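(* Let $F=(f,g):\mathbb{R}^2\to\mathbb{R}^2$ be a polynomial map whose Jacobian determinant $\det DF$ vanishes nowhere on $\mathbb{R}^2$ and such that $F(0,0)=(0,0)$. Let $\mathcal{X}=(-ff_y-gg_y,\ ff_x+gg_x)$ be the associated Hamiltonian polynomial vector field, and let $b(\mathcal{X})$ be its Bendixson compactification, a polynomial vector field on $\mathbb{R}^2$ with coordinates $(u,v)$. Then the following statements are equivalent. (a) $F$ is a global diffeomorphism of the plane onto itself. (b) The origin of the polynomial vector field $b(\mathcal{X})$ is a center. (c) The origin of the polynomial vector field $b(\mathcal{X})$ is a monodromic singular point. (d) The origin of the polynomial vector field $b(\mathcal{X})$ has no hyperbolic sectors. (e) The polynomial vector field $b(\mathcal{X})$ has a $C^k$ first integral with an isolated minimum at the origin, where $k\in\mathbb{N}^+\cup\{\infty\}$.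
   Context: Subscripts $x,y$ denote partial derivatives. A planar vector field $(P,Q)$ is identified with the system $\dot x=P(x,y)$, $\dot y=Q(x,y)$. Bendixson compactification: for real polynomials $P,Q$ with $d=\max\{\deg P,\deg Q\}$ and $\mathscr{X}=(P,Q)$, $b(\mathscr{X})$ is the polynomial vector field in $(u,v)$ given by $$\dot u=(u^2+v^2)^d\Big[(v^2-u^2)P\Big(\tfrac{u}{u^2+v^2},\tfrac{v}{u^2+v^2}\Big)-2uv\,Q\Big(\tfrac{u}{u^2+v^2},\tfrac{v}{u^2+v^2}\Big)\Big],$$ $$\dot v=(u^2+v^2)^d\Big[(u^2-v^2)Q\Big(\tfrac{u}{u^2+v^2},\tfrac{v}{u^2+v^2}\Big)-2uv\,P\Big(\tfrac{u}{u^2+v^2},\tfrac{v}{u^2+v^2}\Big)\Big]$$ (these expressions are polynomials in $u,v$, and are extended to the origin as such). It is obtained from $\mathscr{X}$ by the change of variables $u=x/(x^2+y^2)$, $v=y/(x^2+y^2)$ and a rescaling of time. Let $q$ be a singular point of an analytic planar vector field. It is monodromic if there is a neighborhood of $q$ such that the orbits of the vector field in it turn around $q$ either in forward or in backward time. It is a center if it has a neighborhood filled up with periodic orbits (apart from $q$ itself). A hyperbolic sector of $q$ is a local region with vertex $q$, bounded by two orbits (separatrices of $q$), in which all orbits resemble hyperbolae, in the sense of the standard decomposition of a neighborhood of an isolated singular point (that is neither a center nor a focus) into finitely many hyperbolic, elliptic and parabolic sectors. A first integral of a vector field on an open set $U\subset\mathbb{R}^2$ is a non-locally-constant function $H:U\to\mathbb{R}$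 that is constant along every solution curve contained in $U$. *)

theory Defs
  imports
    "HOL-Analysis.Analysis"
    "HOL-Computational_Algebra.Computational_Algebra"
    "HOL-Library.Extended_Nat"
begin

section \<open>Real polynomials in two variables\<close>

text \<open>A polynomial in \<open>x, y\<close> is an element of \<open>\<real>[y][x]\<close>: the outer variable is \<open>x\<close>, the inner one
  is \<open>y\<close>, and the coefficient of \<open>x^i y^j\<close> is \<^term>\<open>coeff (coeff p i) j\<close>.\<close>

type_synonym poly_xy = "real poly poly"

definition eval_xy :: "poly_xy \<Rightarrow> real \<Rightarrow> real \<Rightarrow> real" where
  "eval_xy p x y = poly (poly p [:x:]) y"

definition var_x :: poly_xy where
  "var_x = [:0, 1:]"

definition var_y :: poly_xy where
  "var_y = [:[:0, 1:]:]"

definition deriv_x :: "poly_xy \<Rightarrow> poly_xy" where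
  "deriv_x p = pderiv p"

definition deriv_y :: "poly_xy \<Rightarrow> poly_xy" where
  "deriv_y p = map_poly pderiv p"

text \<open>The zero polynomial gets total degree 0.\<close>

definition total_degree :: "poly_xy \<Rightarrow> nat" where
  "total_degree p = Max (insert 0 {i + j | i j. coeff (coeff p i) j \<noteq> 0})"

lemma eval_xy_simps [simp]:
  "eval_xy 0 x y = 0" "eval_xy 1 x y = 1"
  "eval_xy (p + q) x y = eval_xy p x y + eval_xy q x y"
  "eval_xy (p - q) x y = eval_xy p x y - eval_xy q x y"
  "eval_xy (- p) x y = - eval_xy p x y"
  "eval_xy (p * q) x y = eval_xy p x y * eval_xy q x y"
  "eval_xy (p ^ n) x y = eval_xy p x y ^ n"
  "eval_xy var_x x y = x" "eval_xy var_y x y = y"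
  "eval_xy [:[:c:]:] x y = c" "eval_xy (smult [:c:] p) x y = c * eval_xy p x y"
  by (simp_all add: eval_xy_def var_x_def var_y_def poly_power)

lemma eval_xy_sum [simp]: "eval_xy (\<Sum>i\<in>A. h i) x y = (\<Sum>i\<in>A. eval_xy (h i) x y)"
  by (simp add: eval_xy_def poly_sum)

lemma eval_xy_altdef:
  "eval_xy p x y =
     (\<Sum>i\<le>degree p. \<Sum>j\<le>degree (coeff p i). coeff (coeff p i) j * x ^ i * y ^ j)"
proof -
  have "eval_xy p x y = poly (\<Sum>i\<le>degree p. coeff p i * [:x:] ^ i) y"
    unfolding eval_xy_def by (subst poly_altdef) simp
  also have "\<dots> = (\<Sum>i\<le>degree p. poly (coeff p i) y * x ^ i)"
    by (simp add: poly_sum poly_power)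
  also have "\<dots> = (\<Sum>i\<le>degree p. \<Sum>j\<le>degree (coeff p i). coeff (coeff p i) j * x ^ i * y ^ j)"
    by (intro sum.cong refl) (simp add: poly_altdef sum_distrib_left sum_distrib_right mult_ac)
  finally show ?thesis .
qed

lemma has_field_derivative_eval_x:
  "((\<lambda>x. eval_xy p x y) has_field_derivative eval_xy (deriv_x p) x y) (at x)"
proof (induction p)
  case 0
  then show ?case by (simp add: deriv_x_def)
next
  case (pCons a p)
  have eq: "(\<lambda>x. eval_xy (pCons a p) x y) = (\<lambda>x. poly a y + x * eval_xy p x y)"
    by (simp add: eval_xy_def fun_eq_iff)
  have d: "eval_xy (deriv_x (pCons a p)) x y = eval_xy p x y + x * eval_xy (deriv_x p) x y"
    by (simp add: eval_xy_def deriv_x_def pderiv_pCons)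
  show ?case
    unfolding eq d by (rule derivative_eq_intros pCons.IH refl | simp)+
qed

lemma has_field_derivative_eval_y:
  "((\<lambda>y. eval_xy p x y) has_field_derivative eval_xy (deriv_y p) x y) (at y)"
proof (induction p)
  case 0
  then show ?case by (simp add: deriv_y_def)
next
  case (pCons a p)
  have eq: "(\<lambda>y. eval_xy (pCons a p) x y) = (\<lambda>y. poly a y + x * eval_xy p x y)"
    by (simp add: eval_xy_def fun_eq_iff)
  have d: "eval_xy (deriv_y (pCons a p)) x y = poly (pderiv a) y + x * eval_xy (deriv_y p) x y"
    using pCons.hyps by (simp add: eval_xy_def deriv_y_def map_poly_pCons)
  show ?case
    unfolding eq d by (rule derivative_eq_intros pCons.IH poly_DERIV refl | simp)+
qed

lemma coeff_le_total_degree: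
  assumes "coeff (coeff p i) j \<noteq> 0"
  shows "i + j \<le> total_degree p"
proof -
  have "{i + j | i j. coeff (coeff p i) j \<noteq> 0}
      \<subseteq> (\<Union>i\<in>{..degree p}. (\<lambda>j. i + j) ` {..degree (coeff p i)})"
  proof
    fix n assume "n \<in> {i + j | i j. coeff (coeff p i) j \<noteq> 0}"
    then obtain a b where ab: "n = a + b" "coeff (coeff p a) b \<noteq> 0" by blast
    from ab(2) have "coeff p a \<noteq> 0" by auto
    with ab show "n \<in> (\<Union>i\<in>{..degree p}. (\<lambda>j. i + j) ` {..degree (coeff p i)})"
      by (auto intro!: bexI[of _ a] le_degree)
  qed
  then have fin: "finite {i + j | i j. coeff (coeff p i) j \<noteq> 0}"
    by (rule finite_subset) auto
  show ?thesis
    unfolding total_degree_def by (rule Max_ge) (use fin assms in auto)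
qed

section \<open>Polynomial maps and planar polynomial vector fields\<close>

text \<open>The pair \<open>(p, q)\<close> induces the map \<open>(x, y) \<mapsto> (p(x, y), q(x, y))\<close>; it is read as a map of the plane
  or as a vector field.\<close>

definition poly_map :: "poly_xy \<times> poly_xy \<Rightarrow> real \<times> real \<Rightarrow> real \<times> real" where
  "poly_map F z = (eval_xy (fst F) (fst z) (snd z), eval_xy (snd F) (fst z) (snd z))"

definition jacobian_det :: "poly_xy \<times> poly_xy \<Rightarrow> poly_xy" where
  "jacobian_det F = deriv_x (fst F) * deriv_y (snd F) - deriv_y (fst F) * deriv_x (snd F)"

definition hamiltonian_field :: "poly_xy \<times> poly_xy \<Rightarrow> poly_xy \<times> poly_xy" where
  "hamiltonian_field F = (case F of (f, g) \<Rightarrow>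
     (- f * deriv_y f - g * deriv_y g, f * deriv_x f + g * deriv_x g))"

text \<open>For \<open>p = \<Sum> a i j x^i y^j\<close> of total degree at most \<open>d\<close>, the expression
  \<open>(u^2 + v^2)^d p(u/(u^2 + v^2), v/(u^2 + v^2))\<close> is the polynomial
  \<open>\<Sum> a i j u^i v^j (u^2 + v^2)^(d - i - j)\<close>; see \<open>eval_inversion_poly\<close> below. The truncated
  subtraction only matters for vanishing coefficients.\<close>

definition inversion_poly :: "nat \<Rightarrow> poly_xy \<Rightarrow> poly_xy" where
  "inversion_poly d p =
     (\<Sum>i\<le>degree p. \<Sum>j\<le>degree (coeff p i).
        [:[:coeff (coeff p i) j:]:] * var_x ^ i * var_y ^ j * (var_x\<^sup>2 + var_y\<^sup>2) ^ (d - i - j))"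

definition bendixson :: "poly_xy \<times> poly_xy \<Rightarrow> poly_xy \<times> poly_xy" where
  "bendixson X = (case X of (P, Q) \<Rightarrow>
     let d = max (total_degree P) (total_degree Q);
         P' = inversion_poly d P; Q' = inversion_poly d Q;
         u = var_x; v = var_y
     in ((v\<^sup>2 - u\<^sup>2) * P' - 2 * u * v * Q', (u\<^sup>2 - v\<^sup>2) * Q' - 2 * u * v * P'))"

lemma eval_inversion_poly:
  assumes "total_degree p \<le> d" and "(u, v) \<noteq> (0, 0)"
  shows "eval_xy (inversion_poly d p) u v =
    (u\<^sup>2 + v\<^sup>2) ^ d * eval_xy p (u / (u\<^sup>2 + v\<^sup>2)) (v / (u\<^sup>2 + v\<^sup>2))"
proof -
  define r where "r = u\<^sup>2 + v\<^sup>2"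
  have r: "r \<noteq> 0"
    using assms(2) unfolding r_def by (simp add: sum_power2_eq_zero_iff)
  have term_eq: "c * u ^ i * v ^ j * r ^ (d - i - j) = r ^ d * (c * (u / r) ^ i * (v / r) ^ j)"
    if "c = coeff (coeff p i) j" for c i j
  proof (cases "c = 0")
    case False
    then have "i + j \<le> d"
      using coeff_le_total_degree[of p i j] that assms(1) by simp
    then have "r ^ d = r ^ (d - i - j) * r ^ i * r ^ j"
      by (simp flip: power_add)
    then show ?thesis
      using r by (simp add: power_divide)
  qed simp
  show ?thesis
    unfolding inversion_poly_def r_def[symmetric] eval_xy_altdef[of p]
    unfolding eval_xy_sum sum_distrib_left
    by (intro sum.cong refl, subst term_eq[OF refl, symmetric])
      (simp add: mult.assoc del: diff_diff_left flip: r_def)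
qed

lemma poly_map_bendixson:
  fixes P Q :: poly_xy and u v :: real
  defines "d \<equiv> max (total_degree P) (total_degree Q)"
    and "P\<^sub>0 \<equiv> eval_xy P (u / (u\<^sup>2 + v\<^sup>2)) (v / (u\<^sup>2 + v\<^sup>2))"
    and "Q\<^sub>0 \<equiv> eval_xy Q (u / (u\<^sup>2 + v\<^sup>2)) (v / (u\<^sup>2 + v\<^sup>2))"
  assumes "(u, v) \<noteq> (0, 0)"
  shows "poly_map (bendixson (P, Q)) (u, v) =
    ((u\<^sup>2 + v\<^sup>2) ^ d * ((v\<^sup>2 - u\<^sup>2) * P\<^sub>0 - 2 * u * v * Q\<^sub>0),
     (u\<^sup>2 + v\<^sup>2) ^ d * ((u\<^sup>2 - v\<^sup>2) * Q\<^sub>0 - 2 * u * v * P\<^sub>0))"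
proof -
  have two: "eval_xy 2 u v = 2"
    by (metis eval_xy_simps(2,3) one_add_one)
  have "eval_xy (inversion_poly d P) u v = (u\<^sup>2 + v\<^sup>2) ^ d * P\<^sub>0"
    "eval_xy (inversion_poly d Q) u v = (u\<^sup>2 + v\<^sup>2) ^ d * Q\<^sub>0"
    using assms(4) unfolding d_def P\<^sub>0_def Q\<^sub>0_def 
    by (simp_all only: eval_inversion_poly max.cobounded1 max.cobounded2 not_False_eq_True)
  then show ?thesis
    unfolding poly_map_def bendixson_def Let_def prod.case d_def[symmetric]
    by (simp add: two algebra_simps)
qed

section \<open>Regularity\<close>

text \<open>On an open set: \<open>C^0\<close> is continuity, and \<open>C^(n+1)\<close> means differentiable with all partial
  derivatives of class \<open>C^n\<close>.\<close>

primrec Cn_on ::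
  "nat \<Rightarrow> 'a::euclidean_space set \<Rightarrow> ('a \<Rightarrow> 'b::real_normed_vector) \<Rightarrow> bool" where
  "Cn_on 0 U f \<longleftrightarrow> continuous_on U f"
| "Cn_on (Suc n) U f \<longleftrightarrow>
     (\<forall>z\<in>U. f differentiable (at z)) \<and>
     (\<forall>b\<in>Basis. Cn_on n U (\<lambda>z. frechet_derivative f (at z) b))"

definition Ck_on ::
  "enat \<Rightarrow> 'a::euclidean_space set \<Rightarrow> ('a \<Rightarrow> 'b::real_normed_vector) \<Rightarrow> bool" where
  "Ck_on k U f \<longleftrightarrow> (\<forall>n. enat n \<le> k \<longrightarrow> Cn_on n U f)"

definition global_diffeomorphism :: "('a::euclidean_space \<Rightarrow> 'a) \<Rightarrow> bool" where
  "global_diffeomorphism F \<longleftrightarrow> bij F \<and> Ck_on \<infinity> UNIV F \<and> Ck_on \<infinity> UNIV (inv F)"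

section \<open>Solutions and singular points of planar vector fields\<close>

type_synonym vfield = "real \<times> real \<Rightarrow> real \<times> real"

definition solves :: "vfield \<Rightarrow> (real \<Rightarrow> real \<times> real) \<Rightarrow> real set \<Rightarrow> bool" where
  "solves W \<gamma> I \<longleftrightarrow>
     is_interval I \<and> (\<forall>t\<in>I. (\<gamma> has_vector_derivative W (\<gamma> t)) (at t within I))"

definition is_center :: "vfield \<Rightarrow> real \<times> real \<Rightarrow> bool" where
  "is_center W q \<longleftrightarrow> W q = 0 \<and>
     (\<exists>U. open U \<and> q \<in> U \<and>
       (\<forall>p\<in>U - {q}. W p \<noteq> 0 \<and>
         (\<exists>\<gamma> T. T > 0 \<and> solves W \<gamma> UNIV \<and> \<gamma> 0 = p \<and> (\<forall>t. \<gamma> (t + T) = \<gamma> t) \<and>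
                range \<gamma> \<subseteq> U - {q})))"

text \<open>The forward semi-orbit of \<open>p\<close> stays in \<open>V - {q}\<close> and winds infinitely often around \<open>q\<close>:
  \<open>\<theta>\<close> is a continuous choice of the polar angle about \<open>q\<close>.\<close>

definition turns_around :: "vfield \<Rightarrow> real \<times> real \<Rightarrow> (real \<times> real) set \<Rightarrow> real \<times> real \<Rightarrow> bool" where
  "turns_around W q V p \<longleftrightarrow>
     (\<exists>\<gamma> \<theta>. solves W \<gamma> {0..} \<and> \<gamma> 0 = p \<and> \<gamma> ` {0..} \<subseteq> V - {q} \<and>
        continuous_on {0..} \<theta> \<and>
        (\<forall>t\<ge>0. \<gamma> t - q = norm (\<gamma> t - q) *\<^sub>R (cos (\<theta> t), sin (\<theta> t))) \<and>
        filterlim (\<lambda>t. \<bar>\<theta> t\<bar>) at_top at_top)"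

text \<open>Backward time is forward time for \<open>- W\<close>. The quantification over all neighbourhoods \<open>V\<close> makes
  the notion local: with one fixed neighbourhood, a node in the interior of a limit cycle would
  qualify, since its orbits wind around it when they approach the cycle.\<close>

definition is_monodromic :: "vfield \<Rightarrow> real \<times> real \<Rightarrow> bool" where
  "is_monodromic W q \<longleftrightarrow> W q = 0 \<and>
     (\<forall>V. open V \<and> q \<in> V \<longrightarrow>
       (\<exists>U. open U \<and> q \<in> U \<and> U \<subseteq> V \<and>
         (\<forall>p\<in>U - {q}. turns_around W q V p \<or> turns_around (\<lambda>z. - W z) q V p)))"

text \<open>A hyperbolic sector is a region that is topologically equivalent to the quadrant
  \<open>[0,1] \<times> [0,1]\<close> of the linear saddle \<open>x' = x, y' = - y\<close>, with vertex \<open>(0,0)\<close>; the axes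
  correspond to the two separatrices and the arcs \<open>x y = c\<close> to the orbits between them.
  Orbit arcs are mapped to orbit arcs, with the sense of time preserved. This is no restriction:
  if a homeomorphism reverses the sense of time, compose it with \<open>(x, y) \<mapsto> (y, x)\<close>.\<close>

definition saddle :: vfield where
  "saddle z = (fst z, - snd z)"

definition maps_orbits :: "vfield \<Rightarrow> (real \<times> real) set \<Rightarrow> vfield \<Rightarrow> (real \<times> real \<Rightarrow> real \<times> real) \<Rightarrow> bool" where
  "maps_orbits V A W h \<longleftrightarrow>
     (\<forall>\<sigma> I. solves V \<sigma> I \<and> \<sigma> ` I \<subseteq> A \<longrightarrow>
       (\<exists>\<gamma> \<tau>. continuous_on I \<tau> \<and> strict_mono_on I \<tau> \<and> solves W \<gamma> (\<tau> ` I) \<and>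
          (\<forall>t\<in>I. h (\<sigma> t) = \<gamma> (\<tau> t))))"

definition hyperbolic_sector :: "vfield \<Rightarrow> real \<times> real \<Rightarrow> (real \<times> real) set \<Rightarrow> bool" where
  "hyperbolic_sector W q S \<longleftrightarrow>
     (\<exists>h h'. homeomorphism ({0..1} \<times> {0..1}) S h h' \<and> h (0, 0) = q \<and>
        maps_orbits saddle ({0..1} \<times> {0..1}) W h)"

section \<open>First integrals\<close>

text \<open>Non-locally-constant: not constant on any nonempty open subset.\<close>

definition first_integral_on :: "vfield \<Rightarrow> (real \<times> real) set \<Rightarrow> (real \<times> real \<Rightarrow> real) \<Rightarrow> bool" where
  "first_integral_on W U H \<longleftrightarrow> open U \<and>
     (\<forall>V. open V \<and> V \<noteq> {} \<and> V \<subseteq> U \<longrightarrow> \<not> H constant_on V) \<and>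
     (\<forall>\<gamma> I. solves W \<gamma> I \<and> \<gamma> ` I \<subseteq> U \<longrightarrow> (\<lambda>t. H (\<gamma> t)) constant_on I)"

definition isolated_minimum_at :: "(real \<times> real \<Rightarrow> real) \<Rightarrow> real \<times> real \<Rightarrow> bool" where
  "isolated_minimum_at H q \<longleftrightarrow> (\<forall>\<^sub>F p in at q. H q < H p)"

end

theory Submission
  imports Defs
begin

text \<open>Along \<open>X\<close> the map \<open>F\<close> rotates about the origin, with angular velocity the Jacobian determinant,
  which may be taken to be positive after exchanging \<open>f\<close> and \<open>g\<close>. So the orbits of \<open>b(X)\<close> off the
  origin are the inverted lifts through \<open>F\<close> of arcs of circles about the origin, and the origin is
  reached where such a lift goes to infinity.

  If \<open>F\<close> is bijective, then all lifts are closed curves around the origin, and \<open>|F|\<close> tends to infinity.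
  Hence the origin is a monodromic center without hyperbolic sectors. The function \<open>exp (- |F|\<^sup>2)\<close> is a
  first integral that is flat at the origin, because \<open>|F|\<close> grows at least like a power of the norm.

  If \<open>F\<close> is not bijective, take the inverse branch of \<open>F\<close> at the origin on its maximal starlike domain
  and the largest disc in that domain. Some, but not all, points of the bounding circle are missing
  (otherwise \<open>F\<close> would be bounded), and the branch blows up at each of them. An arc between two missing
  points gives an orbit that goes from the origin to the origin: it is neither closed nor, since
  it meets the x-axis in finitely many points, winding. A polynomial has a bounded number of zeros on
  circles, so there are finitely many such arcs. The lifts of circles slightly inside the disc, together
  with two consecutive arcs, form a hyperbolic sector. A continuous first integral is constant on a
  separatrix, so it has no isolated minimum at the origin.\<close>

section \<open>Reparametrization of curves\<close>

text \<open>The missing points may fill whole arcs of the bounding circle, and a priori the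
  remaining arcs could be arranged like the gaps of a Cantor set, with no two of them consecutive.
  Hence the count of arcs precedes the construction of a sector, and the vertex of the sector
  absorbs an entire interval of missing angles. The rate comes from an algebraic relation, which any
  three polynomials in two variables satisfy. It is applied to a quadratic form, to
  \<open>|F|\<^sup>2\<close>, and to the derivative of \<open>|F|\<^sup>2\<close> along the level
  ellipses of the form. The last one vanishes at a minimum of \<open>|F|\<close> on an ellipse, so
  the relation ties that minimum to the size of the ellipse. Circles alone would not do, because
  \<open>|F|\<close> may be constant on them.\<close>

lemma interval_antiderivative:
  fixes f :: "real \<Rightarrow> real"
  assumes I: "is_interval I" and f: "continuous_on I f"
  shows "\<exists>\<Phi>. \<forall>t\<in>I. (\<Phi> has_real_derivative f t) (at t within I)"
proof (cases "I = {}")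
  case False
  then obtain t0 where t0: "t0 \<in> I" by auto
  have sub: "{a..b} \<subseteq> I" if "a \<in> I" "b \<in> I" for a b
    using I that by (meson atLeastAtMost_iff mem_is_interval_1_I subsetI)
  \<comment> \<open>At least one of the two integrals is over an empty or degenerate interval and
    vanishes, so this is the integral from \<open>t0\<close> to \<open>t\<close> with its
    sign.\<close>
  define \<Phi> where "\<Phi> = (\<lambda>t. integral {t0..t} f - integral {t..t0} f)"
  have eq: "\<Phi> s = integral {a..s} f - integral {a..t0} f"
    if "a \<in> I" "a \<le> t0" "a \<le> s" "s \<in> I" for a s
  proof (cases "t0 \<le> s")
    case True
    have "f integrable_on {a..s}"
      using f sub[OF that(1,4)] by (meson continuous_on_subset integrable_continuous_real)
    from Henstock_Kurzweil_Integration.integral_combine[OF that(2) True this] True show ?thesis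
      unfolding \<Phi>_def by (cases "s = t0") auto
  next
    case False
    have "f integrable_on {a..t0}"
      using f sub[OF that(1) t0] by (meson continuous_on_subset integrable_continuous_real)
    from Henstock_Kurzweil_Integration.integral_combine[OF that(3) _ this] False show ?thesis
      unfolding \<Phi>_def by auto
  qed
  have "(\<Phi> has_real_derivative f t) (at t within I)" if t: "t \<in> I" for t
  proof -
    \<comment> \<open>If \<open>t\<close> is the left end of \<open>I\<close>, the witness is
      \<open>t\<close> itself; otherwise it lies strictly to the left. Together with
      \<open>b1\<close> this yields a compact interval that coincides with \<open>I\<close> near
      \<open>t\<close>, so that derivatives at an end of \<open>I\<close> are one-sided.\<close>
    obtain a1 where a1: "a1 \<in> I" "a1 \<le> t" "a1 < t \<or> (\<forall>s\<in>I. t \<le> s)"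
      using t by (metis linorder_not_le order.refl order_less_imp_le)
    obtain b1 where b1: "b1 \<in> I" "t \<le> b1" "t < b1 \<or> (\<forall>s\<in>I. s \<le> t)"
      using t by (metis linorder_not_le order.refl order_less_imp_le)
    define a b where "a = min a1 t0" and "b = max b1 t0"
    have ab: "a \<in> I" "b \<in> I" "a \<le> t0" "a \<le> t" "t \<le> b"
      unfolding a_def b_def using a1 b1 t0 by (auto simp: min_def max_def)
    have "((\<lambda>s. integral {a..s} f - integral {a..t0} f) has_real_derivative f t) (at t within {a..b})"
      using integral_has_real_derivative[OF continuous_on_subset[OF f sub[OF ab(1,2)]], of t] ab
      by (auto intro!: derivative_eq_intros)
    then have "(\<Phi> has_real_derivative f t) (at t within {a..b})"
    proof (rule has_field_derivative_transform_within[OF _ zero_less_one])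
      show "integral {a..s} f - integral {a..t0} f = \<Phi> s" if "s \<in> {a..b}" for s
        by (rule eq[symmetric]) (use that ab sub[OF ab(1,2)] in auto)
    qed (use ab in auto)
    moreover define S where "S = {s. (a1 < t \<longrightarrow> a1 < s) \<and> (t < b1 \<longrightarrow> s < b1)}"
    have "open S"
      unfolding S_def by (cases "a1 < t"; cases "t < b1"; simp add: open_Collect_conj)
        (auto intro!: open_Collect_conj open_Collect_less continuous_intros)
    then have "at t within I = at t within {a..b}"
    proof (intro at_within_nhd)
      show "t \<in> S" by (auto simp: S_def)
      show "I \<inter> S - {t} = {a..b} \<inter> S - {t}"
      proof -
        have "a1 \<le> s" if "s \<in> I" "s \<in> S" for s
          using a1(3)
        proof
          assume "a1 < t" then show ?thesis using that(2) by (simp add: S_def)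
        next
          assume "\<forall>s\<in>I. t \<le> s" then show ?thesis using that(1) a1(2) by fastforce
        qed
        moreover have "s \<le> b1" if "s \<in> I" "s \<in> S" for s
          using b1(3)
        proof
          assume "t < b1" then show ?thesis using that(2) by (simp add: S_def)
        next
          assume "\<forall>s\<in>I. s \<le> t" then show ?thesis using that(1) b1(2) by fastforce
        qed
        ultimately have "s \<in> {a..b}" if "s \<in> I" "s \<in> S" for s
          using that by (simp add: a_def b_def min.coboundedI1 max.coboundedI1)
        with sub[OF ab(1,2)] show ?thesis by blast
      qed
    qed
    ultimately show ?thesis by simp
  qed
  then show ?thesis by blast
qed simp

lemma positive_derivative_strict_mono_on:
  fixes \<tau> \<kappa> :: "real \<Rightarrow> real"
  assumes I: "is_interval I" and d: "\<And>t. t \<in> I \<Longrightarrow> (\<tau> has_real_derivative \<kappa> t) (at t within I)"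
    and pos: "\<And>t. t \<in> I \<Longrightarrow> 0 < \<kappa> t"
  shows "strict_mono_on I \<tau>"
proof (rule strict_mono_onI)
  fix r s assume rs: "r \<in> I" "s \<in> I" "r < s"
  have sub: "{r..s} \<subseteq> I"
    using I rs by (meson atLeastAtMost_iff mem_is_interval_1_I subsetI)
  have d': "(\<tau> has_real_derivative \<kappa> x) (at x)" if "r < x" "x < s" for x
  proof -
    have "(\<tau> has_real_derivative \<kappa> x) (at x within {r<..<s})"
      by (rule DERIV_subset[OF d]) (use sub that in auto)
    then show ?thesis using that by (simp add: at_within_open[of x "{r<..<s}"])
  qed
  have cont: "continuous_on {r..s} \<tau>"
    by (rule DERIV_continuous_on, rule DERIV_subset[OF d]) (use sub in auto)
  show "\<tau> r < \<tau> s"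
  proof (rule DERIV_pos_imp_increasing_open[OF rs(3) _ cont])
    fix x assume "r < x" "x < s"
    moreover from this sub have "x \<in> I" by auto
    ultimately show "\<exists>y. (\<tau> has_real_derivative y) (at x) \<and> 0 < y"
      using d' pos by blast
  qed
qed

text \<open>The curve runs along \<open>W\<close> with speed factor \<open>\<kappa>\<close>; in the
  new time, an antiderivative of \<open>\<kappa>\<close>, it becomes a solution. Lifts of circles
  are naturally parametrized by the angle, and this passes from the angle to the time of the
  field.\<close>

lemma reparametrize_to_solution:
  fixes s :: "real \<Rightarrow> real \<times> real" and \<kappa> \<tau> :: "real \<Rightarrow> real"
  assumes I: "is_interval I"
    and s: "\<And>t. t \<in> I \<Longrightarrow> (s has_vector_derivative \<kappa> t *\<^sub>R W (s t)) (at t within I)"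
    and \<tau>: "\<And>t. t \<in> I \<Longrightarrow> (\<tau> has_real_derivative \<kappa> t) (at t within I)"
    and pos: "\<And>t. t \<in> I \<Longrightarrow> 0 < \<kappa> t"
  shows "continuous_on I \<tau>" "strict_mono_on I \<tau>"
    "solves W (\<lambda>r. s (the_inv_into I \<tau> r)) (\<tau> ` I)"
    "\<And>t. t \<in> I \<Longrightarrow> s (the_inv_into I \<tau> (\<tau> t)) = s t"
proof -
  show cont: "continuous_on I \<tau>"
    using \<tau> by (rule DERIV_continuous_on)
  show mono: "strict_mono_on I \<tau>"
    by (rule positive_derivative_strict_mono_on[OF I \<tau> pos])
  have inj: "inj_on \<tau> I" using mono by (rule strict_mono_on_imp_inj_on)
  let ?g = "the_inv_into I \<tau>"
  show g: "s (?g (\<tau> t)) = s t" if "t \<in> I" for t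
    using the_inv_into_f_f[OF inj that] by simp
  have gg: "?g (\<tau> t) = t" if "t \<in> I" for t
    using the_inv_into_f_f[OF inj that] by simp
  have pc: "path_connected I" using I by (simp add: is_interval_path_connected_1)
  obtain g' where g': "homeomorphism I (\<tau> ` I) \<tau> g'"
    using injective_into_1d_eq_homeomorphism[OF cont pc] inj by blast
  have cg: "continuous_on (\<tau> ` I) ?g"
    by (rule continuous_on_eq[OF homeomorphism_cont2[OF g']])
       (use g' gg in \<open>auto simp: homeomorphism_def\<close>)
  have der: "((\<lambda>r. s (?g r)) has_vector_derivative W (s (?g r))) (at r within \<tau> ` I)"
    if "r \<in> \<tau> ` I" for r
  proof -
    obtain t where t: "t \<in> I" "r = \<tau> t" using \<open>r \<in> \<tau> ` I\<close> by blast
    have "(?g has_derivative (\<lambda>h. h / \<kappa> t)) (at (\<tau> t) within \<tau> ` I)"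
    proof (rule has_derivative_inverse_within)
      show "(\<tau> has_derivative (\<lambda>h. \<kappa> t * h)) (at t within I)"
        using \<tau>[OF t(1)] by (simp add: has_field_derivative_def)
      show "continuous (at (\<tau> t) within \<tau> ` I) ?g"
        using cg t by (simp add: continuous_on_eq_continuous_within)
      show "linear (\<lambda>h. h / \<kappa> t)"
        by (simp add: bounded_linear.linear bounded_linear_divide)
      show "(\<lambda>h. h / \<kappa> t) \<circ> (*) (\<kappa> t) = id"
        using pos[OF t(1)] by auto
    qed (use t gg in auto)
    moreover have "(s has_derivative (\<lambda>h. h *\<^sub>R (\<kappa> t *\<^sub>R W (s t)))) (at t within I)"
      using s[OF t(1)] by (simp add: has_vector_derivative_def)
    moreover have "?g ` \<tau> ` I = I" using gg by (force simp: image_image)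
    ultimately have "(s \<circ> ?g has_derivative (\<lambda>h. h *\<^sub>R (\<kappa> t *\<^sub>R W (s t))) \<circ> (\<lambda>h. h / \<kappa> t))
        (at (\<tau> t) within \<tau> ` I)"
      using gg[OF t(1)] by (intro diff_chain_within) auto
    then show ?thesis
      using pos[OF t(1)] gg[OF t(1)] t(2) by (simp add: has_vector_derivative_def o_def)
  qed
  have "is_interval (\<tau> ` I)"
    using I cont connected_continuous_image is_interval_connected_1 by blast
  with der show "solves W (\<lambda>r. s (?g r)) (\<tau> ` I)"
    unfolding solves_def by blast
qed

section \<open>Polynomials in two variables\<close>

lemma eval_xy_pCons: "eval_xy (pCons a p) x y = poly a y + x * eval_xy p x y"
  by (simp add: eval_xy_def)

lemma eval_xy_has_derivative:
  "((\<lambda>z. eval_xy p (fst z) (snd z)) has_derivative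
     (\<lambda>h. eval_xy (deriv_x p) (fst z) (snd z) * fst h + eval_xy (deriv_y p) (fst z) (snd z) * snd h))
   (at z)"
proof (induction p)
  case 0
  then show ?case by (simp add: deriv_x_def deriv_y_def)
next
  case (pCons a p)
  have x: "eval_xy (deriv_x (pCons a p)) x y = eval_xy p x y + x * eval_xy (deriv_x p) x y" for x y
    by (simp add: eval_xy_def deriv_x_def pderiv_pCons)
  have y: "eval_xy (deriv_y (pCons a p)) x y = poly (pderiv a) y + x * eval_xy (deriv_y p) x y" for x y
    using pCons.hyps by (simp add: eval_xy_def deriv_y_def map_poly_pCons)
  have "((\<lambda>z::real \<times> real. poly a (snd z)) has_derivative (\<lambda>h. snd h * poly (pderiv a) (snd z))) (at z)"
    using has_derivative_compose[OF has_derivative_snd[OF has_derivative_ident]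
        poly_DERIV[unfolded has_field_derivative_def]] by (simp add: mult.commute)
  from has_derivative_add[OF this has_derivative_mult[OF has_derivative_fst[OF has_derivative_ident] pCons.IH]]
  show ?case
    unfolding eval_xy_pCons x y by (rule has_derivative_eq_rhs) (auto simp: algebra_simps)
qed

lemma continuous_on_eval_xy [continuous_intros]:
  assumes "continuous_on A a" "continuous_on A b"
  shows "continuous_on A (\<lambda>t. eval_xy p (a t) (b t))"
  by (induction p) (auto simp: eval_xy_pCons eval_xy_simps(1) intro!: continuous_intros assms continuous_on_poly)

text \<open>At fixed \<open>x\<close> a section is the polynomial \<open>poly p [:x:]\<close> by
  definition; at fixed \<open>y\<close> the coefficients must be evaluated first.\<close>

lemma eval_xy_section: "\<exists>q. \<forall>x. poly q x = eval_xy p x y"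
proof
  show "\<forall>x. poly (\<Sum>i\<le>degree p. monom (poly (coeff p i) y) i) x = eval_xy p x y"
    unfolding eval_xy_def by (subst (2) poly_altdef) (simp add: poly_sum poly_monom poly_power)
qed

lemma bounded_poly_const:
  fixes p :: "real poly"
  assumes "\<And>x. \<bar>poly p x\<bar> \<le> M"
  shows "degree p = 0"
proof (rule ccontr)
  assume "degree p \<noteq> 0"
  then obtain a q where p: "p = pCons a q" "q \<noteq> 0"
    by (cases p) (auto split: if_splits)
  then obtain r where "\<And>z. r \<le> norm z \<Longrightarrow> M + 1 \<le> norm (poly (pCons a q) z)"
    using poly_infinity[of q "M + 1" a] by blast
  from this[of "\<bar>r\<bar>"] assms[of "\<bar>r\<bar>"] p abs_ge_self[of r] show False by simp
qed

lemma bounded_eval_xy_imp_deriv_zero: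
  assumes "\<And>x y. \<bar>eval_xy p x y\<bar> \<le> M"
  shows "eval_xy (deriv_x p) x y = 0" "eval_xy (deriv_y p) x y = 0"
proof -
  have "degree (poly p [:x:]) = 0"
    by (rule bounded_poly_const[of _ M]) (use assms in \<open>simp add: eval_xy_def\<close>)
  then obtain c where "poly p [:x:] = [:c:]" using degree_eq_zeroE by blast
  then have "((\<lambda>y. eval_xy p x y) has_field_derivative 0) (at y)"
    by (simp add: eval_xy_def)
  then show "eval_xy (deriv_y p) x y = 0"
    using has_field_derivative_eval_y DERIV_unique by blast
  obtain q where q: "\<And>x. poly q x = eval_xy p x y" using eval_xy_section by blast
  have "degree q = 0"
    by (rule bounded_poly_const[of _ M]) (use assms q in simp)
  then obtain c where "q = [:c:]" using degree_eq_zeroE by blast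
  then have "(\<lambda>x. eval_xy p x y) = (\<lambda>x. c)" using q by auto
  then have "((\<lambda>x. eval_xy p x y) has_field_derivative 0) (at x)"
    by simp
  then show "eval_xy (deriv_x p) x y = 0"
    using has_field_derivative_eval_x DERIV_unique by blast
qed

lemma eval_xy_polynomial_growth:
  "\<exists>C M. 0 \<le> C \<and> (\<forall>x y. \<bar>eval_xy p x y\<bar> \<le> C * (1 + norm (x, y)) ^ M)"
proof -
  define M where "M = total_degree p"
  define C where "C = (\<Sum>i\<le>degree p. \<Sum>j\<le>degree (coeff p i). \<bar>coeff (coeff p i) j\<bar>)"
  have "\<bar>eval_xy p x y\<bar> \<le> C * (1 + norm (x, y)) ^ M" for x y
  proof -
    define r where "r = 1 + norm (x, y)"
    have r: "1 \<le> r" "\<bar>x\<bar> \<le> r" "\<bar>y\<bar> \<le> r"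
      using norm_fst_le[of x y] norm_snd_le[of y x] by (auto simp: r_def)
    have "\<bar>coeff (coeff p i) j * x ^ i * y ^ j\<bar> \<le> \<bar>coeff (coeff p i) j\<bar> * r ^ M" for i j
    proof (cases "coeff (coeff p i) j = 0")
      case False
      then have "i + j \<le> M" using coeff_le_total_degree M_def by blast
      have "\<bar>x\<bar> ^ i * \<bar>y\<bar> ^ j \<le> r ^ i * r ^ j"
        using r by (intro mult_mono power_mono) auto
      also have "\<dots> \<le> r ^ M"
        using r \<open>i + j \<le> M\<close> by (simp flip: power_add add: power_increasing)
      finally show ?thesis
        by (simp add: abs_mult power_abs mult.assoc mult_left_mono)
    qed simp
    then have "\<bar>eval_xy p x y\<bar> \<le> (\<Sum>i\<le>degree p. \<Sum>j\<le>degree (coeff p i). \<bar>coeff (coeff p i) j\<bar> * r ^ M)"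
      unfolding eval_xy_altdef by (intro order.trans[OF sum_abs] sum_mono) auto
    then show ?thesis by (simp add: C_def r_def sum_distrib_right)
  qed
  moreover have "0 \<le> C" by (auto simp: C_def intro!: sum_nonneg)
  ultimately show ?thesis by blast
qed

text \<open>With \<open>w\<close> on the complex unit circle, the coordinates are \<rho> (w + 1/w) /
  2 and \<rho> (w - 1/w) / (2 i). Multiplication by \<open>w ^ D\<close>, for the total degree
  \<open>D\<close>, clears the denominators and leaves a complex polynomial of degree at most
  \<open>2 * D\<close>; the point \<open>z0\<close> shows that it is not zero.\<close>

lemma zeros_on_circle:
  assumes "0 < \<rho>" and z0: "norm z0 = \<rho>" "eval_xy q (fst z0) (snd z0) \<noteq> 0"
  defines "Z \<equiv> {z. norm z = \<rho> \<and> eval_xy q (fst z) (snd z) = 0}"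
  shows "finite Z" "card Z \<le> 2 * total_degree q"
proof -
  define D where "D = total_degree q"
  define P :: "complex poly" where "P = (\<Sum>i\<le>degree q. \<Sum>j\<le>degree (coeff q i).
      smult (of_real (coeff (coeff q i) j))
        ([:of_real \<rho> / 2, 0, of_real \<rho> / 2:] ^ i *
         [:- (of_real \<rho> / (2 * \<i>)), 0, of_real \<rho> / (2 * \<i>):] ^ j * monom 1 (D - (i + j))))"
  have degP: "degree P \<le> 2 * D"
    unfolding P_def
  proof (intro degree_sum_le finite_atMost)
    fix i j
    let ?A = "[:of_real \<rho> / 2, 0, of_real \<rho> / 2:] :: complex poly"
    let ?B = "[:- (of_real \<rho> / (2 * \<i>)), 0, of_real \<rho> / (2 * \<i>):] :: complex poly"
    show "degree (smult (of_real (coeff (coeff q i) j)) (?A ^ i * ?B ^ j * monom 1 (D - (i + j)))) \<le> 2 * D"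
    proof (cases "coeff (coeff q i) j = 0")
      case False
      then have ij: "i + j \<le> D" using coeff_le_total_degree D_def by blast
      have "degree (?A ^ i) \<le> 2 * i" "degree (?B ^ j) \<le> 2 * j"
        by (rule order.trans[OF degree_power_le]; simp)+
      then have "degree (?A ^ i * ?B ^ j * monom 1 (D - (i + j))) \<le> (2 * i + 2 * j) + (D - (i + j))"
        by (intro order.trans[OF degree_mult_le] add_mono degree_monom_le) auto
      with ij show ?thesis using False by simp
    qed simp
  qed
  have ev: "poly P w = w ^ D * of_real (eval_xy q (\<rho> * Re w) (\<rho> * Im w))" if w: "norm w = 1" for w
  proof -
    have ww: "w * cnj w = 1" using w by (simp add: complex_norm_square[symmetric])
    have a: "of_real \<rho> / 2 + w * (w * (of_real \<rho> / 2)) = w * of_real (\<rho> * Re w)"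
    proof -
      have re: "of_real (Re w) = (w + cnj w) / 2" by (simp add: complex_add_cnj)
      have "w * of_real (\<rho> * Re w) = of_real \<rho> * (w * w + w * cnj w) / 2"
        unfolding of_real_mult re by (simp add: algebra_simps)
      then show ?thesis unfolding ww by (simp add: algebra_simps add_divide_distrib)
    qed
    have b: "w * (w * (of_real \<rho> / (2 * \<i>))) - of_real \<rho> / (2 * \<i>) = w * of_real (\<rho> * Im w)"
    proof -
      have im: "of_real (Im w) = (w - cnj w) / (2 * \<i>)" by (simp add: complex_eq_iff)
      have "w * of_real (\<rho> * Im w) = of_real \<rho> * (w * w - w * cnj w) / (2 * \<i>)"
        unfolding of_real_mult im by (simp add: algebra_simps)
      then show ?thesis unfolding ww by (simp add: algebra_simps diff_divide_distrib)
    qed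
    have "poly P w = (\<Sum>i\<le>degree q. \<Sum>j\<le>degree (coeff q i). of_real (coeff (coeff q i) j) *
       ((w * of_real (\<rho> * Re w)) ^ i * (w * of_real (\<rho> * Im w)) ^ j * w ^ (D - (i + j))))"
      unfolding P_def poly_sum a[symmetric] b[symmetric]
      by (simp add: poly_monom poly_power)
    also have "\<dots> = (\<Sum>i\<le>degree q. \<Sum>j\<le>degree (coeff q i).
       w ^ D * of_real (coeff (coeff q i) j * (\<rho> * Re w) ^ i * (\<rho> * Im w) ^ j))"
    proof (intro sum.cong refl)
      fix i j
      show "of_real (coeff (coeff q i) j) *
         ((w * of_real (\<rho> * Re w)) ^ i * (w * of_real (\<rho> * Im w)) ^ j * w ^ (D - (i + j))) =
         w ^ D * of_real (coeff (coeff q i) j * (\<rho> * Re w) ^ i * (\<rho> * Im w) ^ j)"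
      proof (cases "coeff (coeff q i) j = 0")
        case False
        then have "i + j \<le> D" using coeff_le_total_degree D_def by blast
        then have "w ^ D = w ^ i * w ^ j * w ^ (D - (i + j))"
          by (simp flip: power_add)
        then show ?thesis by (simp add: power_mult_distrib mult_ac)
      qed simp
    qed
    finally show ?thesis by (simp add: eval_xy_altdef sum_distrib_left)
  qed
  define \<phi> where "\<phi> = (\<lambda>z::real \<times> real. Complex (fst z / \<rho>) (snd z / \<rho>))"
  have n1: "norm (\<phi> z) = 1" if "norm z = \<rho>" for z
  proof -
    have "(fst z)\<^sup>2 + (snd z)\<^sup>2 = \<rho>\<^sup>2"
      using that assms(1) by (auto simp: norm_prod_def)
    then have "(fst z / \<rho>)\<^sup>2 + (snd z / \<rho>)\<^sup>2 = 1"
      using assms(1) by (simp add: power_divide flip: add_divide_distrib)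
    then show ?thesis by (simp add: \<phi>_def cmod_def)
  qed
  have zz: "poly P (\<phi> z) = 0 \<longleftrightarrow> eval_xy q (fst z) (snd z) = 0" if "norm z = \<rho>" for z
  proof -
    have "\<phi> z \<noteq> 0" using n1[OF that] by auto
    then show ?thesis
      using ev[OF n1[OF that]] assms(1) by (simp add: \<phi>_def)
  qed
  have "P \<noteq> 0" using zz[OF z0(1)] z0(2) by auto
  then have fin: "finite {w. poly P w = 0}" by (rule poly_roots_finite)
  have inj: "inj_on \<phi> Z" using assms(1) by (auto simp: inj_on_def \<phi>_def)
  have sub: "\<phi> ` Z \<subseteq> {w. poly P w = 0}" using zz by (auto simp: Z_def)
  show "finite Z" using finite_imageD[OF finite_subset[OF sub fin] inj] .
  have "card Z = card (\<phi> ` Z)" using card_image[OF inj] by simp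
  also have "\<dots> \<le> card {w. poly P w = 0}" by (rule card_mono[OF fin sub])
  also have "\<dots> \<le> degree P" by (rule card_poly_roots_bound) (use \<open>P \<noteq> 0\<close> in auto)
  finally show "card Z \<le> 2 * total_degree q" using degP by (simp add: D_def)
qed

section \<open>Algebraic dependence\<close>

text \<open>Gaussian elimination by induction on the equations: equation \<open>e\<close> is solved
  for an unknown \<open>v0\<close> with nonzero coefficient and substituted into the others.\<close>

lemma underdetermined_system:
  fixes a :: "'e \<Rightarrow> 'v \<Rightarrow> real"
  assumes "finite E" "finite V" "card E < card V"
  shows "\<exists>x. (\<exists>v\<in>V. x v \<noteq> 0) \<and> (\<forall>e\<in>E. (\<Sum>v\<in>V. a e v * x v) = 0)"
  using assms
proof (induction E arbitrary: V a rule: finite_induct)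
  case empty
  then have "V \<noteq> {}" by auto
  then show ?case by (intro exI[of _ "\<lambda>_. 1"]) auto
next
  case (insert e E)
  show ?case
  proof (cases "\<forall>v\<in>V. a e v = 0")
    case True
    from insert.IH[of V a] insert.prems insert.hyps
    obtain x where "\<exists>v\<in>V. x v \<noteq> 0" "\<forall>e\<in>E. (\<Sum>v\<in>V. a e v * x v) = 0" by auto
    with True show ?thesis by (intro exI[of _ x]) auto
  next
    case False
    then obtain v0 where v0: "v0 \<in> V" "a e v0 \<noteq> 0" by blast
    define b where "b = (\<lambda>e' v. a e' v - a e' v0 * a e v / a e v0)"
    have "card E < card (V - {v0})"
      using insert.prems insert.hyps v0 by simp
    with insert.IH[of "V - {v0}" b] insert.prems obtain x
      where x: "\<exists>v\<in>V-{v0}. x v \<noteq> 0" "\<forall>e\<in>E. (\<Sum>v\<in>V-{v0}. b e v * x v) = 0" by auto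
    define s where "s = (\<Sum>v\<in>V-{v0}. a e v * x v)"
    define y where "y = x(v0 := - s / a e v0)"
    have sum: "(\<Sum>v\<in>V. a e' v * y v) = (\<Sum>v\<in>V-{v0}. a e' v * x v) - a e' v0 * s / a e v0" for e'
    proof -
      have "(\<Sum>v\<in>V. a e' v * y v) = a e' v0 * y v0 + (\<Sum>v\<in>V-{v0}. a e' v * y v)"
        by (rule sum.remove) (use insert.prems v0 in auto)
      also have "(\<Sum>v\<in>V-{v0}. a e' v * y v) = (\<Sum>v\<in>V-{v0}. a e' v * x v)"
        by (rule sum.cong) (auto simp: y_def)
      finally show ?thesis by (simp add: y_def)
    qed
    have "(\<Sum>v\<in>V. a e v * y v) = 0"
      unfolding sum s_def[symmetric] using v0 by simp
    moreover have "(\<Sum>v\<in>V. a e' v * y v) = 0" if "e' \<in> E" for e'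
    proof -
      have "(\<Sum>v\<in>V-{v0}. b e' v * x v) = (\<Sum>v\<in>V-{v0}. a e' v * x v) - a e' v0 * s / a e v0"
        by (simp add: b_def s_def left_diff_distrib right_diff_distrib sum_subtractf sum_distrib_left
            sum_divide_distrib mult_ac)
      with x(2) that show ?thesis unfolding sum by simp
    qed
    moreover have "\<exists>v\<in>V. y v \<noteq> 0" using x(1) by (auto simp: y_def)
    ultimately show ?thesis by (intro exI[of _ y]) auto
  qed
qed

text \<open>A box of exponents instead of a triangle, so that the number of monomials is a plain
  product.\<close>

definition bidegree_le :: "poly_xy \<Rightarrow> nat \<Rightarrow> bool" where
  "bidegree_le p m \<longleftrightarrow> degree p \<le> m \<and> (\<forall>a. degree (coeff p a) \<le> m)"

lemma bidegree_le_ex: "\<exists>m. bidegree_le p m"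
proof -
  define m where "m = degree p + (\<Sum>a\<le>degree p. degree (coeff p a))"
  have "degree (coeff p a) \<le> m" for a
  proof (cases "a \<le> degree p")
    case True
    then have "degree (coeff p a) \<le> (\<Sum>a\<le>degree p. degree (coeff p a))"
      by (intro member_le_sum) auto
    then show ?thesis by (simp add: m_def)
  qed (simp add: coeff_eq_0)
  then have "bidegree_le p m" by (simp add: bidegree_le_def m_def)
  then show ?thesis ..
qed

lemma bidegree_le_mono: "bidegree_le p m \<Longrightarrow> m \<le> n \<Longrightarrow> bidegree_le p n"
  unfolding bidegree_le_def by (meson order_trans)

lemma bidegree_le_mult:
  assumes "bidegree_le p m" "bidegree_le q n"
  shows "bidegree_le (p * q) (m + n)"
  using assms unfolding bidegree_le_def coeff_mult
  by (auto intro!: order.trans[OF degree_mult_le] degree_sum_le add_mono)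

lemma bidegree_le_power: "bidegree_le p m \<Longrightarrow> bidegree_le (p ^ n) (n * m)"
proof (induction n)
  case 0
  then show ?case by (simp add: bidegree_le_def)
next
  case (Suc n)
  then show ?case using bidegree_le_mult[of p m "p ^ n" "n * m"] by simp
qed

lemma coeff_coeff_const_mult: "coeff (coeff ([:[:c:]:] * p) a) b = c * coeff (coeff p a) b"
  by simp

text \<open>Dimension count: the \<open>(n + 1) ^ 3\<close> products lie in the span of
  \<open>(3 * n * d + 1) ^ 2\<close> monomials, and a cubic bound outgrows a quadratic one.\<close>

lemma three_polynomials_dependent:
  fixes p q r :: poly_xy
  shows "\<exists>n c. (\<exists>i\<le>n. \<exists>j\<le>n. \<exists>k\<le>n. c i j k \<noteq> 0) \<and>
    (\<Sum>k\<le>n. \<Sum>i\<le>n. \<Sum>j\<le>n. [:[:c i j k:]:] * (p ^ i * q ^ j * r ^ k)) = 0"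
proof -
  obtain m1 m2 m3 where m: "bidegree_le p m1" "bidegree_le q m2" "bidegree_le r m3"
    using bidegree_le_ex by metis
  define d where "d = m1 + m2 + m3 + 1"
  have d: "bidegree_le p d" "bidegree_le q d" "bidegree_le r d"
    by (rule m[THEN bidegree_le_mono]; simp add: d_def)+
  \<comment> \<open>This choice turns the leading term \<open>9 * n ^ 2 * d ^ 2\<close> of the
    monomial count into \<open>n ^ 3\<close>. The rest, \<open>6 * n * d + 1\<close>, stays below
    the rest of \<open>(n + 1) ^ 3\<close> because \<open>2 * d \<le> n\<close>.\<close>
  define n where "n = 9 * d ^ 2"
  define M where "M = 3 * n * d"
  have bd: "bidegree_le (p ^ i * q ^ j * r ^ k) M" if "i \<le> n" "j \<le> n" "k \<le> n" for i j k
  proof -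
    have "bidegree_le (p ^ i * q ^ j * r ^ k) (i * d + j * d + k * d)"
      by (intro bidegree_le_mult bidegree_le_power d)
    moreover have "i * d + j * d + k * d \<le> n * d + n * d + n * d"
      using that by (intro add_mono mult_right_mono) auto
    ultimately show ?thesis by (rule bidegree_le_mono[OF _ order.trans]) (simp add: M_def)
  qed
  define V where "V = {..n} \<times> {..n} \<times> {..n}"
  define E where "E = {..M} \<times> {..M}"
  have "card E < card V"
  proof -
    have "1 \<le> d" by (simp add: d_def)
    have "card E = (3 * n * d + 1) * (3 * n * d + 1)" by (simp add: E_def card_cartesian_product M_def)
    also have "\<dots> = n * n * n + 6 * n * d + 1"
      by (simp add: algebra_simps n_def power2_eq_square)
    also have "\<dots> < (n + 1) * ((n + 1) * (n + 1))"
    proof -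
      have "d \<le> d ^ 2" using \<open>1 \<le> d\<close> by (simp add: power2_eq_square)
      then have "6 * n * d < 3 * n * n + 3 * n"
      proof -
        have "2 * d \<le> n" "0 < n" using \<open>d \<le> d ^ 2\<close> \<open>1 \<le> d\<close> by (auto simp: n_def)
        then have "3 * n * (2 * d) \<le> 3 * n * n" by (intro mult_le_mono) auto
        moreover have "3 * n * (2 * d) = 6 * n * d" by simp
        ultimately show ?thesis using \<open>0 < n\<close> by linarith
      qed
      then show ?thesis by (simp add: algebra_simps)
    qed
    also have "\<dots> = card V" by (simp add: V_def card_cartesian_product)
    finally show ?thesis .
  qed
  \<comment> \<open>One equation for each coefficient of the combination, one unknown for each
    product.\<close>
  then obtain x where x: "\<exists>v\<in>V. x v \<noteq> 0"
    "\<forall>e\<in>E. (\<Sum>v\<in>V. (case (e, v) of ((a, b), (i, j, k)) \<Rightarrow> coeff (coeff (p ^ i * q ^ j * r ^ k) a) b) * x v) = 0"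
    using underdetermined_system[of E V "\<lambda>e v. case (e, v) of ((a, b), (i, j, k)) \<Rightarrow> coeff (coeff (p ^ i * q ^ j * r ^ k) a) b"]
    by (auto simp: E_def V_def)
  define c where "c = (\<lambda>i j k. x (i, j, k))"
  define S where "S = (\<Sum>k\<le>n. \<Sum>i\<le>n. \<Sum>j\<le>n. [:[:c i j k:]:] * (p ^ i * q ^ j * r ^ k))"
  have cS: "coeff (coeff S a) b = (\<Sum>v\<in>V. (case v of (i, j, k) \<Rightarrow> coeff (coeff (p ^ i * q ^ j * r ^ k) a) b) * x v)" for a b
  proof -
    have "coeff (coeff S a) b = (\<Sum>k\<le>n. \<Sum>i\<le>n. \<Sum>j\<le>n. coeff (coeff (p ^ i * q ^ j * r ^ k) a) b * c i j k)"
      unfolding S_def coeff_sum coeff_coeff_const_mult by (simp add: mult.commute)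
    also have "\<dots> = (\<Sum>i\<le>n. \<Sum>j\<le>n. \<Sum>k\<le>n. coeff (coeff (p ^ i * q ^ j * r ^ k) a) b * c i j k)"
      by (subst sum.swap, rule sum.cong[OF refl], rule sum.swap)
    also have "\<dots> = (\<Sum>v\<in>V. (case v of (i, j, k) \<Rightarrow> coeff (coeff (p ^ i * q ^ j * r ^ k) a) b) * x v)"
      unfolding V_def c_def by (simp add: sum.cartesian_product split_beta)
    finally show ?thesis .
  qed
  have "coeff (coeff S a) b = 0" for a b
  proof (cases "a \<le> M \<and> b \<le> M")
    case True
    then have "(a, b) \<in> E" by (simp add: E_def)
    with x(2) show ?thesis unfolding cS by fastforce
  next
    case False
    have "coeff (coeff (p ^ i * q ^ j * r ^ k) a) b = 0" if "(i, j, k) \<in> V" for i j k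
    proof -
      have "bidegree_le (p ^ i * q ^ j * r ^ k) M" using that bd by (auto simp: V_def)
      with False show ?thesis unfolding bidegree_le_def
        by (metis coeff_0 coeff_eq_0 le_less_trans not_le)
    qed
    then show ?thesis unfolding cS by (intro sum.neutral) auto
  qed
  then have "S = 0" by (intro poly_eqI) simp
  moreover have "\<exists>i\<le>n. \<exists>j\<le>n. \<exists>k\<le>n. c i j k \<noteq> 0" using x(1) by (auto simp: V_def c_def)
  ultimately show ?thesis unfolding S_def by blast
qed

section \<open>Inversion and polar coordinates\<close>

definition inversion :: "real \<times> real \<Rightarrow> real \<times> real" where
  "inversion z = (fst z / ((fst z)\<^sup>2 + (snd z)\<^sup>2), snd z / ((fst z)\<^sup>2 + (snd z)\<^sup>2))"

definition inversion_deriv :: "real \<times> real \<Rightarrow> real \<times> real \<Rightarrow> real \<times> real" where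
  "inversion_deriv z h =
     ((((snd z)\<^sup>2 - (fst z)\<^sup>2) * fst h - 2 * fst z * snd z * snd h) / ((fst z)\<^sup>2 + (snd z)\<^sup>2)\<^sup>2,
      (((fst z)\<^sup>2 - (snd z)\<^sup>2) * snd h - 2 * fst z * snd z * fst h) / ((fst z)\<^sup>2 + (snd z)\<^sup>2)\<^sup>2)"

lemma norm_prod_power2: "(norm z)\<^sup>2 = (fst z)\<^sup>2 + (snd z)\<^sup>2" for z :: "real \<times> real"
  by (simp add: norm_prod_def)

lemma sum_squares_pos: "z \<noteq> 0 \<Longrightarrow> 0 < (fst z)\<^sup>2 + (snd z)\<^sup>2" for z :: "real \<times> real"
  by (metis norm_prod_power2 zero_less_norm_iff zero_less_power)

lemma inversion_altdef: "inversion z = z /\<^sub>R (norm z)\<^sup>2"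
  by (simp add: inversion_def norm_prod_power2 prod_eq_iff divide_inverse mult.commute)

lemma inversion_0 [simp]: "inversion 0 = 0"
  by (simp add: inversion_altdef)

lemma inversion_eq_0_iff [simp]: "inversion z = 0 \<longleftrightarrow> z = 0"
  by (simp add: inversion_altdef)

lemma norm_inversion [simp]: "norm (inversion z) = inverse (norm z)"
  by (cases "z = 0") (simp_all add: inversion_altdef power2_eq_square)

lemma inversion_inversion [simp]: "inversion (inversion z) = z"
proof (cases "z = 0")
  case False
  then show ?thesis
    unfolding inversion_altdef[of "inversion z"] norm_inversion
    by (simp add: inversion_altdef power_inverse)
qed simp

lemma inversion_inject [simp]: "inversion z = inversion w \<longleftrightarrow> z = w"
  by (metis inversion_inversion)

lemma inversion_has_derivative:
  assumes "z \<noteq> 0"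
  shows "(inversion has_derivative inversion_deriv z) (at z within A)"
proof -
  have nz: "(fst z)\<^sup>2 + (snd z)\<^sup>2 \<noteq> 0" by (rule less_imp_neq[OF sum_squares_pos[OF assms], symmetric])
  have d: "((\<lambda>z::real \<times> real. (fst z)\<^sup>2 + (snd z)\<^sup>2) has_derivative (\<lambda>h. 2 * fst z * fst h + 2 * snd z * snd h)) (at z within A)"
    by (auto intro!: derivative_eq_intros)
  have 1: "((\<lambda>z. fst z / ((fst z)\<^sup>2 + (snd z)\<^sup>2)) has_derivative
      (\<lambda>h. (((snd z)\<^sup>2 - (fst z)\<^sup>2) * fst h - 2 * fst z * snd z * snd h) / ((fst z)\<^sup>2 + (snd z)\<^sup>2)\<^sup>2)) (at z within A)"
  proof (rule has_derivative_eq_rhs[OF has_derivative_divide'[OF has_derivative_fst[OF has_derivative_ident] d nz]], rule ext)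
    fix h :: "real \<times> real"
    have "fst h * ((fst z)\<^sup>2 + (snd z)\<^sup>2) - fst z * (2 * fst z * fst h + 2 * snd z * snd h)
        = ((snd z)\<^sup>2 - (fst z)\<^sup>2) * fst h - 2 * fst z * snd z * snd h" by algebra
    then show "(fst h * ((fst z)\<^sup>2 + (snd z)\<^sup>2) - fst z * (2 * fst z * fst h + 2 * snd z * snd h)) /
        (((fst z)\<^sup>2 + (snd z)\<^sup>2) * ((fst z)\<^sup>2 + (snd z)\<^sup>2)) =
        (((snd z)\<^sup>2 - (fst z)\<^sup>2) * fst h - 2 * fst z * snd z * snd h) / ((fst z)\<^sup>2 + (snd z)\<^sup>2)\<^sup>2"
      by (simp only: power2_eq_square)
  qed
  have 2: "((\<lambda>z. snd z / ((fst z)\<^sup>2 + (snd z)\<^sup>2)) has_derivative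
      (\<lambda>h. (((fst z)\<^sup>2 - (snd z)\<^sup>2) * snd h - 2 * fst z * snd z * fst h) / ((fst z)\<^sup>2 + (snd z)\<^sup>2)\<^sup>2)) (at z within A)"
  proof (rule has_derivative_eq_rhs[OF has_derivative_divide'[OF has_derivative_snd[OF has_derivative_ident] d nz]], rule ext)
    fix h :: "real \<times> real"
    have "snd h * ((fst z)\<^sup>2 + (snd z)\<^sup>2) - snd z * (2 * fst z * fst h + 2 * snd z * snd h)
        = ((fst z)\<^sup>2 - (snd z)\<^sup>2) * snd h - 2 * fst z * snd z * fst h" by algebra
    then show "(snd h * ((fst z)\<^sup>2 + (snd z)\<^sup>2) - snd z * (2 * fst z * fst h + 2 * snd z * snd h)) /
        (((fst z)\<^sup>2 + (snd z)\<^sup>2) * ((fst z)\<^sup>2 + (snd z)\<^sup>2)) =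
        (((fst z)\<^sup>2 - (snd z)\<^sup>2) * snd h - 2 * fst z * snd z * fst h) / ((fst z)\<^sup>2 + (snd z)\<^sup>2)\<^sup>2"
      by (simp only: power2_eq_square)
  qed
  show ?thesis
    unfolding inversion_def[abs_def] inversion_deriv_def[abs_def] by (rule has_derivative_Pair[OF 1 2])
qed

lemma continuous_on_inversion:
  assumes "continuous_on A c" "\<And>x. x \<in> A \<Longrightarrow> c x \<noteq> 0"
  shows "continuous_on A (\<lambda>x. inversion (c x))"
  unfolding inversion_altdef by (intro continuous_intros assms(1)) (use assms(2) in simp)

text \<open>At an inverted point the denominators cancel; the quadratic polynomials in
  \<open>u\<close> that remain are the matrix entries of the Bendixson compactification.\<close>

lemma inversion_deriv_inversion:
  assumes "u \<noteq> 0"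
  shows "inversion_deriv (inversion u) h =
     (((snd u)\<^sup>2 - (fst u)\<^sup>2) * fst h - 2 * fst u * snd u * snd h,
      ((fst u)\<^sup>2 - (snd u)\<^sup>2) * snd h - 2 * fst u * snd u * fst h)"
proof -
  define i where "i = 1 / ((fst u)\<^sup>2 + (snd u)\<^sup>2)"
  have i: "i * ((fst u)\<^sup>2 + (snd u)\<^sup>2) = 1" "i \<noteq> 0"
    using less_imp_neq[OF sum_squares_pos[OF assms], symmetric] by (simp_all only: i_def) simp_all
  have u: "fst (inversion u) = i * fst u" "snd (inversion u) = i * snd u"
    by (simp_all add: inversion_def i_def)
  have "(i * fst u)\<^sup>2 + (i * snd u)\<^sup>2 = i * (i * ((fst u)\<^sup>2 + (snd u)\<^sup>2))"
    by (simp add: power_mult_distrib power2_eq_square distrib_left mult_ac)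
  then have n: "(i * fst u)\<^sup>2 + (i * snd u)\<^sup>2 = i" by (simp only: i(1) mult_1_right)
  have 1: "((i * snd u)\<^sup>2 - (i * fst u)\<^sup>2) * fst h - 2 * (i * fst u) * (i * snd u) * snd h
      = i\<^sup>2 * (((snd u)\<^sup>2 - (fst u)\<^sup>2) * fst h - 2 * fst u * snd u * snd h)"
    by algebra
  have 2: "((i * fst u)\<^sup>2 - (i * snd u)\<^sup>2) * snd h - 2 * (i * fst u) * (i * snd u) * fst h
      = i\<^sup>2 * (((fst u)\<^sup>2 - (snd u)\<^sup>2) * snd h - 2 * fst u * snd u * fst h)"
    by algebra
  show ?thesis
    unfolding inversion_deriv_def u n 1 2 using i(2) by simp
qed

text \<open>The chain rule for an involution, here checked by computation.\<close>

lemma inversion_deriv_inverse: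
  assumes "u \<noteq> 0"
  shows "inversion_deriv u (inversion_deriv (inversion u) h) = h"
proof -
  define s where "s = (fst u)\<^sup>2 + (snd u)\<^sup>2"
  have s: "s \<noteq> 0" unfolding s_def by (rule less_imp_neq[OF sum_squares_pos[OF assms], symmetric])
  have 1: "((snd u)\<^sup>2 - (fst u)\<^sup>2) * (((snd u)\<^sup>2 - (fst u)\<^sup>2) * fst h - 2 * fst u * snd u * snd h) -
      2 * fst u * snd u * (((fst u)\<^sup>2 - (snd u)\<^sup>2) * snd h - 2 * fst u * snd u * fst h) = s\<^sup>2 * fst h"
    unfolding s_def by algebra
  have 2: "((fst u)\<^sup>2 - (snd u)\<^sup>2) * (((fst u)\<^sup>2 - (snd u)\<^sup>2) * snd h - 2 * fst u * snd u * fst h) -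
      2 * fst u * snd u * (((snd u)\<^sup>2 - (fst u)\<^sup>2) * fst h - 2 * fst u * snd u * snd h) = s\<^sup>2 * snd h"
    unfolding s_def by algebra
  show ?thesis
    unfolding inversion_deriv_inversion[OF assms]
    unfolding inversion_deriv_def s_def[symmetric] fst_conv snd_conv 1 2 using s by simp
qed

lemma inversion_deriv_scaleR: "inversion_deriv z (c *\<^sub>R h) = c *\<^sub>R inversion_deriv z h"
  by (simp add: inversion_deriv_def algebra_simps)

definition polar :: "real \<Rightarrow> real \<Rightarrow> real \<times> real" where
  "polar r a = (r * cos a, r * sin a)"

text \<open>The quarter turn, which is also the vector field whose flow rotates the plane with
  angular velocity one.\<close>

definition rot :: "real \<times> real \<Rightarrow> real \<times> real" where
  "rot w = (- snd w, fst w)"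

lemma norm_polar [simp]: "norm (polar r a) = \<bar>r\<bar>"
proof -
  have "(norm (polar r a))\<^sup>2 = r\<^sup>2 * ((cos a)\<^sup>2 + (sin a)\<^sup>2)"
    unfolding norm_prod_power2 by (simp add: polar_def power_mult_distrib distrib_left del: sin_cos_squared_add sin_cos_squared_add2)
  then have "(norm (polar r a))\<^sup>2 = \<bar>r\<bar>\<^sup>2" by simp
  then show ?thesis by (rule power2_eq_imp_eq) auto
qed

lemma polar_ex: "\<exists>a. w = polar (norm w) a"
proof (cases "w = 0")
  case False
  have "(fst w / norm w)\<^sup>2 + (snd w / norm w)\<^sup>2 = 1"
    using False by (simp add: power_divide norm_prod_power2[symmetric] flip: add_divide_distrib)
  then obtain a where "fst w / norm w = cos a" "snd w / norm w = sin a"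
    using sincos_total_2pi by metis
  moreover have "norm w * (fst w / norm w) = fst w" "norm w * (snd w / norm w) = snd w"
    using False by simp_all
  ultimately have "w = polar (norm w) a"
    by (simp only: polar_def prod_eq_iff fst_conv snd_conv)
  then show ?thesis ..
qed (simp add: polar_def prod_eq_iff)

lemma polar_2pi [simp]: "polar r (a + 2 * pi) = polar r a"
  by (simp add: polar_def)

lemma polar_eq_imp:
  assumes "polar r a = polar r b" "r \<noteq> 0"
  obtains n :: int where "a = b + 2 * pi * of_int n"
proof -
  have "cos a = cos b" "sin a = sin b" using assms by (auto simp: polar_def)
  then obtain n :: int where "a = b + 2 * pi * of_int n" using sin_cos_eq_iff by metis
  then show ?thesis by (rule that)
qed

lemma polar_inj:
  assumes "polar r a = polar r b" "r \<noteq> 0" "\<bar>a - b\<bar> < 2 * pi"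
  shows "a = b"
proof -
  obtain n :: int where n: "a = b + 2 * pi * of_int n" using polar_eq_imp[OF assms(1,2)] .
  then have "2 * pi * \<bar>of_int n\<bar> < 2 * pi * 1" using assms(3) by (simp add: abs_mult)
  then have "\<bar>real_of_int n\<bar> < 1" by (subst (asm) mult_less_cancel_left_pos) auto
  then have "n = 0" by linarith
  then show ?thesis using n by simp
qed

lemma continuous_on_polar [continuous_intros]:
  fixes A :: "'a::t2_space set"
  assumes "continuous_on A r" "continuous_on A a"
  shows "continuous_on A (\<lambda>x. polar (r x) (a x))"
  unfolding polar_def by (intro continuous_on_Pair continuous_on_mult continuous_on_cos continuous_on_sin assms)

lemma polar_has_vector_derivative:
  assumes "(\<phi> has_real_derivative k) (at t within A)"
  shows "((\<lambda>t. polar r (\<phi> t)) has_vector_derivative k *\<^sub>R rot (polar r (\<phi> t))) (at t within A)"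
proof -
  have "((\<lambda>t. r * cos (\<phi> t)) has_real_derivative k * - (r * sin (\<phi> t))) (at t within A)"
    "((\<lambda>t. r * sin (\<phi> t)) has_real_derivative k * (r * cos (\<phi> t))) (at t within A)"
    by (rule derivative_eq_intros assms refl | simp)+
  then show ?thesis
    unfolding polar_def rot_def has_real_derivative_iff_has_vector_derivative
    by (auto dest: has_vector_derivative_Pair)
qed

text \<open>In the frame rotated by \<open>\<phi>\<close> the components \<open>p\<close> and
  \<open>q\<close> of \<open>w\<close> have derivative zero.\<close>

lemma rotation_integral:
  assumes I: "is_interval I" and \<phi>: "\<And>t. t \<in> I \<Longrightarrow> (\<phi> has_real_derivative k t) (at t within I)"
    and w: "\<And>t. t \<in> I \<Longrightarrow> (w has_vector_derivative k t *\<^sub>R rot (w t)) (at t within I)"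
  obtains r a where "0 \<le> r" "\<And>t. t \<in> I \<Longrightarrow> w t = polar r (a + \<phi> t)"
proof (cases "I = {}")
  case False
  then obtain t0 where t0: "t0 \<in> I" by auto
  define p q where "p = (\<lambda>t. fst (w t) * cos (\<phi> t) + snd (w t) * sin (\<phi> t))"
    and "q = (\<lambda>t. snd (w t) * cos (\<phi> t) - fst (w t) * sin (\<phi> t))"
  have w1: "((\<lambda>t. fst (w t)) has_real_derivative - (k t * snd (w t))) (at t within I)" if "t \<in> I" for t
    using bounded_linear.has_vector_derivative[OF bounded_linear_fst w[OF that]]
    by (simp add: has_real_derivative_iff_has_vector_derivative rot_def)
  have w2: "((\<lambda>t. snd (w t)) has_real_derivative (k t * fst (w t))) (at t within I)" if "t \<in> I" for t
    using bounded_linear.has_vector_derivative[OF bounded_linear_snd w[OF that]]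
    by (simp add: has_real_derivative_iff_has_vector_derivative rot_def)
  have "(p has_real_derivative 0) (at t within I)" if "t \<in> I" for t
    unfolding p_def using that
    by (auto intro!: derivative_eq_intros w1 w2 \<phi> simp: algebra_simps)
  then have p: "p t = p t0" if "t \<in> I" for t
    using has_field_derivative_zero_constant[of I p] I t0 that is_interval_convex_1 by metis
  have "(q has_real_derivative 0) (at t within I)" if "t \<in> I" for t
    unfolding q_def using that
    by (auto intro!: derivative_eq_intros w1 w2 \<phi> simp: algebra_simps)
  then have q: "q t = q t0" if "t \<in> I" for t
    using has_field_derivative_zero_constant[of I q] I t0 that is_interval_convex_1 by metis
  obtain a where a: "(p t0, q t0) = polar (norm (p t0, q t0)) a" using polar_ex by blast
  define r where "r = norm (p t0, q t0)"
  have "w t = polar r (a + \<phi> t)" if "t \<in> I" for t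
  proof -
    have 1: "r * cos a = p t" "r * sin a = q t"
      using a p[OF that] q[OF that] by (auto simp: polar_def r_def)
    have "fst (w t) = p t * cos (\<phi> t) - q t * sin (\<phi> t)" "snd (w t) = q t * cos (\<phi> t) + p t * sin (\<phi> t)"
      unfolding p_def q_def using sin_cos_squared_add[of "\<phi> t"] by algebra+
    then show ?thesis
      by (simp add: polar_def prod_eq_iff cos_add sin_add 1[symmetric] algebra_simps)
  qed
  then show ?thesis by (intro that[of r a]) (auto simp: r_def)
qed (use that in auto)

section \<open>Maps with positive Jacobian determinant\<close>

locale positive_jacobian =
  fixes f g :: poly_xy
  assumes jac_pos: "\<And>x y. 0 < eval_xy (jacobian_det (f, g)) x y"
    and map_0: "poly_map (f, g) (0, 0) = (0, 0)"
begin

definition F :: "real \<times> real \<Rightarrow> real \<times> real" where "F = poly_map (f, g)"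
definition X :: "real \<times> real \<Rightarrow> real \<times> real" where "X = poly_map (hamiltonian_field (f, g))"
definition B :: "real \<times> real \<Rightarrow> real \<times> real" where "B = poly_map (bendixson (hamiltonian_field (f, g)))"
definition J :: "real \<times> real \<Rightarrow> real" where "J z = eval_xy (jacobian_det (f, g)) (fst z) (snd z)"
definition fx where "fx z = eval_xy (deriv_x f) (fst z) (snd z)"
definition fy where "fy z = eval_xy (deriv_y f) (fst z) (snd z)"
definition gx where "gx z = eval_xy (deriv_x g) (fst z) (snd z)"
definition gy where "gy z = eval_xy (deriv_y g) (fst z) (snd z)"
definition DF where "DF z h = (fx z * fst h + fy z * snd h, gx z * fst h + gy z * snd h)"
definition DFinv where
  "DFinv z h = ((gy z * fst h - fy z * snd h) / J z, (fx z * snd h - gx z * fst h) / J z)"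
definition dd :: nat where
  "dd = max (total_degree (fst (hamiltonian_field (f, g)))) (total_degree (snd (hamiltonian_field (f, g))))"

lemma F_0 [simp]: "F 0 = 0"
  using map_0 by (simp add: F_def zero_prod_def)

lemma J_pos: "0 < J z"
  by (simp add: J_def jac_pos)

lemma J_eq: "J z = fx z * gy z - fy z * gx z"
  by (simp add: J_def fx_def fy_def gx_def gy_def jacobian_det_def)

lemma F_has_derivative: "(F has_derivative DF z) (at z within A)"
proof -
  have "(F has_derivative DF z) (at z)"
    unfolding F_def poly_map_def DF_def fx_def fy_def gx_def gy_def fst_conv snd_conv
    by (intro has_derivative_Pair eval_xy_has_derivative)
  then show ?thesis by (rule has_derivative_at_withinI)
qed

lemma continuous_on_F: "continuous_on A F"
  by (rule has_derivative_continuous_on[OF F_has_derivative])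

lemma continuous_on_J: "continuous_on A J"
  unfolding J_def by (intro continuous_on_eval_xy continuous_on_fst continuous_on_snd continuous_on_id)

lemma DFinv_DF: "DFinv z (DF z h) = h"
proof -
  have "gy z * (fx z * fst h + fy z * snd h) - fy z * (gx z * fst h + gy z * snd h) = J z * fst h"
    "fx z * (gx z * fst h + gy z * snd h) - gx z * (fx z * fst h + fy z * snd h) = J z * snd h"
    unfolding J_eq by algebra+
  then show ?thesis using J_pos[of z] by (simp add: DFinv_def DF_def)
qed

lemma DF_DFinv: "DF z (DFinv z h) = h"
proof -
  have "fx z * (gy z * fst h - fy z * snd h) + fy z * (fx z * snd h - gx z * fst h) = J z * fst h"
    "gx z * (gy z * fst h - fy z * snd h) + gy z * (fx z * snd h - gx z * fst h) = J z * snd h"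
    unfolding J_eq by algebra+
  then show ?thesis using J_pos[of z]
    by (simp add: DFinv_def DF_def flip: add_divide_distrib)
qed

lemma bounded_linear_DFinv: "bounded_linear (DFinv z)"
  unfolding linear_conv_bounded_linear[symmetric]
  by (rule linearI) (simp_all add: DFinv_def algebra_simps add_divide_distrib diff_divide_distrib)

text \<open>\<open>J z\<close> times \<open>DFinv z\<close> is the adjugate of \<open>DF z\<close>,
  and it maps \<open>rot (F z)\<close>, which is \<open>(- g, f)\<close>, to the Hamiltonian field.
  So \<open>X\<close> is the lift through \<open>F\<close> of a multiple of the rotation
  field.\<close>

lemma X_eq: "X z = DFinv z (J z *\<^sub>R rot (F z))"
proof -
  define a b where "a = eval_xy f (fst z) (snd z)" and "b = eval_xy g (fst z) (snd z)"
  have X: "X z = (- a * fy z - b * gy z, a * fx z + b * gx z)"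
    by (simp add: X_def poly_map_def hamiltonian_field_def fx_def fy_def gx_def gy_def a_def b_def)
  have F: "rot (F z) = (- b, a)"
    by (simp add: F_def poly_map_def rot_def a_def b_def)
  have "J z \<noteq> 0" using J_pos[of z] by simp
  then show ?thesis
    unfolding X F by (simp add: DFinv_def field_simps)
qed

lemma DF_X: "DF z (X z) = J z *\<^sub>R rot (F z)"
  by (simp add: X_eq DF_DFinv)

text \<open>Since the inversion is its own inverse,
  \<open>inversion_deriv (inversion u) (X (inversion u))\<close> is the push-forward of the
  Hamiltonian field; the power of the norm only rescales time.\<close>

lemma B_eq:
  assumes "u \<noteq> 0"
  shows "B u = (norm u) ^ (2 * dd) *\<^sub>R inversion_deriv (inversion u) (X (inversion u))"
proof -
  obtain P Q where PQ: "hamiltonian_field (f, g) = (P, Q)" by force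
  obtain a b where u: "u = (a, b)" by force
  have "(norm u) ^ (2 * dd) = (a\<^sup>2 + b\<^sup>2) ^ dd"
    by (simp add: power_mult norm_prod_power2 u)
  then show ?thesis
    using poly_map_bendixson[of a b P Q] assms
    unfolding B_def inversion_deriv_inversion[OF assms] PQ
    by (simp add: u X_def PQ poly_map_def inversion_def dd_def zero_prod_def mult_ac)
qed

lemma B_0 [simp]: "B 0 = 0"
  by (simp add: B_def poly_map_def bendixson_def Let_def split_beta zero_prod_def)

text \<open>Relates the time of the rotation of \<open>F\<close> to the time of \<open>B\<close>: it combines the factor
  \<open>(u\<^sup>2 + v\<^sup>2) ^ d\<close> of the compactification with the Jacobian determinant.\<close>

definition speed :: "real \<times> real \<Rightarrow> real" where
  "speed z = 1 / (inverse (norm z) ^ (2 * dd) * J z)"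

lemma speed_pos: "z \<noteq> 0 \<Longrightarrow> 0 < speed z"
  by (simp add: speed_def J_pos)

lemma continuous_on_speed:
  assumes "continuous_on A c" "\<And>t. t \<in> A \<Longrightarrow> c t \<noteq> 0"
  shows "continuous_on A (\<lambda>t. speed (c t))"
proof -
  have "continuous_on A (\<lambda>t. J (c t))"
    using continuous_on_compose2[OF continuous_on_J[of UNIV] assms(1)] by simp
  moreover have "J (c t) \<noteq> 0" for t using J_pos[of "c t"] by simp
  ultimately show ?thesis
    unfolding speed_def
    by (intro continuous_on_divide continuous_on_mult continuous_on_power continuous_on_inverse
        continuous_on_norm continuous_on_const assms(1)) (use assms(2) in simp_all)
qed

text \<open>\<open>c\<close> lifts a curve that rotates with angular velocity \<open>m\<close>. The
  factor \<open>m * speed (c t)\<close> is the derivative of the time of \<open>B\<close> with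
  respect to the parameter of \<open>c\<close>.\<close>

lemma lift_has_vector_derivative:
  assumes c: "(c has_vector_derivative DFinv (c t) (m *\<^sub>R rot (F (c t)))) (at t within I)"
    and "c t \<noteq> 0"
  shows "((\<lambda>t. inversion (c t)) has_vector_derivative
     (m * speed (c t)) *\<^sub>R B (inversion (c t))) (at t within I)"
proof -
  interpret DI: bounded_linear "DFinv (c t)" by (rule bounded_linear_DFinv)
  have nz: "inversion (c t) \<noteq> 0" using assms(2) by simp
  have "((inversion \<circ> c) has_derivative
      inversion_deriv (c t) \<circ> (\<lambda>h. h *\<^sub>R DFinv (c t) (m *\<^sub>R rot (F (c t))))) (at t within I)"
    using c unfolding has_vector_derivative_def
    by (intro diff_chain_within inversion_has_derivative assms(2))
  then have "((\<lambda>t. inversion (c t)) has_vector_derivative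
      inversion_deriv (c t) (DFinv (c t) (m *\<^sub>R rot (F (c t))))) (at t within I)"
    by (simp add: has_vector_derivative_def o_def inversion_deriv_scaleR)
  moreover have "(m * speed (c t)) *\<^sub>R B (inversion (c t)) =
      inversion_deriv (c t) (DFinv (c t) (m *\<^sub>R rot (F (c t))))"
    unfolding B_eq[OF nz] using J_pos[of "c t"] assms(2)
    by (simp add: speed_def X_eq inversion_deriv_scaleR DI.scaleR field_simps)
  ultimately show ?thesis by simp
qed

text \<open>The converse passage, from orbits to rotations. The sign of \<open>\<sigma>\<close> is
  the sense of time, because monodromy admits backward orbits.\<close>

lemma solution_F_has_vector_derivative:
  assumes "(\<gamma> has_vector_derivative \<sigma> *\<^sub>R B (\<gamma> t)) (at t within I)" "\<gamma> t \<noteq> 0"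
  shows "((\<lambda>t. F (inversion (\<gamma> t))) has_vector_derivative
      (\<sigma> * (norm (\<gamma> t) ^ (2 * dd) * J (inversion (\<gamma> t)))) *\<^sub>R rot (F (inversion (\<gamma> t)))) (at t within I)"
proof -
  let ?z = "inversion (\<gamma> t)"
  have "((\<lambda>t. F (inversion (\<gamma> t))) has_derivative
     (\<lambda>h. DF ?z (inversion_deriv (\<gamma> t) (h *\<^sub>R (\<sigma> *\<^sub>R B (\<gamma> t)))))) (at t within I)"
    using diff_chain_within[OF diff_chain_within[OF assms(1)[unfolded has_vector_derivative_def]
      inversion_has_derivative[OF assms(2)]] F_has_derivative]
    by (simp add: o_def)
  moreover have "inversion_deriv (\<gamma> t) (B (\<gamma> t)) = (norm (\<gamma> t) ^ (2 * dd)) *\<^sub>R X ?z"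
    unfolding B_eq[OF assms(2)] inversion_deriv_scaleR inversion_deriv_inverse[OF assms(2)] ..
  moreover have "DF ?z (c *\<^sub>R h) = c *\<^sub>R DF ?z h" for c h
    by (simp add: DF_def algebra_simps)
  ultimately show ?thesis
    by (simp add: has_vector_derivative_def inversion_deriv_scaleR DF_X mult_ac)
qed

text \<open>The angle is an antiderivative of the angular velocity. That velocity has a constant
  sign, as the Jacobian determinant is positive and the orbit avoids the origin; hence the
  injectivity.\<close>

lemma solution_angle:
  assumes I: "is_interval I"
    and \<gamma>: "\<And>t. t \<in> I \<Longrightarrow> (\<gamma> has_vector_derivative \<sigma> *\<^sub>R B (\<gamma> t)) (at t within I)"
    and nz: "\<And>t. t \<in> I \<Longrightarrow> \<gamma> t \<noteq> 0" and "0 < \<bar>\<sigma>\<bar>"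
  obtains r \<phi> where "0 \<le> r" "continuous_on I \<phi>" "inj_on \<phi> I"
    "\<And>t. t \<in> I \<Longrightarrow> F (inversion (\<gamma> t)) = polar r (\<phi> t)"
proof -
  define k where "k = (\<lambda>t. norm (\<gamma> t) ^ (2 * dd) * J (inversion (\<gamma> t)))"
  have c\<gamma>: "continuous_on I \<gamma>"
    using \<gamma> by (metis continuous_on_eq_continuous_within has_vector_derivative_continuous)
  have "continuous_on I (\<lambda>t. J (inversion (\<gamma> t)))"
    by (rule continuous_on_compose2[OF continuous_on_J[of UNIV] continuous_on_inversion[OF c\<gamma> nz]]) auto
  then have "continuous_on I k"
    unfolding k_def by (intro continuous_on_mult continuous_on_power continuous_on_norm c\<gamma>)
  then obtain \<Phi> where \<Phi>: "\<And>t. t \<in> I \<Longrightarrow> (\<Phi> has_real_derivative k t) (at t within I)"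
    using interval_antiderivative[OF I] by blast
  have kpos: "0 < k t" if "t \<in> I" for t using nz[OF that] J_pos by (simp add: k_def)
  have sm: "strict_mono_on I \<Phi>"
    by (rule positive_derivative_strict_mono_on[OF I \<Phi> kpos])
  have "((\<lambda>t. \<sigma> * \<Phi> t) has_real_derivative \<sigma> * k t) (at t within I)" if "t \<in> I" for t
    by (rule DERIV_cmult[OF \<Phi>[OF that]])
  moreover have "((\<lambda>t. F (inversion (\<gamma> t))) has_vector_derivative
      (\<sigma> * k t) *\<^sub>R rot (F (inversion (\<gamma> t)))) (at t within I)" if "t \<in> I" for t
    unfolding k_def by (rule solution_F_has_vector_derivative[OF \<gamma> nz]) (use that in auto)
  ultimately obtain r a where ra: "0 \<le> r" "\<And>t. t \<in> I \<Longrightarrow> F (inversion (\<gamma> t)) = polar r (a + \<sigma> * \<Phi> t)"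
    using rotation_integral[OF I, of "\<lambda>t. \<sigma> * \<Phi> t" "\<lambda>t. \<sigma> * k t" "\<lambda>t. F (inversion (\<gamma> t))"] by blast
  have "inj_on (\<lambda>t. a + \<sigma> * \<Phi> t) I"
    using strict_mono_on_imp_inj_on[OF sm] \<open>0 < \<bar>\<sigma>\<bar>\<close> by (auto simp: inj_on_def)
  moreover have "continuous_on I (\<lambda>t. a + \<sigma> * \<Phi> t)"
    by (intro continuous_on_add continuous_on_mult continuous_on_const DERIV_continuous_on[OF \<Phi>])
  ultimately show ?thesis using ra that by blast
qed

lemma solution_norm_constant:
  assumes "solves B \<gamma> I" "\<And>t. t \<in> I \<Longrightarrow> \<gamma> t \<noteq> 0"
  shows "(\<lambda>t. norm (F (inversion (\<gamma> t)))) constant_on I"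
proof -
  obtain r \<phi> where "\<And>t. t \<in> I \<Longrightarrow> F (inversion (\<gamma> t)) = polar r (\<phi> t)"
    by (rule solution_angle[of I \<gamma> 1]) (use assms in \<open>auto simp: solves_def\<close>)
  then show ?thesis unfolding constant_on_def by (intro exI[of _ "\<bar>r\<bar>"]) simp
qed

lemma local_inverse:
  obtains N V \<phi> where "open N" "z \<in> N" "open V" "F z \<in> V" "homeomorphism N V F \<phi>"
proof -
  define D where "D = (\<lambda>z. Blinfun (DF z))"
  have bl: "bounded_linear (DF z)" for z using F_has_derivative has_derivative_bounded_linear by blast
  have D: "blinfun_apply (D z) = DF z" for z unfolding D_def using bl by (simp add: bounded_linear_Blinfun_apply)
  have cont: "continuous_on UNIV D"
  proof (rule continuous_on_blinfun_componentwise)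
    fix i :: "real \<times> real"
    show "continuous_on UNIV (\<lambda>z. blinfun_apply (D z) i)"
      unfolding D DF_def fx_def fy_def gx_def gy_def
      by (intro continuous_on_Pair continuous_on_add continuous_on_mult continuous_on_eval_xy
          continuous_on_fst continuous_on_snd continuous_on_id continuous_on_const)
  qed
  have "Blinfun (DFinv z) o\<^sub>L D z = id_blinfun"
    by (rule blinfun_eqI)
      (simp add: D bounded_linear_Blinfun_apply[OF bounded_linear_DFinv] DFinv_DF)
  from inverse_function_theorem[OF open_UNIV _ cont UNIV_I this, of F] obtain U' V \<phi> where
    "open U'" "z \<in> U'" "open V" "F z \<in> V" "homeomorphism U' V F \<phi>"
    using F_has_derivative by (metis D)
  then show ?thesis by (rule that)
qed

end

text \<open>The set where \<open>P\<close> holds is open and closed in \<open>T\<close>. Both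
  conditions are stated pointwise, the form in which continuation arguments provide them.\<close>

lemma connected_all:
  assumes T: "connected T" and "t0 \<in> T" "P t0"
    and "\<And>t. t \<in> T \<Longrightarrow> P t \<Longrightarrow> \<exists>U. openin (top_of_set T) U \<and> t \<in> U \<and> (\<forall>s\<in>U. P s)"
    and "\<And>t. t \<in> T \<Longrightarrow> \<not> P t \<Longrightarrow> \<exists>U. openin (top_of_set T) U \<and> t \<in> U \<and> (\<forall>s\<in>U. \<not> P s)"
    and "t \<in> T"
  shows "P t"
proof -
  define A where "A = {t\<in>T. P t}"
  have U: "U \<subseteq> T" if "openin (top_of_set T) U" for U using openin_imp_subset[OF that] .
  have "openin (top_of_set T) A"
  proof (subst openin_subopen, rule ballI)
    fix x assume "x \<in> A"
    then obtain U where "openin (top_of_set T) U" "x \<in> U" "\<forall>s\<in>U. P s"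
      using assms(4)[of x] by (auto simp: A_def)
    with U show "\<exists>U. openin (top_of_set T) U \<and> x \<in> U \<and> U \<subseteq> A" by (auto simp: A_def subset_iff)
  qed
  moreover have "openin (top_of_set T) (T - A)"
  proof (subst openin_subopen, rule ballI)
    fix x assume "x \<in> T - A"
    then obtain U where "openin (top_of_set T) U" "x \<in> U" "\<forall>s\<in>U. \<not> P s"
      using assms(5)[of x] by (auto simp: A_def)
    with U show "\<exists>U. openin (top_of_set T) U \<and> x \<in> U \<and> U \<subseteq> T - A" by (auto simp: A_def subset_iff)
  qed
  then have "closedin (top_of_set T) A"
    by (simp add: closedin_def A_def)
  ultimately have "A = {} \<or> A = T" using T connected_clopen by blast
  with assms(2,3,6) show ?thesis by (auto simp: A_def)
qed

context positive_jacobian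
begin

section \<open>The maximal starlike domain of an inverse branch\<close>

text \<open>Uniqueness of lifts: agreement is an open condition by local injectivity of
  \<open>F\<close> and a closed one by continuity.\<close>

lemma lifts_agree:
  assumes T: "connected T" and a: "continuous_on T a" and b: "continuous_on T b"
    and eq: "\<And>t. t \<in> T \<Longrightarrow> F (a t) = F (b t)" and t0: "t0 \<in> T" "a t0 = b t0" and t: "t \<in> T"
  shows "a t = b t"
proof (rule connected_all[where P = "\<lambda>t. a t = b t", OF T t0 _ _ t])
  fix t assume t: "t \<in> T" "a t = b t"
  obtain N V \<phi> where N: "open N" "a t \<in> N" "homeomorphism N V F \<phi>" using local_inverse[of "a t"] .
  let ?U = "(T \<inter> a -` N) \<inter> (T \<inter> b -` N)"
  have "openin (top_of_set T) ?U"
    by (intro openin_Int continuous_openin_preimage_gen a b N)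
  moreover have "a s = b s" if "s \<in> ?U" for s
    using that eq[of s] homeomorphism_apply1[OF N(3)] by (metis IntE vimageE)
  ultimately show "\<exists>U. openin (top_of_set T) U \<and> t \<in> U \<and> (\<forall>s\<in>U. a s = b s)"
    using t N by (intro exI[of _ ?U]) auto
next
  fix t assume t: "t \<in> T" "a t \<noteq> b t"
  let ?U = "T \<inter> (\<lambda>t. a t - b t) -` (- {0})"
  have "openin (top_of_set T) ?U"
    by (intro continuous_openin_preimage_gen continuous_on_diff a b open_Compl closed_singleton)
  then show "\<exists>U. openin (top_of_set T) U \<and> t \<in> U \<and> (\<forall>s\<in>U. a s \<noteq> b s)"
    using t by (intro exI[of _ ?U]) auto
qed

text \<open>Starlikeness makes sections unique: any two are compared along the segment from the
  origin. So all of them glue together, and the union of their domains is again starlike.\<close>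

definition starlike_section :: "(real \<times> real) set \<Rightarrow> (real \<times> real \<Rightarrow> real \<times> real) \<Rightarrow> bool" where
  "starlike_section S \<psi> \<longleftrightarrow> open S \<and> 0 \<in> S \<and> (\<forall>w\<in>S. \<forall>t\<in>{0..1}. t *\<^sub>R w \<in> S) \<and>
     continuous_on S \<psi> \<and> \<psi> 0 = 0 \<and> (\<forall>w\<in>S. F (\<psi> w) = w)"

definition D :: "(real \<times> real) set" where "D = \<Union>{S. \<exists>\<psi>. starlike_section S \<psi>}"

definition G :: "real \<times> real \<Rightarrow> real \<times> real" where
  "G w = (THE z. \<exists>S \<psi>. starlike_section S \<psi> \<and> w \<in> S \<and> z = \<psi> w)"

lemma starlike_section_unique:
  assumes "starlike_section S \<psi>" "starlike_section S' \<psi>'" "w \<in> S" "w \<in> S'"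
  shows "\<psi> w = \<psi>' w"
proof -
  let ?T = "(\<lambda>t. t *\<^sub>R w) ` {0..1::real}"
  have "?T \<subseteq> S" "?T \<subseteq> S'" using assms unfolding starlike_section_def by auto
  show ?thesis
  proof (rule lifts_agree[of ?T \<psi> \<psi>' 0 w])
    show "connected ?T"
      by (intro connected_continuous_image continuous_on_scaleR continuous_on_id continuous_on_const) auto
    show "continuous_on ?T \<psi>" "continuous_on ?T \<psi>'"
      using assms \<open>?T \<subseteq> S\<close> \<open>?T \<subseteq> S'\<close> unfolding starlike_section_def by (meson continuous_on_subset)+
    show "F (\<psi> t) = F (\<psi>' t)" if "t \<in> ?T" for t
      using assms \<open>?T \<subseteq> S\<close> \<open>?T \<subseteq> S'\<close> that unfolding starlike_section_def by (metis subsetD)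
    show "0 \<in> ?T" by (rule image_eqI[of _ _ 0]) auto
    show "w \<in> ?T" by (rule image_eqI[of _ _ 1]) auto
    show "\<psi> 0 = \<psi>' 0" using assms unfolding starlike_section_def by simp
  qed
qed

lemma G_eq: "starlike_section S \<psi> \<Longrightarrow> w \<in> S \<Longrightarrow> G w = \<psi> w"
  unfolding G_def by (rule the_equality) (use starlike_section_unique in blast)+

lemma starlike_section_G:
  assumes "starlike_section S \<psi>"
  shows "starlike_section S G"
proof -
  have eq: "G w = \<psi> w" if "w \<in> S" for w using G_eq[OF assms that] .
  have "continuous_on S G"
    by (rule continuous_on_eq[of S \<psi>]) (use assms eq in \<open>auto simp: starlike_section_def\<close>)
  then show ?thesis using assms eq unfolding starlike_section_def by simp
qed

lemma zero_in_D: "0 \<in> D"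
proof -
  obtain N V \<phi> where N: "0 \<in> N" "open V" "F 0 \<in> V" "homeomorphism N V F \<phi>"
    using local_inverse[of 0] .
  obtain e where e: "0 < e" "ball 0 e \<subseteq> V" using N(2,3) open_contains_ball[of V] by auto
  have "starlike_section (ball 0 e) \<phi>"
    unfolding starlike_section_def
  proof (intro conjI ballI)
    fix w :: "real \<times> real" and t :: real assume "w \<in> ball 0 e" "t \<in> {0..1}"
    then have "\<bar>t\<bar> * norm w \<le> 1 * norm w" by (intro mult_right_mono) auto
    with \<open>w \<in> ball 0 e\<close> show "t *\<^sub>R w \<in> ball 0 e" by simp
  next
    show "continuous_on (ball 0 e) \<phi>"
      using homeomorphism_cont2[OF N(4)] e(2) continuous_on_subset by blast
    show "\<phi> 0 = 0" using homeomorphism_apply1[OF N(4,1)] by simp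
    show "F (\<phi> w) = w" if "w \<in> ball 0 e" for w
      using homeomorphism_apply2[OF N(4)] e(2) that by blast
  qed (use e in auto)
  then show ?thesis unfolding D_def using e by auto
qed

lemma section_D: "starlike_section D G"
proof -
  let ?A = "{S. \<exists>\<psi>. starlike_section S \<psi>}"
  have A: "open S" "continuous_on S G" "\<forall>w\<in>S. \<forall>t\<in>{0..1}. t *\<^sub>R w \<in> S" "G 0 = 0" "\<forall>w\<in>S. F (G w) = w"
    if "S \<in> ?A" for S
    using that starlike_section_G unfolding starlike_section_def by blast+
  have "open D" unfolding D_def using A(1) by blast
  moreover have "continuous_on D G"
    unfolding D_def by (rule continuous_on_open_Union) (use A in auto)
  moreover have "\<forall>w\<in>D. \<forall>t\<in>{0..1}. t *\<^sub>R w \<in> D" unfolding D_def using A(3) by blast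
  moreover have "G 0 = 0" using zero_in_D A(4) unfolding D_def by blast
  moreover have "\<forall>w\<in>D. F (G w) = w" using A(5) unfolding D_def by blast
  ultimately show ?thesis using zero_in_D unfolding starlike_section_def by blast
qed

lemma open_D: "open D" and G_0 [simp]: "G 0 = 0" and continuous_on_G: "continuous_on D G"
  and F_G: "w \<in> D \<Longrightarrow> F (G w) = w"
  using section_D unfolding starlike_section_def by auto

lemma section_subset_D: "starlike_section S \<psi> \<Longrightarrow> S \<subseteq> D"
  unfolding D_def by auto

lemma continuous_on_G_comp:
  "continuous_on A c \<Longrightarrow> c ` A \<subseteq> D \<Longrightarrow> continuous_on A (\<lambda>t. G (c t))"
  by (rule continuous_on_compose2[OF continuous_on_G])

lemma inj_on_G: "inj_on G D"
  by (rule inj_on_inverseI[of D F]) (rule F_G)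

lemma G_eq_0_iff: "w \<in> D \<Longrightarrow> G w = 0 \<longleftrightarrow> w = 0"
  using F_G by fastforce

lemma G_has_derivative:
  assumes "w \<in> D"
  shows "(G has_derivative DFinv (G w)) (at w)"
proof (rule has_derivative_inverse_basic[OF F_has_derivative bounded_linear_DFinv _ _ open_D assms F_G])
  show "DFinv (G w) \<circ> DF (G w) = id" by (auto simp: DFinv_DF)
  show "isCont G w" using continuous_on_G assms by (simp add: continuous_on_eq_continuous_at[OF open_D])
qed

lemma G_comp_has_vector_derivative:
  assumes "(c has_vector_derivative v) (at t within I)" "c t \<in> D"
  shows "((\<lambda>t. G (c t)) has_vector_derivative DFinv (G (c t)) v) (at t within I)"
  using vector_derivative_diff_chain_within[OF assms(1)] G_has_derivative[OF assms(2)]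
    has_derivative_at_withinI by (fastforce simp: o_def)

text \<open>If \<open>G (x n)\<close> tends to \<open>z\<close>, then continuity of \<open>F\<close>
  makes \<open>x n\<close> tend to \<open>F z\<close>.\<close>

lemma closure_G_image:
  assumes "S \<subseteq> D" "z \<in> closure (G ` S)"
  shows "F z \<in> closure S" "F z \<in> D \<Longrightarrow> G (F z) = z"
proof -
  obtain y where "\<forall>n. y n \<in> G ` S" "y \<longlonglongrightarrow> z" using assms(2) closure_sequential by blast
  then obtain x where x: "\<And>n. x n \<in> S" "(\<lambda>n. G (x n)) \<longlonglongrightarrow> z"
    unfolding image_iff by (metis (no_types, lifting) tendsto_cong eventually_sequentiallyI ext)
  have "(\<lambda>n. F (G (x n))) \<longlonglongrightarrow> F z"
    by (rule continuous_on_tendsto_compose[OF continuous_on_F[of UNIV] x(2)]) auto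
  moreover have "F (G (x n)) = x n" for n using F_G x(1) assms(1) by blast
  ultimately have lim: "x \<longlonglongrightarrow> F z" by simp
  then show "F z \<in> closure S" using x(1) closure_sequential by blast
  assume "F z \<in> D"
  moreover have "\<forall>\<^sub>F n in sequentially. x n \<in> D" using x(1) assms(1) by (intro always_eventually) blast
  ultimately have "(\<lambda>n. G (x n)) \<longlonglongrightarrow> G (F z)"
    using continuous_on_tendsto_compose[OF continuous_on_G lim] by blast
  then show "G (F z) = z" using x(2) LIMSEQ_unique by blast
qed

text \<open>The image is open by invariance of domain, and the last assumption makes it
  closed.\<close>

lemma G_image_UNIV:
  assumes "S \<subseteq> D" "open S" "S \<noteq> {}" "\<And>z. z \<in> closure (G ` S) \<Longrightarrow> F z \<in> S"
  shows "G ` S = UNIV"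
proof -
  have "open (G ` S)"
    by (rule invariance_of_domain)
      (use assms continuous_on_subset[OF continuous_on_G] inj_on_subset[OF inj_on_G] in auto)
  moreover have "closed (G ` S)"
  proof -
    have "closure (G ` S) \<subseteq> G ` S"
    proof
      fix z assume z: "z \<in> closure (G ` S)"
      then have "F z \<in> S" by (rule assms(4))
      moreover from this have "G (F z) = z" using closure_G_image(2)[OF assms(1) z] assms(1) by blast
      ultimately show "z \<in> G ` S" by (metis imageI)
    qed
    then show ?thesis by (simp add: closure_subset_eq)
  qed
  ultimately show ?thesis using clopen[of "G ` S"] assms(3) by auto
qed

lemma bij_F_if_D_UNIV:
  assumes "D = UNIV"
  shows "bij F"
proof -
  have "G ` UNIV = UNIV" by (rule G_image_UNIV) (use assms in auto)
  then have "bij G" using inj_on_G assms by (simp add: bij_def)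
  moreover have "F = inv G"
    using F_G assms \<open>bij G\<close> by (metis UNIV_I bij_inv_eq_iff ext)
  ultimately show ?thesis by (simp add: bij_imp_bij_inv)
qed

text \<open>The local inverse of \<open>F\<close> at \<open>z\<close> coincides with
  \<open>G\<close> at one point near \<open>w\<close>, hence on the overlap of two discs. Glued
  together they form a section on a larger starlike set, which \<open>D\<close> contains by
  maximality.\<close>

lemma inverse_branch_extends:
  assumes R: "0 < R" "ball 0 R \<subseteq> D" and w: "norm w = R" "F z = w"
    and near: "\<And>\<epsilon>. 0 < \<epsilon> \<Longrightarrow> \<exists>w'\<in>D \<inter> cball 0 R \<inter> ball w \<epsilon>. dist (G w') z < \<epsilon>"
  shows "w \<in> D"
proof -
  obtain N V \<phi> where N: "open N" "z \<in> N" "open V" "F z \<in> V" "homeomorphism N V F \<phi>"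
    using local_inverse[of z] .
  obtain \<epsilon>1 where e1: "0 < \<epsilon>1" "ball w \<epsilon>1 \<subseteq> V" using N w open_contains_ball[of V] by auto
  obtain \<epsilon>2 where e2: "0 < \<epsilon>2" "ball z \<epsilon>2 \<subseteq> N" using N open_contains_ball[of N] by auto
  define \<epsilon> where "\<epsilon> = \<epsilon>1"
  have "0 < min \<epsilon>1 \<epsilon>2" using e1 e2 by simp
  from near[OF this] obtain w' where w'0: "w' \<in> D \<inter> cball 0 R \<inter> ball w (min \<epsilon>1 \<epsilon>2)" "dist (G w') z < min \<epsilon>1 \<epsilon>2"
    by blast
  then have w'1: "w' \<in> D" "norm w' \<le> R" "w' \<in> ball w \<epsilon>1" by auto
  have "G w' \<in> ball z \<epsilon>2" using w'0 by (simp add: dist_commute)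
  then have "G w' \<in> N" using e2 by blast
  note w' = w'1 this
  have \<phi>w': "\<phi> w' = G w'" using homeomorphism_apply1[OF N(5) w'(4)] F_G[OF w'(1)] by simp
  define C where "C = ball 0 R \<inter> ball w \<epsilon>"
  have F\<phi>: "F (\<phi> y) = y" if "y \<in> ball w \<epsilon>" for y
    using homeomorphism_apply2[OF N(5)] e1(2) that unfolding \<epsilon>_def by blast
  have c\<phi>: "continuous_on (ball w \<epsilon>) \<phi>"
    using homeomorphism_cont2[OF N(5)] e1(2) continuous_on_subset unfolding \<epsilon>_def by blast
  \<comment> \<open>\<open>w'\<close> may lie on the bounding circle, outside the open set
    \<open>C\<close>. It is in the closure of \<open>C\<close>, so adding it keeps the set
    connected.\<close>
  have agree: "G y = \<phi> y" if "y \<in> C" for y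
  proof (rule lifts_agree[of "insert w' C" G \<phi> w'])
    have "w' \<in> closure C"
      using open_Int_closure_subset[of "ball w \<epsilon>" "ball 0 R"] w' R by (auto simp: C_def \<epsilon>_def Int_commute)
    then have "insert w' C \<subseteq> closure C" using closure_subset[of C] by blast
    moreover have "connected C" unfolding C_def by (intro convex_connected convex_Int convex_ball)
    ultimately show "connected (insert w' C)"
      by (intro connected_intermediate_closure[of C "insert w' C"]) blast+
    show "continuous_on (insert w' C) G"
      by (rule continuous_on_subset[OF continuous_on_G]) (use w'(1) R(2) in \<open>unfold C_def, blast\<close>)
    show "continuous_on (insert w' C) \<phi>"
      by (rule continuous_on_subset[OF c\<phi>]) (use w'(3) in \<open>unfold C_def \<epsilon>_def, blast\<close>)
    show "F (G t) = F (\<phi> t)" if "t \<in> insert w' C" for t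
    proof -
      have "t \<in> ball w \<epsilon>" "t \<in> D" using that w'(1,3) R(2) unfolding C_def \<epsilon>_def by blast+
      then show ?thesis using F\<phi>[of t] F_G[of t] by simp
    qed
  qed (use that \<phi>w' in auto)
  define \<psi> where "\<psi> = (\<lambda>y. if y \<in> ball 0 R then G y else \<phi> y)"
  have \<psi>G: "\<psi> y = G y" if "y \<in> ball 0 R" for y using that by (simp add: \<psi>_def)
  have \<psi>\<phi>: "\<psi> y = \<phi> y" if "y \<in> ball w \<epsilon>" for y using that agree[of y] by (simp add: \<psi>_def C_def)
  have "starlike_section (ball 0 R \<union> ball w \<epsilon>) \<psi>"
    unfolding starlike_section_def
  proof (intro conjI ballI)
    fix y :: "real \<times> real" and t :: real assume y: "y \<in> ball 0 R \<union> ball w \<epsilon>" and t: "t \<in> {0..1}"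
    show "t *\<^sub>R y \<in> ball 0 R \<union> ball w \<epsilon>"
    proof (cases "norm (t *\<^sub>R y) < R")
      \<comment> \<open>Here \<open>t *\<^sub>R y\<close> is still outside the open disc, and
        shrinking \<open>y\<close> to it does not increase the distance to \<open>w\<close>: the
        squared distances differ by
        \<open>(1 - t) * ((norm y)\<^sup>2 * (1 + t) - 2 * (w \<bullet> y))\<close>, where
        \<open>w \<bullet> y \<le> R * norm y\<close>.\<close>
      case False
      then have ty: "R \<le> t * norm y" using t by simp
      have tn: "t * norm y \<le> norm y" using t by (simp add: mult_left_le_one_le)
      then have y': "y \<in> ball w \<epsilon>" using y ty by auto
      have "w \<bullet> y \<le> R * norm y" using norm_cauchy_schwarz[of w y] w by simp
      then have "0 \<le> (1 - t) * ((norm y)\<^sup>2 * (1 + t) - 2 * (w \<bullet> y))"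
      proof (intro mult_nonneg_nonneg)
        have "2 * R * norm y \<le> (norm y + t * norm y) * norm y"
          using ty tn by (intro mult_right_mono) auto
        with \<open>w \<bullet> y \<le> R * norm y\<close> show "0 \<le> (norm y)\<^sup>2 * (1 + t) - 2 * (w \<bullet> y)"
          by (simp add: power2_eq_square algebra_simps)
      qed (use t in auto)
      also have "\<dots> = (norm (w - y))\<^sup>2 - (norm (w - t *\<^sub>R y))\<^sup>2"
      proof -
        have "(norm (w - y))\<^sup>2 = w \<bullet> w - 2 * (w \<bullet> y) + (norm y)\<^sup>2"
          unfolding power2_norm_eq_inner by (simp add: inner_diff_left inner_diff_right inner_commute[of y w])
        moreover have "(norm (w - t *\<^sub>R y))\<^sup>2 = w \<bullet> w - 2 * t * (w \<bullet> y) + t * t * (norm y)\<^sup>2"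
          unfolding power2_norm_eq_inner
          by (simp add: inner_diff_left inner_diff_right inner_commute[of y w] algebra_simps)
        ultimately show ?thesis by (simp only:) (simp add: algebra_simps)
      qed
      finally have "(norm (w - t *\<^sub>R y))\<^sup>2 \<le> (norm (w - y))\<^sup>2" by simp
      then have "norm (w - t *\<^sub>R y) \<le> norm (w - y)" by (rule power2_le_imp_le[OF _ norm_ge_zero])
      with y' show ?thesis by (simp add: dist_norm)
    qed auto
  next
    have "continuous_on (ball 0 R) \<psi>" "continuous_on (ball w \<epsilon>) \<psi>"
      by (rule continuous_on_eq[OF continuous_on_subset[OF continuous_on_G R(2)] \<psi>G[symmetric]], assumption)
        (rule continuous_on_eq[OF c\<phi> \<psi>\<phi>[symmetric]])
    then show "continuous_on (ball 0 R \<union> ball w \<epsilon>) \<psi>" by (intro continuous_on_open_Un) auto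
    show "\<psi> 0 = 0" using R by (simp add: \<psi>_def)
    show "F (\<psi> y) = y" if "y \<in> ball 0 R \<union> ball w \<epsilon>" for y
      using that
    proof
      assume "y \<in> ball 0 R"
      then show ?thesis using F_G[of y] R(2) \<psi>G[of y] by auto
    next
      assume "y \<in> ball w \<epsilon>"
      then show ?thesis using F\<phi>[of y] \<psi>\<phi>[of y] by simp
    qed
  qed (use R in auto)
  then have "ball 0 R \<union> ball w \<epsilon> \<subseteq> D" by (rule section_subset_D)
  then show ?thesis using e1 by (auto simp: \<epsilon>_def)
qed

text \<open>If the values stayed bounded along a sequence tending to \<open>w\<close>, some of them
  would converge to a point \<open>z\<close> with \<open>F z = w\<close>, and the branch would
  extend to \<open>w\<close>.\<close>

lemma inverse_branch_blows_up:
  assumes R: "0 < R" "ball 0 R \<subseteq> D" and w: "norm w = R" "w \<notin> D"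
  shows "\<exists>\<epsilon>>0. \<forall>w'\<in>D \<inter> cball 0 R \<inter> ball w \<epsilon>. M < norm (G w')"
proof (rule ccontr)
  assume neg: "\<not> ?thesis"
  have "\<exists>w'. w' \<in> D \<inter> cball 0 R \<inter> ball w (1 / real (Suc n)) \<and> norm (G w') \<le> M" for n
  proof -
    have "0 < 1 / real (Suc n)" by simp
    then have "\<exists>w'\<in>D \<inter> cball 0 R \<inter> ball w (1 / real (Suc n)). \<not> M < norm (G w')" using neg by blast
    then show ?thesis unfolding not_less by blast
  qed
  then obtain x where x: "\<And>n. x n \<in> D \<inter> cball 0 R \<inter> ball w (1 / real (Suc n))" "\<And>n. norm (G (x n)) \<le> M"
    by metis
  have "\<forall>n. G (x n) \<in> cball 0 M" using x(2) by simp
  then obtain z r where r: "strict_mono (r :: nat \<Rightarrow> nat)" "((\<lambda>n. G (x n)) \<circ> r) \<longlonglongrightarrow> z"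
    by (rule seq_compactE[OF compact_imp_seq_compact[OF compact_cball]])
  have "(\<lambda>n. dist w (x n)) \<longlonglongrightarrow> 0"
  proof (rule tendsto_sandwich[OF _ _ tendsto_const lim_1_over_n[THEN LIMSEQ_Suc]])
    show "\<forall>\<^sub>F n in sequentially. dist w (x n) \<le> 1 / real (Suc n)"
      using x(1) by (intro always_eventually allI) (auto intro: less_imp_le)
  qed auto
  then have xw: "x \<longlonglongrightarrow> w" unfolding tendsto_dist_iff[of x] by (simp add: dist_commute)
  then have xr: "(\<lambda>n. x (r n)) \<longlonglongrightarrow> w" using LIMSEQ_subseq_LIMSEQ[OF xw r(1)] by (simp add: o_def)
  have Gr: "(\<lambda>n. G (x (r n))) \<longlonglongrightarrow> z" using r(2) by (simp add: o_def)
  have "(\<lambda>n. F (G (x (r n)))) \<longlonglongrightarrow> F z"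
    by (rule continuous_on_tendsto_compose[OF continuous_on_F[of UNIV] Gr]) auto
  moreover have "F (G (x n)) = x n" for n using F_G x(1) by auto
  ultimately have "F z = w" using xr LIMSEQ_unique by auto
  have "w \<in> D"
  proof (rule inverse_branch_extends[OF R w(1) \<open>F z = w\<close>])
    fix \<epsilon> :: real assume "0 < \<epsilon>"
    then have "\<forall>\<^sub>F n in sequentially. dist (x (r n)) w < \<epsilon> \<and> dist (G (x (r n))) z < \<epsilon>"
      using tendstoD[OF xr] tendstoD[OF Gr] by (intro eventually_conj) auto
    then obtain n where "dist (x (r n)) w < \<epsilon>" "dist (G (x (r n))) z < \<epsilon>"
      by (auto dest: eventually_happens)
    then show "\<exists>w'\<in>D \<inter> cball 0 R \<inter> ball w \<epsilon>. dist (G w') z < \<epsilon>"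
      using x(1)[of "r n"] by (intro bexI[of _ "x (r n)"]) (auto simp: dist_commute)
  qed
  with w show False by simp
qed

end

section \<open>The largest disc in the domain of the inverse branch\<close>

context positive_jacobian
begin

text \<open>\<open>R\<close> is the distance of the complement of \<open>D\<close> from the origin.
  If the whole circle were missing, blow-up would make the image of the disc under \<open>G\<close>
  closed, hence the whole plane, and \<open>F\<close> would be bounded by \<open>R\<close>. Bounded
  polynomials are constant, against the positive Jacobian determinant.\<close>

lemma not_bij_radius:
  assumes "\<not> bij F"
  obtains R where "0 < R" "ball 0 R \<subseteq> D" "\<exists>w. norm w = R \<and> w \<notin> D" "\<exists>w. norm w = R \<and> w \<in> D"
proof -
  have "- D \<noteq> {}" using bij_F_if_D_UNIV assms by blast
  moreover have "closed (- D)" using open_D by (simp add: closed_def)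
  ultimately obtain w0 where w0: "w0 \<in> - D" "\<And>y. y \<in> - D \<Longrightarrow> dist 0 w0 \<le> dist 0 y"
    using distance_attains_inf[of "- D" 0] by blast
  define R where "R = norm w0"
  have "w0 \<noteq> 0" using w0(1) zero_in_D by blast
  then have R: "0 < R" by (simp add: R_def)
  have ball: "ball 0 R \<subseteq> D"
  proof
    fix y :: "real \<times> real" assume "y \<in> ball 0 R"
    then show "y \<in> D" using w0(2)[of y] by (cases "y \<in> D") (simp_all add: R_def)
  qed
  have "\<exists>w. norm w = R \<and> w \<in> D"
  proof (rule ccontr)
    assume bad: "\<not> ?thesis"
    have "G ` ball 0 R = UNIV"
    proof (rule G_image_UNIV[OF ball open_ball])
      fix z assume z: "z \<in> closure (G ` ball 0 R)"
      have cl: "F z \<in> cball 0 R" using closure_G_image(1)[OF ball z] R by simp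
      show "F z \<in> ball 0 R"
      proof (rule ccontr)
        assume "F z \<notin> ball 0 R"
        with cl have n: "norm (F z) = R" by simp
        with bad have "F z \<notin> D" by blast
        from inverse_branch_blows_up[OF R ball n this, of "norm z + 1"] obtain \<epsilon> where
          \<epsilon>: "0 < \<epsilon>" "\<And>w'. w' \<in> D \<inter> cball 0 R \<inter> ball (F z) \<epsilon> \<Longrightarrow> norm z + 1 < norm (G w')" by blast
        \<comment> \<open>A neighbourhood of \<open>z\<close> whose points have norm below
          \<open>norm z + 1\<close> and are mapped close to \<open>F z\<close>. Points of the branch
          in it would have to exceed that bound.\<close>
        define W where "W = ball 0 (norm z + 1) \<inter> F -` ball (F z) \<epsilon>"
        have "open W" unfolding W_def
          by (intro open_Int open_ball open_vimage continuous_on_F)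
        moreover have "z \<in> W" using \<epsilon> by (simp add: W_def)
        ultimately have "W \<inter> G ` ball 0 R \<noteq> {}"
          using open_Int_closure_eq_empty[of W "G ` ball 0 R"] z by blast
        then obtain w' where w': "w' \<in> ball 0 R" "G w' \<in> W" by blast
        then have "w' \<in> D" using ball by blast
        then have "w' \<in> ball (F z) \<epsilon>" "norm (G w') < norm z + 1"
          using w'(2) F_G by (simp_all add: W_def)
        moreover have "w' \<in> cball 0 R" using w'(1) by simp
        ultimately show False using \<epsilon>(2)[of w'] \<open>w' \<in> D\<close> by simp
      qed
    qed (use R in auto)
    then have bd: "norm (F z) < R" for z
    proof -
      obtain w where "w \<in> ball 0 R" "z = G w" using \<open>G ` ball 0 R = UNIV\<close> by (metis UNIV_I imageE)
      then show ?thesis using F_G ball by fastforce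
    qed
    have "\<bar>eval_xy f x y\<bar> \<le> R" "\<bar>eval_xy g x y\<bar> \<le> R" for x y
      using bd[of "(x, y)"] norm_fst_le[of "eval_xy f x y" "eval_xy g x y"]
        norm_snd_le[of "eval_xy g x y" "eval_xy f x y"]
      by (auto simp: F_def poly_map_def)
    then have "J 0 = 0"
      unfolding J_eq fx_def gx_def fy_def gy_def
      using bounded_eval_xy_imp_deriv_zero[of f R] by simp
    then show False using J_pos[of 0] by simp
  qed
  moreover have "norm w0 = R \<and> w0 \<notin> D" using w0(1) by (simp add: R_def)
  then have "\<exists>w. norm w = R \<and> w \<notin> D" ..
  ultimately show ?thesis by (intro that[OF R ball])
qed

end

section \<open>Maps that are not bijective\<close>

locale nonproper_map = positive_jacobian +
  fixes R :: real
  assumes R_pos: "0 < R" and ball_D: "ball 0 R \<subseteq> D"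
    and bad_ex: "\<exists>w. norm w = R \<and> w \<notin> D" and good_ex: "\<exists>w. norm w = R \<and> w \<in> D"
begin

lemma blow_up_tendsto:
  assumes lim: "(a \<longlongrightarrow> w) \<A>" and ev: "\<forall>\<^sub>F x in \<A>. a x \<in> D \<and> norm (a x) \<le> R"
    and w: "norm w = R" "w \<notin> D"
  shows "((\<lambda>x. inversion (G (a x))) \<longlongrightarrow> 0) \<A>"
proof (rule tendstoI)
  fix e :: real assume e: "0 < e"
  obtain \<epsilon> where \<epsilon>: "0 < \<epsilon>" "\<And>w'. w' \<in> D \<inter> cball 0 R \<inter> ball w \<epsilon> \<Longrightarrow> inverse e < norm (G w')"
    using inverse_branch_blows_up[OF R_pos ball_D w] by blast
  have "\<forall>\<^sub>F x in \<A>. dist (a x) w < \<epsilon>" using tendstoD[OF lim \<epsilon>(1)] .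
  with ev show "\<forall>\<^sub>F x in \<A>. dist (inversion (G (a x))) 0 < e"
  proof eventually_elim
    case (elim x)
    then have "inverse e < norm (G (a x))" by (intro \<epsilon>(2)) (auto simp: dist_commute)
    then have "inverse (norm (G (a x))) < inverse (inverse e)"
      using e by (intro less_imp_inverse_less) simp_all
    then show ?case by simp
  qed
qed

text \<open>The lift cannot reach a missing point, because \<open>G\<close> is unbounded near that
  point while the lift is continuous; inside \<open>D\<close>, uniqueness of lifts applies.\<close>

lemma lift_stays_in_D:
  assumes T: "connected T" and \<eta>: "continuous_on T \<eta>" and w: "continuous_on T w"
    and eq: "\<And>t. t \<in> T \<Longrightarrow> F (\<eta> t) = w t" and le: "\<And>t. t \<in> T \<Longrightarrow> norm (w t) \<le> R"
    and t0: "t0 \<in> T" "w t0 \<in> D" "\<eta> t0 = G (w t0)" and t: "t \<in> T"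
  shows "w t \<in> D \<and> \<eta> t = G (w t)"
proof (rule connected_all[where P = "\<lambda>t. w t \<in> D \<and> \<eta> t = G (w t)", OF T t0(1) _ _ _ t])
  define T' where "T' = T \<inter> w -` D"
  have oT': "openin (top_of_set T) T'"
    unfolding T'_def by (rule continuous_openin_preimage_gen[OF w open_D])
  have TT: "T' \<subseteq> T" by (simp add: T'_def)
  have cG: "continuous_on T' (\<lambda>t. G (w t))"
    by (rule continuous_on_G_comp[OF continuous_on_subset[OF w TT]]) (auto simp: T'_def)
  have c\<eta>: "continuous_on T' \<eta>" by (rule continuous_on_subset[OF \<eta> TT])
  show "w t0 \<in> D \<and> \<eta> t0 = G (w t0)" using t0 by blast
  {
    fix t assume t: "t \<in> T" "w t \<in> D \<and> \<eta> t = G (w t)"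
    obtain N V \<phi> where N: "open N" "\<eta> t \<in> N" "homeomorphism N V F \<phi>" using local_inverse[of "\<eta> t"] .
    let ?U = "(T' \<inter> \<eta> -` N) \<inter> (T' \<inter> (\<lambda>t. G (w t)) -` N)"
    have "openin (top_of_set T) ?U"
      by (intro openin_trans[OF _ oT'] openin_Int continuous_openin_preimage_gen cG c\<eta> N)
    moreover have "w s \<in> D \<and> \<eta> s = G (w s)" if "s \<in> ?U" for s
    proof -
      have s: "s \<in> T" "w s \<in> D" "\<eta> s \<in> N" "G (w s) \<in> N" using that by (auto simp: T'_def)
      have "\<eta> s = \<phi> (F (\<eta> s))" using homeomorphism_apply1[OF N(3) s(3)] by simp
      also have "\<dots> = \<phi> (F (G (w s)))" using eq[OF s(1)] F_G[OF s(2)] by simp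
      also have "\<dots> = G (w s)" using homeomorphism_apply1[OF N(3) s(4)] by simp
      finally show ?thesis using s by simp
    qed
    moreover have "t \<in> ?U" using t N by (auto simp: T'_def)
    ultimately show "\<exists>U. openin (top_of_set T) U \<and> t \<in> U \<and> (\<forall>s\<in>U. w s \<in> D \<and> \<eta> s = G (w s))"
      by blast
  next
    fix t assume t: "t \<in> T" "\<not> (w t \<in> D \<and> \<eta> t = G (w t))"
    show "\<exists>U. openin (top_of_set T) U \<and> t \<in> U \<and> (\<forall>s\<in>U. \<not> (w s \<in> D \<and> \<eta> s = G (w s)))"
    proof (cases "w t \<in> D")
      case True
      let ?U = "T' \<inter> (\<lambda>t. \<eta> t - G (w t)) -` (- {0})"
      have "openin (top_of_set T) ?U"
        by (intro openin_trans[OF _ oT'] continuous_openin_preimage_gen continuous_on_diff c\<eta> cG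
            open_Compl closed_singleton)
      moreover have "t \<in> ?U" using t True by (auto simp: T'_def)
      ultimately show ?thesis by (intro exI[of _ ?U]) auto
    next
      case False
      then have n: "norm (w t) = R" using ball_D le[OF t(1)] by (cases "norm (w t) < R") auto
      obtain \<epsilon> where \<epsilon>: "0 < \<epsilon>"
        "\<And>w'. w' \<in> D \<inter> cball 0 R \<inter> ball (w t) \<epsilon> \<Longrightarrow> norm (\<eta> t) + 1 < norm (G w')"
        using inverse_branch_blows_up[OF R_pos ball_D n False] by blast
      let ?U = "(T \<inter> \<eta> -` ball 0 (norm (\<eta> t) + 1)) \<inter> (T \<inter> w -` ball (w t) \<epsilon>)"
      have "openin (top_of_set T) ?U"
        by (intro openin_Int continuous_openin_preimage_gen w \<eta> open_ball)
      moreover have "t \<in> ?U" using t \<epsilon> by simp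
      moreover have "\<not> (w s \<in> D \<and> \<eta> s = G (w s))" if "s \<in> ?U" for s
        using \<epsilon>(2)[of "w s"] that le[of s] by auto
      ultimately show ?thesis by blast
    qed
  }
qed

definition good :: "real \<Rightarrow> bool" where "good a \<longleftrightarrow> polar R a \<in> D"

lemma open_good: "open {a. good a}"
proof -
  have "continuous_on UNIV (\<lambda>a. polar R a)"
    by (intro continuous_on_polar continuous_on_const continuous_on_id)
  from open_vimage[OF open_D this] show ?thesis by (simp add: good_def vimage_def)
qed

lemma good_2pi: "good (a + 2 * pi) \<longleftrightarrow> good a"
  by (simp add: good_def)

lemma good_2pi_nat: "good (a + 2 * pi * real n) \<longleftrightarrow> good a"
proof (induction n)
  case (Suc n)
  then show ?case using good_2pi[of "a + 2 * pi * real n"] by (simp add: algebra_simps)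
qed simp

lemma good_2pi_int: "good (a + 2 * pi * of_int n) \<longleftrightarrow> good a"
proof (cases "0 \<le> n")
  case True
  then show ?thesis using good_2pi_nat[of a "nat n"] by simp
next
  case False
  then show ?thesis using good_2pi_nat[of "a + 2 * pi * of_int n" "nat (- n)"] by simp
qed

lemma shift_into_interval:
  obtains n :: int where "c \<le> a + 2 * pi * of_int n" "a + 2 * pi * of_int n < c + 2 * pi"
proof -
  define n where "n = \<lceil>(c - a) / (2 * pi)\<rceil>"
  have "(c - a) / (2 * pi) \<le> of_int n" "of_int n < (c - a) / (2 * pi) + 1"
    unfolding n_def by linarith+
  then have "c \<le> a + 2 * pi * of_int n" "a + 2 * pi * of_int n < c + 2 * pi"
    using pi_gt_zero by (simp_all add: field_simps)
  then show ?thesis by (rule that)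
qed

lemma bad_angle: obtains b where "c \<le> b" "b < c + 2 * pi" "\<not> good b"
proof -
  obtain w where w: "norm w = R" "w \<notin> D" using bad_ex by blast
  obtain a where "w = polar R a" using polar_ex[of w] w by auto
  then have "\<not> good a" using w by (simp add: good_def)
  then show ?thesis using shift_into_interval[of c a] that good_2pi_int by metis
qed

lemma good_angle: obtains a where "good a"
proof -
  obtain w where w: "norm w = R" "w \<in> D" using good_ex by blast
  obtain a where "w = polar R a" using polar_ex[of w] w by auto
  then show ?thesis using w that by (auto simp: good_def)
qed

text \<open>The bad angles form a closed set, so the infimum of those after \<open>a\<close> is
  attained.\<close>

lemma first_bad:
  assumes "good a" "a \<le> c" "\<not> good c"
  obtains b where "a < b" "b \<le> c" "\<not> good b" "\<And>x. a \<le> x \<Longrightarrow> x < b \<Longrightarrow> good x"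
proof -
  define S where "S = {a..} \<inter> - {a. good a}"
  have S: "closed S" "c \<in> S" "bdd_below S"
    unfolding S_def using open_good assms by (auto intro!: closed_Int bdd_belowI[of _ a] simp: closed_def)
  have "Inf S \<in> S" by (rule closed_contains_Inf) (use S in auto)
  moreover have "good x" if "a \<le> x" "x < Inf S" for x
    using cInf_lower[of x S] S(3) that by (force simp: S_def)
  moreover have "Inf S \<le> c" using cInf_lower S by blast
  ultimately show ?thesis
    using that[of "Inf S"] assms by (force simp: S_def less_le)
qed

lemma gap_end_tendsto:
  assumes "a < b" "\<not> good b" "\<And>x. a \<le> x \<Longrightarrow> x < b \<Longrightarrow> good x"
  shows "((\<lambda>x. inversion (G (polar R x))) \<longlongrightarrow> 0) (at_left b)"
proof (rule blow_up_tendsto[where w = "polar R b"])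
  show "((\<lambda>x. polar R x) \<longlongrightarrow> polar R b) (at_left b)"
    unfolding polar_def by (intro tendsto_intros)
  have "\<forall>\<^sub>F x in at_left b. a < x \<and> x < b"
    using eventually_at_left[OF assms(1)] assms(1) by blast
  then show "\<forall>\<^sub>F x in at_left b. polar R x \<in> D \<and> norm (polar R x) \<le> R"
    by eventually_elim (use assms(3) R_pos in \<open>auto simp: good_def\<close>)
qed (use assms R_pos in \<open>auto simp: good_def\<close>)

text \<open>Near the end of a gap \<open>G\<close> is large and its inversion small. The points
  found here are the starting points that refute a center and monodromy.\<close>

lemma orbit_near_origin:
  assumes "0 < e"
  obtains w where "w \<in> D" "norm w = R" "norm (inversion (G w)) < e"
proof -
  obtain a where a: "good a" using good_angle .
  obtain c where "a \<le> c" "\<not> good c" using bad_angle[of a] by blast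
  from first_bad[OF a this] obtain b where b: "a < b" "\<not> good b" "\<And>x. a \<le> x \<Longrightarrow> x < b \<Longrightarrow> good x" by blast
  have "\<forall>\<^sub>F x in at_left b. dist (inversion (G (polar R x))) 0 < e"
    using tendstoD[OF gap_end_tendsto[OF b] assms] .
  moreover have "\<forall>\<^sub>F x in at_left b. a < x \<and> x < b"
    using eventually_at_left[OF b(1)] b(1) by blast
  ultimately have "\<forall>\<^sub>F x in at_left b. good x \<and> norm (inversion (G (polar R x))) < e"
    by eventually_elim (use b in auto)
  then obtain x where "good x" "norm (inversion (G (polar R x))) < e"
    using eventually_happens[of _ "at_left b"] by auto
  then show ?thesis using that[of "polar R x"] R_pos by (auto simp: good_def)
qed

text \<open>Along the orbit the angle runs injectively through an interval without bad angles. Bad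
  angles recur with period \<open>2 * pi\<close>, so this interval is too short for the orbit to
  return to a point.\<close>

lemma solution_in_gap_inj:
  assumes I: "is_interval I" "t0 \<in> I"
    and \<gamma>: "\<And>t. t \<in> I \<Longrightarrow> (\<gamma> has_vector_derivative \<sigma> *\<^sub>R B (\<gamma> t)) (at t within I)"
    and nz: "\<And>t. t \<in> I \<Longrightarrow> \<gamma> t \<noteq> 0" and \<sigma>: "0 < \<bar>\<sigma>\<bar>"
    and w: "w \<in> D" "norm w = R" "\<gamma> t0 = inversion (G w)"
  shows "inj_on \<gamma> I" "\<And>t. t \<in> I \<Longrightarrow> norm (F (inversion (\<gamma> t))) = R"
proof -
  obtain r \<phi> where \<phi>: "0 \<le> r" "continuous_on I \<phi>" "inj_on \<phi> I"
    "\<And>t. t \<in> I \<Longrightarrow> F (inversion (\<gamma> t)) = polar r (\<phi> t)"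
    using solution_angle[OF I(1) \<gamma> nz \<sigma>] by blast
  have w0: "polar r (\<phi> t0) = w" using \<phi>(4)[OF I(2)] w F_G by simp
  then have r: "r = R" using \<phi>(1) w(2) norm_polar[of r "\<phi> t0"] by simp
  show nR: "norm (F (inversion (\<gamma> t))) = R" if "t \<in> I" for t
    using \<phi>(4)[OF that] r R_pos by simp
  have c\<gamma>: "continuous_on I \<gamma>"
    unfolding continuous_on_eq_continuous_within using \<gamma> has_vector_derivative_continuous by blast
  have con: "connected I" using I(1) by (simp add: is_interval_connected_1)
  have good: "good (\<phi> t)" if "t \<in> I" for t
    unfolding good_def
  proof (rule lift_stays_in_D[of I "\<lambda>t. inversion (\<gamma> t)" "\<lambda>t. polar R (\<phi> t)" t0, THEN conjunct1])
    show "continuous_on I (\<lambda>t. inversion (\<gamma> t))" by (rule continuous_on_inversion[OF c\<gamma> nz])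
    show "continuous_on I (\<lambda>t. polar R (\<phi> t))" by (intro continuous_on_polar continuous_on_const \<phi>(2))
  qed (use con \<phi>(4) r R_pos I w w0 that in auto)
  have lt: "\<bar>\<phi> s - \<phi> t\<bar> < 2 * pi" if "s \<in> I" "t \<in> I" for s t
  proof -
    have int: "is_interval (\<phi> ` I)"
      using connected_continuous_image[OF \<phi>(2) con] by (simp add: is_interval_connected_1)
    have "\<phi> s < \<phi> t + 2 * pi" if st: "s \<in> I" "t \<in> I" for s t
    proof (rule ccontr)
      assume "\<not> \<phi> s < \<phi> t + 2 * pi"
      obtain b where b: "\<phi> t \<le> b" "b < \<phi> t + 2 * pi" "\<not> good b" using bad_angle .
      then have "b \<le> \<phi> s" using \<open>\<not> \<phi> s < \<phi> t + 2 * pi\<close> by linarith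
      with b(1) have "b \<in> \<phi> ` I"
        by (rule mem_is_interval_1_I[OF int imageI[OF st(2)] imageI[OF st(1)]])
      with good b show False by blast
    qed
    from this[OF that] this[OF that(2,1)] show ?thesis by linarith
  qed
  show "inj_on \<gamma> I"
  proof (rule inj_onI)
    fix s t assume st: "s \<in> I" "t \<in> I" "\<gamma> s = \<gamma> t"
    then have "polar R (\<phi> s) = polar R (\<phi> t)" using \<phi>(4) r by metis
    then have "\<phi> s = \<phi> t" using polar_inj lt st R_pos by (metis less_irrefl)
    with \<phi>(3) st show "s = t" by (meson inj_onD)
  qed
qed

lemma not_center: "\<not> is_center B 0"
proof
  assume "is_center B 0"
  then obtain U where U: "open U" "0 \<in> U" "\<forall>p\<in>U - {0}. B p \<noteq> 0 \<and>
         (\<exists>\<gamma> T. T > 0 \<and> solves B \<gamma> UNIV \<and> \<gamma> 0 = p \<and> (\<forall>t. \<gamma> (t + T) = \<gamma> t) \<and> range \<gamma> \<subseteq> U - {0})"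
    unfolding is_center_def by blast
  obtain e where e: "0 < e" "ball 0 e \<subseteq> U" using U open_contains_ball by blast
  obtain w where w: "w \<in> D" "norm w = R" "norm (inversion (G w)) < e" using orbit_near_origin[OF e(1)] .
  have "w \<noteq> 0" using w(2) R_pos by auto
  then have "G w \<noteq> 0" using G_eq_0_iff[OF w(1)] by simp
  then have "inversion (G w) \<noteq> 0" by simp
  moreover have "inversion (G w) \<in> U" using w(3) e(2) by (meson mem_ball_0 subsetD)
  ultimately obtain \<gamma> T where \<gamma>: "T > 0" "solves B \<gamma> UNIV" "\<gamma> 0 = inversion (G w)" "\<forall>t. \<gamma> (t + T) = \<gamma> t"
    "range \<gamma> \<subseteq> U - {0}" using U(3) by blast
  have "\<gamma> t \<noteq> 0" for t using \<gamma>(5) by blast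
  then have "inj_on \<gamma> UNIV"
    by (intro solution_in_gap_inj(1)[of UNIV 0 \<gamma> 1 w]) (use \<gamma> w in \<open>auto simp: solves_def\<close>)
  then have "0 + T = 0" using \<gamma>(4) by (metis UNIV_I inj_onD)
  with \<gamma>(1) show False by simp
qed

text \<open>On the axis these are the zeros of a polynomial in one variable, which has the value
  \<open>- R\<^sup>2\<close> at the origin because \<open>F 0 = 0\<close>.\<close>

lemma finitely_many_axis_crossings:
  "finite {z. snd z = 0 \<and> norm (F z) = R}"
proof -
  obtain q where q: "\<And>x. poly q x = eval_xy (f\<^sup>2 + g\<^sup>2 - [:[:R\<^sup>2:]:]) x 0"
    using eval_xy_section[of _ 0] by metis
  have eq: "poly q x = (norm (F (x, 0)))\<^sup>2 - R\<^sup>2" for x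
    unfolding q norm_prod_power2 by (simp add: F_def poly_map_def)
  have "poly q 0 \<noteq> 0" using eq[of 0] R_pos by (simp flip: zero_prod_def)
  then have "finite {x. poly q x = 0}" by (intro poly_roots_finite) auto
  then have "finite ((\<lambda>x. (x, 0)) ` {x. poly q x = 0})" by simp
  moreover have "{z. snd z = 0 \<and> norm (F z) = R} \<subseteq> (\<lambda>x. (x, 0)) ` {x. poly q x = 0}"
    using eq by force
  ultimately show ?thesis by (rule finite_subset[rotated])
qed

text \<open>An unbounded angle passes every large multiple of \<open>pi\<close>, and each passage is
  a crossing of the horizontal axis. But the orbit repeats no point, and its inversion has finitely
  many points on the axis.\<close>

lemma does_not_turn:
  assumes w: "w \<in> D" "norm w = R" and \<sigma>: "0 < \<bar>\<sigma>\<bar>"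
  shows "\<not> turns_around (\<lambda>z. \<sigma> *\<^sub>R B z) 0 UNIV (inversion (G w))"
proof
  assume "turns_around (\<lambda>z. \<sigma> *\<^sub>R B z) 0 UNIV (inversion (G w))"
  then obtain \<gamma> \<theta> where \<gamma>: "solves (\<lambda>z. \<sigma> *\<^sub>R B z) \<gamma> {0..}" "\<gamma> 0 = inversion (G w)" "\<gamma> ` {0..} \<subseteq> UNIV - {0}"
    and \<theta>: "continuous_on {0..} \<theta>" "\<And>t. 0 \<le> t \<Longrightarrow> \<gamma> t - 0 = norm (\<gamma> t - 0) *\<^sub>R (cos (\<theta> t), sin (\<theta> t))"
      "filterlim (\<lambda>t. \<bar>\<theta> t\<bar>) at_top at_top"
    unfolding turns_around_def by blast
  have "inj_on \<gamma> {0..}" and nR: "\<And>t. t \<in> {0..} \<Longrightarrow> norm (F (inversion (\<gamma> t))) = R"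
    by (rule solution_in_gap_inj[of "{0..}" 0 \<gamma> \<sigma> w]; use \<gamma> w \<sigma> in \<open>auto simp: solves_def\<close>)+
  define Z where "Z = {t. 0 \<le> t \<and> snd (\<gamma> t) = 0}"
  have "(\<lambda>t. inversion (\<gamma> t)) ` Z \<subseteq> {z. snd z = 0 \<and> norm (F z) = R}"
  proof -
    have "snd (inversion (\<gamma> t)) = 0" if "t \<in> Z" for t using that by (simp add: Z_def inversion_def)
    moreover have "norm (F (inversion (\<gamma> t))) = R" if "t \<in> Z" for t using that nR by (simp add: Z_def)
    ultimately show ?thesis by blast
  qed
  then have "finite ((\<lambda>t. inversion (\<gamma> t)) ` Z)"
    using finitely_many_axis_crossings finite_subset by blast
  moreover have "inj_on (\<lambda>t. inversion (\<gamma> t)) Z"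
    using \<open>inj_on \<gamma> {0..}\<close> by (auto simp: inj_on_def Z_def)
  ultimately have fin: "finite Z" using finite_imageD by blast
  obtain m0 :: nat where m0: "\<bar>\<theta> 0\<bar> \<le> real m0 * pi"
    using reals_Archimedean3[OF pi_gt_zero] less_imp_le by blast
  have "of_nat m \<in> (\<lambda>t. \<bar>\<theta> t\<bar> / pi) ` Z" if "m0 \<le> m" for m :: nat
  proof -
    have "real m0 * pi \<le> real m * pi" using that by (intro mult_right_mono) auto
    with m0 have m: "\<bar>\<theta> 0\<bar> \<le> real m * pi" by linarith
    have "\<forall>\<^sub>F t in at_top. real m * pi \<le> \<bar>\<theta> t\<bar>" using \<theta>(3) by (simp add: filterlim_at_top)
    then have "\<forall>\<^sub>F t in at_top. real m * pi \<le> \<bar>\<theta> t\<bar> \<and> 0 \<le> t"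
      using eventually_ge_at_top[of 0] by (rule eventually_conj)
    then obtain T where T: "real m * pi \<le> \<bar>\<theta> T\<bar>" "0 \<le> T"
      by (auto dest: eventually_happens)
    have "continuous_on {0..T} (\<lambda>t. \<bar>\<theta> t\<bar>)"
      by (intro continuous_on_rabs continuous_on_subset[OF \<theta>(1)]) auto
    from IVT'[OF m T(1,2) this] obtain t where t: "0 \<le> t" "\<bar>\<theta> t\<bar> = real m * pi" by auto
    have "sin \<bar>\<theta> t\<bar> = 0" unfolding t(2) by simp
    then have "sin (\<theta> t) = 0" by (auto simp: abs_if split: if_splits)
    then have "snd (\<gamma> t) = 0" using \<theta>(2)[OF t(1)] by (metis diff_zero mult_zero_right snd_conv snd_scaleR real_scaleR_def)
    then have "t \<in> Z" using t by (simp add: Z_def)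
    moreover have "of_nat m = \<bar>\<theta> t\<bar> / pi" using t(2) by simp
    ultimately show ?thesis by (rule rev_image_eqI)
  qed
  then have "real ` {m0..} \<subseteq> (\<lambda>t. \<bar>\<theta> t\<bar> / pi) ` Z" by auto
  then have "finite (real ` {m0..})" using fin finite_subset by blast
  then have "finite {m0..}" by (rule finite_imageD) (simp add: inj_on_def)
  then show False using infinite_Ici by blast
qed

lemma not_monodromic: "\<not> is_monodromic B 0"
proof
  assume "is_monodromic B 0"
  then obtain U where U: "open U" "0 \<in> U"
    "\<forall>p\<in>U - {0}. turns_around B 0 UNIV p \<or> turns_around (\<lambda>z. - B z) 0 UNIV p"
    unfolding is_monodromic_def using open_UNIV UNIV_I by metis
  obtain e where e: "0 < e" "ball 0 e \<subseteq> U" using U open_contains_ball by blast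
  obtain w where w: "w \<in> D" "norm w = R" "norm (inversion (G w)) < e" using orbit_near_origin[OF e(1)] .
  have "w \<noteq> 0" using w(2) R_pos by auto
  then have "G w \<noteq> 0" using G_eq_0_iff[OF w(1)] by simp
  then have "inversion (G w) \<noteq> 0" by simp
  moreover have "inversion (G w) \<in> U" using w(3) e(2) by (meson mem_ball_0 subsetD)
  ultimately show False
    using U(3) does_not_turn[OF w(1,2), of 1] does_not_turn[OF w(1,2), of "- 1"] by auto
qed

end

text \<open>The quantities \<open>x * exp (- t)\<close> and \<open>y * exp t\<close> are constant
  along solutions. The explicit form reduces \<open>maps_orbits\<close> to arcs of hyperbolas and of
  the axes.\<close>

lemma saddle_solution:
  assumes "solves saddle \<sigma> I"
  obtains P Q where "\<And>t. t \<in> I \<Longrightarrow> \<sigma> t = (P * exp t, Q * exp (- t))"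
proof (cases "I = {}")
  case False
  then obtain t0 where t0: "t0 \<in> I" by auto
  have I: "is_interval I" and d: "\<And>t. t \<in> I \<Longrightarrow> (\<sigma> has_vector_derivative saddle (\<sigma> t)) (at t within I)"
    using assms by (auto simp: solves_def)
  have d1: "((\<lambda>t. fst (\<sigma> t)) has_real_derivative fst (\<sigma> t)) (at t within I)" if "t \<in> I" for t
    using bounded_linear.has_vector_derivative[OF bounded_linear_fst d[OF that]]
    by (simp add: has_real_derivative_iff_has_vector_derivative saddle_def)
  have d2: "((\<lambda>t. snd (\<sigma> t)) has_real_derivative - snd (\<sigma> t)) (at t within I)" if "t \<in> I" for t
    using bounded_linear.has_vector_derivative[OF bounded_linear_snd d[OF that]]
    by (simp add: has_real_derivative_iff_has_vector_derivative saddle_def)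
  define p q where "p = (\<lambda>t. fst (\<sigma> t) * exp (- t))" and "q = (\<lambda>t. snd (\<sigma> t) * exp t)"
  have "(p has_real_derivative 0) (at t within I)" if "t \<in> I" for t
    unfolding p_def by (rule derivative_eq_intros d1 that refl | simp)+
  then have p: "p t = p t0" if "t \<in> I" for t
    using has_field_derivative_zero_constant[of I p] I t0 that is_interval_convex_1 by metis
  have "(q has_real_derivative 0) (at t within I)" if "t \<in> I" for t
    unfolding q_def by (rule derivative_eq_intros d2 that refl | simp)+
  then have q: "q t = q t0" if "t \<in> I" for t
    using has_field_derivative_zero_constant[of I q] I t0 that is_interval_convex_1 by metis
  have "\<sigma> t = (p t0 * exp t, q t0 * exp (- t))" if "t \<in> I" for t
    unfolding p[OF that, symmetric] q[OF that, symmetric]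
    by (simp add: p_def q_def prod_eq_iff exp_minus)
  then show ?thesis by (rule that)
qed (use that in blast)

context nonproper_map
begin

section \<open>Hyperbolic sectors\<close>

definition level_poly :: poly_xy where "level_poly = f\<^sup>2 + g\<^sup>2 - [:[:R\<^sup>2:]:]"

lemma level_poly_eq_0_iff: "eval_xy level_poly (fst z) (snd z) = 0 \<longleftrightarrow> norm (F z) = R"
proof -
  have "eval_xy level_poly (fst z) (snd z) = (norm (F z))\<^sup>2 - R\<^sup>2"
    unfolding norm_prod_power2 by (simp add: level_poly_def F_def poly_map_def)
  then show ?thesis using R_pos by (simp add: power2_eq_iff_nonneg)
qed

text \<open>Each gap between bad angles carries an orbit that crosses all sufficiently large circles, so
  the number of zeros of \<open>level_poly\<close> on a circle bounds the number of gaps.\<close>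

lemma card_separated_good:
  assumes A: "finite A" "A \<subseteq> {b0<..<b0 + 2 * pi}" "\<And>a. a \<in> A \<Longrightarrow> good a" and b0: "\<not> good b0"
    and sep: "\<And>a a'. a \<in> A \<Longrightarrow> a' \<in> A \<Longrightarrow> a < a' \<Longrightarrow> \<exists>b. a < b \<and> b < a' \<and> \<not> good b"
  shows "card A \<le> 2 * total_degree level_poly"
proof -
  define \<rho>0 where "\<rho>0 = (\<Sum>a\<in>A. norm (G (polar R a)))"
  have \<rho>0: "norm (G (polar R a)) \<le> \<rho>0" if "a \<in> A" for a
    unfolding \<rho>0_def by (rule member_le_sum[OF that]) (use A in auto)
  have "0 \<le> \<rho>0" unfolding \<rho>0_def by (rule sum_nonneg) simp
  have "finite (fst ` {z. snd z = 0 \<and> norm (F z) = R})"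
    using finitely_many_axis_crossings by (rule finite_imageI)
  then have "\<not> {\<rho>0 + 1..} \<subseteq> fst ` {z. snd z = 0 \<and> norm (F z) = R}"
    using finite_subset infinite_Ici by blast
  \<comment> \<open>The disc of radius \<open>\<rho>\<close> contains the chosen point of every gap.
    Its boundary point \<open>(\<rho>, 0)\<close> is off the level curve, so
    \<open>level_poly\<close> does not vanish on the whole circle.\<close>
  then obtain \<rho> where \<rho>: "\<rho>0 + 1 \<le> \<rho>" "\<rho> \<notin> fst ` {z. snd z = 0 \<and> norm (F z) = R}"
    by auto
  have \<rho>F: "norm (F (\<rho>, 0)) \<noteq> R" using \<rho>(2) by (force simp: image_iff)
  have \<rho>pos: "0 < \<rho>" using \<rho> \<open>0 \<le> \<rho>0\<close> by linarith
  have b1: "\<not> good (b0 + 2 * pi)" using b0 good_2pi by simp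
  \<comment> \<open>From \<open>a\<close> to the end of its gap the norm passes from at most
    \<open>\<rho>\<close> to infinity, so it takes the value \<open>\<rho>\<close> within the
    gap.\<close>
  have "\<exists>x. a \<le> x \<and> x < b0 + 2 * pi \<and> (\<forall>y. a \<le> y \<longrightarrow> y \<le> x \<longrightarrow> good y) \<and> norm (G (polar R x)) = \<rho>"
    if a: "a \<in> A" for a
  proof -
    have ga: "good a" "a \<le> b0 + 2 * pi" using A a by (auto simp: less_imp_le subset_iff)
    obtain b where b: "a < b" "b \<le> b0 + 2 * pi" "\<not> good b" "\<And>x. a \<le> x \<Longrightarrow> x < b \<Longrightarrow> good x"
      using first_bad[OF ga b1] by blast
    have "\<forall>\<^sub>F x in at_left b. dist (inversion (G (polar R x))) 0 < inverse \<rho>"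
      using tendstoD[OF gap_end_tendsto[OF b(1,3,4)]] \<rho>pos by simp
    moreover have "\<forall>\<^sub>F x in at_left b. a < x \<and> x < b"
      using eventually_at_left[OF b(1)] b(1) by blast
    ultimately have "\<forall>\<^sub>F x in at_left b. a < x \<and> x < b \<and> \<rho> < norm (G (polar R x))"
    proof eventually_elim
      case (elim x)
      then have "polar R x \<in> D" using b(4)[of x] by (simp add: good_def)
      then have "G (polar R x) \<noteq> 0"
        using G_eq_0_iff norm_polar[of R x] R_pos by fastforce
      then have "\<rho> < norm (G (polar R x))"
        using elim \<rho>pos by (simp add: inverse_less_iff_less)
      then show ?case using elim by simp
    qed
    then obtain y where y: "a < y" "y < b" "\<rho> < norm (G (polar R y))"
      using eventually_happens[of _ "at_left b"] by auto
    have "continuous_on {a..y} (\<lambda>x. norm (G (polar R x)))"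
    proof (intro continuous_on_norm continuous_on_G_comp continuous_on_polar continuous_on_const continuous_on_id)
      show "(\<lambda>x. polar R x) ` {a..y} \<subseteq> D" using b(4) y by (auto simp: good_def)
    qed
    moreover have "norm (G (polar R a)) \<le> \<rho>" using \<rho>0[OF a] \<rho>(1) by linarith
    ultimately obtain x where "a \<le> x" "x \<le> y" "norm (G (polar R x)) = \<rho>"
      using IVT'[of "\<lambda>x. norm (G (polar R x))" a \<rho> y] y by auto
    moreover have "x < b" using calculation y by linarith
    ultimately show ?thesis using b(2,4) by (intro exI[of _ x]) auto
  qed
  then have "\<exists>x. \<forall>a\<in>A. a \<le> x a \<and> x a < b0 + 2 * pi \<and> (\<forall>y. a \<le> y \<longrightarrow> y \<le> x a \<longrightarrow> good y) \<and>
      norm (G (polar R (x a))) = \<rho>"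
    by (intro bchoice) blast
  then obtain x where xb: "\<And>a. a \<in> A \<Longrightarrow> a \<le> x a" "\<And>a. a \<in> A \<Longrightarrow> x a < b0 + 2 * pi"
    "\<And>a y. a \<in> A \<Longrightarrow> a \<le> y \<Longrightarrow> y \<le> x a \<Longrightarrow> good y" "\<And>a. a \<in> A \<Longrightarrow> norm (G (polar R (x a))) = \<rho>"
    by blast
  define z where "z = (\<lambda>a. G (polar R (x a)))"
  have xD: "polar R (x a) \<in> D" if "a \<in> A" for a
    using xb(3)[OF that xb(1)[OF that] order.refl] by (simp add: good_def)
  have less: "x a < a'" if "a \<in> A" "a' \<in> A" "a < a'" for a a'
  proof -
    obtain c where c: "a < c" "c < a'" "\<not> good c" using sep[OF \<open>a \<in> A\<close> \<open>a' \<in> A\<close> \<open>a < a'\<close>] by blast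
    then have "x a < c" using xb(3)[OF \<open>a \<in> A\<close>, of c] by (meson not_le less_imp_le)
    then show ?thesis using c by linarith
  qed
  have "inj_on z A"
  proof (rule inj_onI)
    fix a a' assume a: "a \<in> A" "a' \<in> A" "z a = z a'"
    then have "polar R (x a) = polar R (x a')"
      using inj_on_G xD unfolding z_def by (meson inj_onD)
    moreover have "b0 < x a" "x a < b0 + 2 * pi" "b0 < x a'" "x a' < b0 + 2 * pi"
      using xb(1,2)[OF a(1)] xb(1,2)[OF a(2)] A(2) a by fastforce+
    then have "\<bar>x a - x a'\<bar> < 2 * pi" by linarith
    ultimately have "x a = x a'" using polar_inj R_pos by (metis less_irrefl)
    then show "a = a'"
      using less[OF a(1,2)] less[OF a(2,1)] xb(1)[OF a(1)] xb(1)[OF a(2)] by linarith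
  qed
  define Z where "Z = {z. norm z = \<rho> \<and> eval_xy level_poly (fst z) (snd z) = 0}"
  have n\<rho>: "norm (\<rho>, 0::real) = \<rho>" using \<rho>pos by (simp add: norm_Pair)
  have Z: "finite Z" "card Z \<le> 2 * total_degree level_poly"
    unfolding Z_def
    by (rule zeros_on_circle[OF \<rho>pos n\<rho>]; use \<rho>F level_poly_eq_0_iff[of "(\<rho>, 0)"] in simp)+
  have "z ` A \<subseteq> Z"
  proof
    fix y assume "y \<in> z ` A"
    then obtain a where a: "a \<in> A" "y = z a" by blast
    have "norm y = \<rho>" using xb(4)[OF a(1)] a(2) by (simp add: z_def)
    moreover have "norm (F y) = R" using F_G[OF xD[OF a(1)]] a(2) R_pos by (simp add: z_def)
    ultimately show "y \<in> Z" using level_poly_eq_0_iff by (simp add: Z_def)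
  qed
  then have "card (z ` A) \<le> card Z" using Z(1) by (rule card_mono[rotated])
  then show ?thesis using card_image[OF \<open>inj_on z A\<close>] Z(2) by simp
qed

text \<open>Among the sets of good angles in one period that are pairwise separated by bad angles,
  one of maximal cardinality exists. Between its two smallest elements \<open>x\<close> and
  \<open>y\<close> the bad angles fill a single interval, since a good angle between two of them
  could be added to the set. The case \<open>\<alpha> = \<beta>\<close> is a single missing
  point.\<close>

lemma isolated_bad_interval:
  obtains x \<alpha> \<beta> y where "x < \<alpha>" "\<alpha> \<le> \<beta>" "\<beta> < y" "y - x \<le> 2 * pi"
    "\<And>a. \<alpha> \<le> a \<Longrightarrow> a \<le> \<beta> \<Longrightarrow> \<not> good a" "\<And>a. x \<le> a \<Longrightarrow> a < \<alpha> \<Longrightarrow> good a" "\<And>a. \<beta> < a \<Longrightarrow> a \<le> y \<Longrightarrow> good a"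
proof -
  obtain g0 where g0: "good g0" using good_angle .
  have g1: "good (g0 + 2 * pi)" using g0 good_2pi by simp
  obtain b where b: "g0 \<le> b" "b < g0 + 2 * pi" "\<not> good b" using bad_angle .
  have b': "\<not> good (b - 2 * pi)" using good_2pi[of "b - 2 * pi"] b by simp
  have "g0 < b" using b g0 by (metis less_le)
  define \<A> where "\<A> = (\<lambda>A. finite A \<and> A \<subseteq> {g0..g0 + 2 * pi} \<and> (\<forall>a\<in>A. good a) \<and>
    (\<forall>a\<in>A. \<forall>a'\<in>A. a < a' \<longrightarrow> (\<exists>b. a < b \<and> b < a' \<and> \<not> good b)))"
  define N where "N = 2 * total_degree level_poly"
  \<comment> \<open>The window starts at a good angle, while \<open>card_separated_good\<close>
    counts in a period that starts at a bad one. So the set is cut at \<open>b\<close>, and its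
    halves are counted from \<open>b - 2 * pi\<close> and from \<open>b\<close>.\<close>
  have bound: "card A < 2 * N + 1" if "\<A> A" for A
  proof -
    have A: "finite A" "A \<subseteq> {g0..g0 + 2 * pi}" "\<And>a. a \<in> A \<Longrightarrow> good a"
      "\<And>a a'. a \<in> A \<Longrightarrow> a' \<in> A \<Longrightarrow> a < a' \<Longrightarrow> \<exists>b. a < b \<and> b < a' \<and> \<not> good b"
      using that unfolding \<A>_def by blast+
    have "card (A \<inter> {..<b}) \<le> N"
      unfolding N_def by (rule card_separated_good[of _ "b - 2 * pi"]) (use A b b' \<open>g0 < b\<close> in auto)
    moreover have "card (A \<inter> {b<..}) \<le> N"
      unfolding N_def by (rule card_separated_good[of _ b]) (use A b \<open>g0 < b\<close> in auto)
    moreover have "a < b \<or> b < a" if "a \<in> A" for a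
      using A(3)[OF that] b(3) by (metis linorder_neqE_linordered_idom)
    then have "A = (A \<inter> {..<b}) \<union> (A \<inter> {b<..})" by blast
    then have "card A \<le> card (A \<inter> {..<b}) + card (A \<inter> {b<..})" by (metis card_Un_le)
    ultimately show ?thesis by linarith
  qed
  \<comment> \<open>The two ends are good by periodicity and separated by \<open>b\<close>; this
    guarantees at least two elements in a maximal set.\<close>
  have A0: "\<A> {g0, g0 + 2 * pi}"
    unfolding \<A>_def using g0 g1 b \<open>g0 < b\<close> pi_gt_zero by fastforce
  obtain A where A: "\<A> A" "\<And>A'. \<A> A' \<Longrightarrow> card A' \<le> card A"
    using ex_has_greatest_nat[of \<A> "{g0, g0 + 2 * pi}" card "2 * N + 1"] A0 bound by blast
  have fin: "finite A" and Asub: "A \<subseteq> {g0..g0 + 2 * pi}" and Agood: "\<And>a. a \<in> A \<Longrightarrow> good a"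
    and Asep: "\<And>a a'. a \<in> A \<Longrightarrow> a' \<in> A \<Longrightarrow> a < a' \<Longrightarrow> \<exists>b. a < b \<and> b < a' \<and> \<not> good b"
    using A(1) unfolding \<A>_def by blast+
  have "2 \<le> card A" using A(2)[OF A0] by simp
  then have "A \<noteq> {}" by auto
  define x where "x = Min A"
  have x: "x \<in> A" "\<And>a. a \<in> A \<Longrightarrow> x \<le> a" using fin \<open>A \<noteq> {}\<close> by (auto simp: x_def)
  have "card (A - {x}) \<noteq> 0" using \<open>2 \<le> card A\<close> x(1) fin by simp
  then have "A - {x} \<noteq> {}" by (metis card.empty)
  define y where "y = Min (A - {x})"
  have "y \<in> A - {x}" unfolding y_def using fin \<open>A - {x} \<noteq> {}\<close> by (intro Min_in) auto
  moreover have "y \<le> a" if "a \<in> A" "a \<noteq> x" for a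
    unfolding y_def using fin that by (intro Min_le) auto
  ultimately have y: "y \<in> A" "x < y" "\<And>a. a \<in> A \<Longrightarrow> a \<noteq> x \<Longrightarrow> y \<le> a"
    using x(2)[of y] by auto
  define S where "S = {x..y} \<inter> - {a. good a}"
  have Sc: "closed S" unfolding S_def using open_good by (intro closed_Int) (auto simp: closed_def)
  obtain c where "x < c" "c < y" "\<not> good c" using Asep[OF x(1) y(1,2)] by blast
  then have "c \<in> S" by (simp add: S_def)
  then have "S \<noteq> {}" by blast
  have Sb: "bdd_below S" "bdd_above S" unfolding S_def by (auto intro: bdd_belowI[of _ x] bdd_aboveI[of _ y])
  define \<alpha> \<beta> where "\<alpha> = Inf S" and "\<beta> = Sup S"
  have \<alpha>: "\<alpha> \<in> S" unfolding \<alpha>_def by (rule closed_contains_Inf[OF \<open>S \<noteq> {}\<close> Sb(1) Sc])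
  have \<beta>: "\<beta> \<in> S" unfolding \<beta>_def by (rule closed_contains_Sup[OF \<open>S \<noteq> {}\<close> Sb(2) Sc])
  have lo: "\<alpha> \<le> s" "s \<le> \<beta>" if "s \<in> S" for s
    using cInf_lower[OF that Sb(1)] cSup_upper[OF that Sb(2)] by (simp_all add: \<alpha>_def \<beta>_def)
  have \<alpha>b: "x \<le> \<alpha>" "\<alpha> \<le> y" "\<not> good \<alpha>" and \<beta>b: "x \<le> \<beta>" "\<beta> \<le> y" "\<not> good \<beta>"
    using \<alpha> \<beta> by (auto simp: S_def)
  have "x < \<alpha>" using \<alpha>b Agood[OF x(1)] by (metis less_le)
  have "\<beta> < y" using \<beta>b Agood[OF y(1)] by (metis less_le)
  have "\<alpha> \<le> \<beta>" using lo \<beta> by blast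
  have g1: "good a" if "x \<le> a" "a < \<alpha>" for a
    using lo(1)[of a] that \<alpha>b by (force simp: S_def)
  have g2: "good a" if "\<beta> < a" "a \<le> y" for a
    using lo(2)[of a] that \<beta>b by (force simp: S_def)
  have bad: "\<not> good a" if "\<alpha> \<le> a" "a \<le> \<beta>" for a
  proof
    assume ga: "good a"
    then have a: "\<alpha> < a" "a < \<beta>" using that \<alpha>b \<beta>b by (metis less_le)+
    have "a \<notin> A" using y(3)[of a] a \<open>x < \<alpha>\<close> \<open>\<beta> < y\<close> by force
    have "\<A> (insert a A)"
      unfolding \<A>_def
    proof (intro conjI ballI impI)
      show "finite (insert a A)" using fin by simp
      show "insert a A \<subseteq> {g0..g0 + 2 * pi}" using Asub x(1) y(1) a \<open>x < \<alpha>\<close> \<open>\<beta> < y\<close> by force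
      show "good c" if "c \<in> insert a A" for c using that ga Agood by blast
      fix c c' assume c: "c \<in> insert a A" "c' \<in> insert a A" "c < c'"
      consider "c \<in> A" "c' \<in> A" | "c = a" "c' \<in> A" | "c \<in> A" "c' = a" using c by blast
      then show "\<exists>b. c < b \<and> b < c' \<and> \<not> good b"
      proof cases
        case 1
        then show ?thesis using Asep c(3) by blast
      next
        case 2
        have "c' \<noteq> x" using c(3) 2 a \<open>x < \<alpha>\<close> by linarith
        then have "y \<le> c'" using y(3) 2 by blast
        then show ?thesis using 2 a \<beta>b \<open>\<beta> < y\<close> by (intro exI[of _ \<beta>]) auto
      next
        case 3
        have "\<not> y \<le> c" using c(3) 3 a \<open>\<beta> < y\<close> by linarith
        then have "c = x" using y(3) 3 by blast
        then show ?thesis using 3 a \<alpha>b \<open>x < \<alpha>\<close> by (intro exI[of _ \<alpha>]) auto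
      qed
    qed
    then have "card (insert a A) \<le> card A" by (rule A(2))
    then show False using fin \<open>a \<notin> A\<close> by simp
  qed
  have "g0 \<le> x" "y \<le> g0 + 2 * pi" using Asub x(1) y(1) by auto
  then have "y - x \<le> 2 * pi" by linarith
  show ?thesis
    by (rule that[OF \<open>x < \<alpha>\<close> \<open>\<alpha> \<le> \<beta>\<close> \<open>\<beta> < y\<close> \<open>y - x \<le> 2 * pi\<close> bad g1 g2])
qed

end

text \<open>On \<open>p * q = c\<close> an increase of \<open>p\<close> cannot increase
  \<open>q\<close>, also for \<open>c = 0\<close>. This makes the sector map injective on each
  level.\<close>

lemma hyperbola_ratio_mono:
  fixes p q p' q' :: real
  assumes "0 \<le> p" "0 \<le> q" "0 \<le> p'" "0 \<le> q'" "0 < p + q" "p < p'" "p * q = p' * q'"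
  shows "p - q < p' - q'" "(p - q) / (p + q) \<le> (p' - q') / (p' + q')"
proof -
  have q: "q' \<le> q"
  proof (rule ccontr)
    assume "\<not> q' \<le> q"
    then have "p * q < p' * q'" using assms by (intro mult_strict_mono') auto
    with assms show False by simp
  qed
  then show "p - q < p' - q'" using assms by simp
  have "p * q' \<le> p' * q" using assms q by (intro mult_mono) auto
  then have "(p - q) * (p' + q') \<le> (p' - q') * (p + q)" by (simp add: algebra_simps)
  moreover have "0 < p' + q'" using assms by linarith
  ultimately show "(p - q) / (p + q) \<le> (p' - q') / (p' + q')"
    using assms(5) by (simp add: divide_le_eq le_divide_eq mult.commute)
qed

context nonproper_map
begin

text \<open>The hyperbola \<open>p q = c\<close> is mapped into the level \<open>R - R c / 2\<close> of \<open>|F|\<close>. The angle is chosen to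
  increase along every hyperbola and to sweep the whole bad interval near the corner, so that no
  continuity at the corner needs to be arranged: everything there is sent to infinity by \<open>G\<close>.\<close>

lemma hyperbolic_sector_exists: "\<exists>S. hyperbolic_sector B 0 S"
proof -
  obtain x0 \<alpha> \<beta> y0 where ab: "x0 < \<alpha>" "\<alpha> \<le> \<beta>" "\<beta> < y0" "y0 - x0 \<le> 2 * pi"
    and bad: "\<And>a. \<alpha> \<le> a \<Longrightarrow> a \<le> \<beta> \<Longrightarrow> \<not> good a"
    and gl: "\<And>a. x0 \<le> a \<Longrightarrow> a < \<alpha> \<Longrightarrow> good a" and gr: "\<And>a. \<beta> < a \<Longrightarrow> a \<le> y0 \<Longrightarrow> good a"
    by (rule isolated_bad_interval) (rule that; blast)
  \<comment> \<open>Half of the smaller margin: \<open>\<alpha> - \<delta>\<close> and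
    \<open>\<beta> + \<delta>\<close> remain within the good intervals, and any two angles in use
    differ by less than \<open>2 * pi\<close>.\<close>
  define \<delta> where "\<delta> = min (\<alpha> - x0) (y0 - \<beta>) / 2"
  define m where "m = (\<alpha> + \<beta>) / 2"
  define k where "k = (\<beta> - \<alpha>) / 2"
  have \<delta>: "0 < \<delta>" "x0 < \<alpha> - \<delta>" "\<beta> + \<delta> < y0" "k + \<delta> < pi"
    and mk: "m - k = \<alpha>" "m + k = \<beta>" "0 \<le> k"
    using ab by (auto simp: \<delta>_def m_def k_def min_def field_simps)
  define Q where "Q = {0..1::real} \<times> {0..1::real}"
  \<comment> \<open>It is \<open>- 1\<close> on the vertical axis and \<open>1\<close> on the
    horizontal one, without a limit at the corner.\<close>
  define \<sigma> where "\<sigma> = (\<lambda>z::real \<times> real. (fst z - snd z) / (fst z + snd z))"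
  \<comment> \<open>On the axes the angle is \<open>\<alpha> - \<delta> * snd z\<close> and
    \<open>\<beta> + \<delta> * fst z\<close>, in the two gaps next to the bad interval. The term
    with \<open>\<delta>\<close> keeps the angle strictly increasing along hyperbolas even if
    \<open>k = 0\<close>.\<close>
  define \<Theta> where "\<Theta> = (\<lambda>z::real \<times> real. m + \<delta> * (fst z - snd z) + k * \<sigma> z)"
  \<comment> \<open>The value is \<open>R\<close> exactly on the axes; elsewhere on the square it
    lies between \<open>R / 2\<close> and \<open>R\<close>, so that the point is in the open disc,
    where \<open>G\<close> is defined, and away from the origin.\<close>
  define \<rho> where "\<rho> = (\<lambda>z::real \<times> real. R - R / 2 * (fst z * snd z))"
  define w where "w = (\<lambda>z. polar (\<rho> z) (\<Theta> z))"
  define h where "h = (\<lambda>z. if z = 0 then 0 else inversion (G (w z)))"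
  have Q: "0 \<le> fst z" "fst z \<le> 1" "0 \<le> snd z" "snd z \<le> 1" if "z \<in> Q" for z
    using that by (auto simp: Q_def mem_Times_iff)
  have sum_pos: "0 < fst z + snd z" if "z \<in> Q" "z \<noteq> 0" for z
    using Q[OF that(1)] that(2) by (cases z) (auto simp: zero_prod_def)
  have \<sigma>1: "\<bar>\<sigma> z\<bar> \<le> 1" if "z \<in> Q" "z \<noteq> 0" for z
    using Q[OF that(1)] sum_pos[OF that] by (simp add: \<sigma>_def abs_le_iff divide_le_eq)
  have \<Theta>m: "\<bar>\<Theta> z - m\<bar> \<le> \<delta> * \<bar>fst z - snd z\<bar> + k" if "z \<in> Q" "z \<noteq> 0" for z
  proof -
    have "\<bar>\<Theta> z - m\<bar> \<le> \<bar>\<delta> * (fst z - snd z)\<bar> + \<bar>k * \<sigma> z\<bar>" by (simp add: \<Theta>_def)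
    moreover have "\<bar>k * \<sigma> z\<bar> \<le> k * 1"
      unfolding abs_mult using \<sigma>1[OF that] mk(3) by (intro mult_mono) auto
    moreover have "\<bar>\<delta> * (fst z - snd z)\<bar> = \<delta> * \<bar>fst z - snd z\<bar>" using \<delta>(1) by (simp add: abs_mult)
    ultimately show ?thesis by linarith
  qed
  have \<Theta>b: "\<bar>\<Theta> z - m\<bar> \<le> \<delta> + k" if "z \<in> Q" "z \<noteq> 0" for z
  proof -
    have "\<delta> * \<bar>fst z - snd z\<bar> \<le> \<delta> * 1"
      using \<delta>(1) Q[OF that(1)] by (intro mult_left_mono) (auto simp: abs_le_iff)
    then show ?thesis using \<Theta>m[OF that] by linarith
  qed
  have \<rho>b: "R / 2 \<le> \<rho> z" "\<rho> z \<le> R" if "z \<in> Q" for z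
  proof -
    have "fst z * snd z \<le> 1 * 1" using Q[OF that] by (intro mult_mono) simp_all
    then have "R / 2 * (fst z * snd z) \<le> R / 2 * 1"
      using R_pos by (intro mult_left_mono) simp_all
    moreover have "0 \<le> R / 2 * (fst z * snd z)"
      using R_pos Q[OF that] by (intro mult_nonneg_nonneg) simp_all
    ultimately show "R / 2 \<le> \<rho> z" "\<rho> z \<le> R" unfolding \<rho>_def by linarith+
  qed
  have \<rho>pos: "0 < \<rho> z" if "z \<in> Q" for z using \<rho>b(1)[OF that] R_pos by linarith
  have wR: "norm (w z) \<le> R" if "z \<in> Q" for z
    using \<rho>b[OF that] \<rho>pos[OF that] by (simp add: w_def)
  have wD: "w z \<in> D" if "z \<in> Q" "z \<noteq> 0" for z
  proof (cases "fst z = 0 \<or> snd z = 0")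
    case False
    then have "0 < fst z * snd z" using Q[OF that(1)] by (simp add: less_le)
    then have "\<rho> z < R" using R_pos by (simp add: \<rho>_def)
    then have "w z \<in> ball 0 R" using \<rho>pos[OF that(1)] by (simp add: w_def)
    then show ?thesis using ball_D by blast
  next
    case True
    have "good (\<Theta> z)"
    proof (cases "fst z = 0")
      case True
      then have s: "0 < snd z" using sum_pos[OF that] by simp
      then have "\<Theta> z = \<alpha> - \<delta> * snd z" using True mk by (simp add: \<Theta>_def \<sigma>_def)
      moreover have "0 < \<delta> * snd z" "\<delta> * snd z \<le> \<delta> * 1"
        using \<delta>(1) s Q[OF that(1)] by (auto intro: mult_left_mono)
      ultimately show ?thesis using \<delta>(2) by (intro gl) linarith+
    next
      case False
      with \<open>fst z = 0 \<or> snd z = 0\<close> have z: "snd z = 0" "0 < fst z" using sum_pos[OF that] by auto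
      then have "\<Theta> z = \<beta> + \<delta> * fst z" using mk by (simp add: \<Theta>_def \<sigma>_def)
      moreover have "0 < \<delta> * fst z" "\<delta> * fst z \<le> \<delta> * 1"
        using \<delta>(1) z Q[OF that(1)] by (auto intro: mult_left_mono)
      ultimately show ?thesis using \<delta>(3) by (intro gr) linarith+
    qed
    moreover have "\<rho> z = R" using True by (auto simp: \<rho>_def)
    ultimately show ?thesis by (simp add: w_def good_def)
  qed
  have w0: "w z \<noteq> 0" if "z \<in> Q" for z
  proof -
    have "norm (w z) \<noteq> 0" using \<rho>pos[OF that] by (simp add: w_def)
    then show ?thesis by force
  qed
  have Gw0: "G (w z) \<noteq> 0" if "z \<in> Q" "z \<noteq> 0" for z
    using G_eq_0_iff[OF wD[OF that]] w0[OF that(1)] by simp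
  have h0: "h z = 0 \<longleftrightarrow> z = 0" if "z \<in> Q" for z
    using Gw0[OF that] by (simp add: h_def)
  have fst_inj: "\<not> fst z < fst z'" if z: "z \<in> Q" "z \<noteq> 0" and z': "z' \<in> Q" "z' \<noteq> 0"
    and eq: "fst z * snd z = fst z' * snd z'" "\<Theta> z = \<Theta> z'" for z z'
  proof
    assume lt: "fst z < fst z'"
    have "fst z - snd z < fst z' - snd z'" "\<sigma> z \<le> \<sigma> z'"
      unfolding \<sigma>_def
      using hyperbola_ratio_mono[of "fst z" "snd z" "fst z'" "snd z'"] Q[OF z(1)] Q[OF z'(1)] sum_pos[OF z] lt eq(1)
      by auto
    then have "\<delta> * (fst z - snd z) < \<delta> * (fst z' - snd z')" "k * \<sigma> z \<le> k * \<sigma> z'"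
      using \<delta>(1) mk(3) by (simp, intro mult_left_mono)
    then have "\<Theta> z < \<Theta> z'" by (simp add: \<Theta>_def)
    with eq(2) show False by simp
  qed
  have inj: "inj_on h Q"
  proof (rule inj_onI)
    fix z z' assume z: "z \<in> Q" and z': "z' \<in> Q" and eq: "h z = h z'"
    show "z = z'"
    proof (cases "z = 0 \<or> z' = 0")
      case True
      then show ?thesis using h0[OF z] h0[OF z'] eq by metis
    next
      case False
      then have nz: "z \<noteq> 0" "z' \<noteq> 0" by auto
      then have "G (w z) = G (w z')" using eq by (simp add: h_def)
      then have ww: "w z = w z'" using inj_on_G wD[OF z nz(1)] wD[OF z' nz(2)] by (meson inj_onD)
      then have "norm (w z) = norm (w z')" by simp
      then have rr: "\<rho> z = \<rho> z'" using \<rho>pos[OF z] \<rho>pos[OF z'] by (simp add: w_def)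
      then have c: "fst z * snd z = fst z' * snd z'" using R_pos by (simp add: \<rho>_def)
      have "\<bar>\<Theta> z - \<Theta> z'\<bar> < 2 * pi" using \<Theta>b[OF z nz(1)] \<Theta>b[OF z' nz(2)] \<delta>(4) by linarith
      then have t: "\<Theta> z = \<Theta> z'"
        using polar_inj[of "\<rho> z" "\<Theta> z" "\<Theta> z'"] ww rr \<rho>pos[OF z] by (simp add: w_def)
      have f: "fst z = fst z'"
        using fst_inj[OF z nz(1) z' nz(2) c t] fst_inj[OF z' nz(2) z nz(1) c[symmetric] t[symmetric]] by linarith
      have "snd z = snd z'"
      proof (cases "fst z = 0")
        case False
        then show ?thesis using c f by simp
      next
        case True
        then have "\<Theta> z = \<alpha> - \<delta> * snd z" "\<Theta> z' = \<alpha> - \<delta> * snd z'"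
          using f mk sum_pos[OF z nz(1)] sum_pos[OF z' nz(2)] by (simp_all add: \<Theta>_def \<sigma>_def)
        then show ?thesis using t \<delta>(1) by simp
      qed
      with f show ?thesis by (simp add: prod_eq_iff)
    qed
  qed
  have cw: "continuous_on (Q - {0}) w"
    unfolding w_def \<rho>_def \<Theta>_def \<sigma>_def
    by (intro continuous_on_polar continuous_on_add continuous_on_diff continuous_on_mult continuous_on_divide
        continuous_on_fst continuous_on_snd continuous_on_id continuous_on_const) (use sum_pos in force)
  have "continuous_on (Q - {0}) (\<lambda>z. inversion (G (w z)))"
    by (intro continuous_on_inversion continuous_on_G_comp[OF cw]) (use wD Gw0 in blast)+
  then have ch: "continuous_on (Q - {0}) h"
    by (rule continuous_on_eq) (auto simp: h_def)
  \<comment> \<open>For points tending to the corner, the angles accumulate in the bad interval and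
    the radii tend to \<open>R\<close>. Blow-up at that missing point contradicts a positive
    distance from the origin.\<close>
  have tend0: "(h \<longlongrightarrow> 0) (at 0 within Q)"
  proof (rule ccontr)
    assume "\<not> ?thesis"
    then obtain e where e: "0 < e" "\<not> (\<forall>\<^sub>F z in at 0 within Q. dist (h z) 0 < e)"
      unfolding tendsto_iff by blast
    have "\<exists>z. z \<in> Q \<and> z \<noteq> 0 \<and> dist z 0 < 1 / real (Suc n) \<and> e \<le> dist (h z) 0" for n
    proof -
      have "0 < 1 / real (Suc n)" by simp
      then show ?thesis using e(2) unfolding eventually_at by (metis linorder_not_le)
    qed
    then obtain z where z: "\<And>n. z n \<in> Q" "\<And>n. z n \<noteq> 0" "\<And>n. dist (z n) 0 < 1 / real (Suc n)"
      "\<And>n. e \<le> dist (h (z n)) 0" by metis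
    have "\<forall>n. \<Theta> (z n) \<in> {m - (\<delta> + k)..m + (\<delta> + k)}"
      using \<Theta>b[OF z(1,2)] by (auto simp: abs_le_iff) (smt (verit))+
    then obtain t r where r: "strict_mono (r :: nat \<Rightarrow> nat)" "((\<lambda>n. \<Theta> (z n)) \<circ> r) \<longlonglongrightarrow> t"
      by (rule seq_compactE[OF compact_imp_seq_compact[OF compact_Icc]])
    have z0: "z \<longlonglongrightarrow> 0"
      unfolding tendsto_dist_iff[of z]
    proof (rule tendsto_sandwich[OF _ _ tendsto_const lim_1_over_n[THEN LIMSEQ_Suc]])
      show "\<forall>\<^sub>F n in sequentially. dist (z n) 0 \<le> 1 / real (Suc n)"
        using z(3) by (intro always_eventually allI less_imp_le)
    qed auto
    have zr: "(\<lambda>n. z (r n)) \<longlonglongrightarrow> 0" using LIMSEQ_subseq_LIMSEQ[OF z0 r(1)] by (simp add: o_def)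
    have tr: "(\<lambda>n. \<Theta> (z (r n))) \<longlonglongrightarrow> t" using r(2) by (simp add: o_def)
    have fz: "(\<lambda>n. fst (z (r n))) \<longlonglongrightarrow> 0" "(\<lambda>n. snd (z (r n))) \<longlonglongrightarrow> 0"
      using tendsto_fst[OF zr] tendsto_snd[OF zr] by simp_all
    have "\<bar>t - m\<bar> \<le> \<delta> * \<bar>0 - 0\<bar> + k"
    proof (rule tendsto_le[OF sequentially_bot])
      show "(\<lambda>n. \<delta> * \<bar>fst (z (r n)) - snd (z (r n))\<bar> + k) \<longlonglongrightarrow> \<delta> * \<bar>0 - 0\<bar> + k"
        by (intro tendsto_intros fz)
      show "(\<lambda>n. \<bar>\<Theta> (z (r n)) - m\<bar>) \<longlonglongrightarrow> \<bar>t - m\<bar>" by (intro tendsto_intros tr)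
      show "\<forall>\<^sub>F n in sequentially. \<bar>\<Theta> (z (r n)) - m\<bar> \<le> \<delta> * \<bar>fst (z (r n)) - snd (z (r n))\<bar> + k"
        using \<Theta>m[OF z(1,2)] by simp
    qed
    then have "\<alpha> \<le> t" "t \<le> \<beta>" unfolding mk(1,2)[symmetric] by auto
    then have "\<not> good t" by (rule bad)
    have "(\<lambda>n. \<rho> (z (r n))) \<longlonglongrightarrow> R - R / 2 * (0 * 0)"
      unfolding \<rho>_def by (intro tendsto_intros fz)
    then have "(\<lambda>n. w (z (r n))) \<longlonglongrightarrow> polar R t"
      unfolding w_def polar_def by (intro tendsto_Pair tendsto_mult tendsto_cos tendsto_sin tr) simp_all
    then have "(\<lambda>n. inversion (G (w (z (r n))))) \<longlonglongrightarrow> 0"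
      by (rule blow_up_tendsto) (use \<open>\<not> good t\<close> wD[OF z(1,2)] wR[OF z(1)] R_pos in \<open>auto simp: good_def\<close>)
    then have "\<forall>\<^sub>F n in sequentially. dist (inversion (G (w (z (r n))))) 0 < e" using e(1) by (rule tendstoD)
    then obtain n where "dist (inversion (G (w (z (r n))))) 0 < e" by (auto dest: eventually_happens)
    moreover have "h (z (r n)) = inversion (G (w (z (r n))))" using z(2)[of "r n"] by (simp add: h_def)
    ultimately show False using z(4)[of "r n"] by simp
  qed
  have cont: "continuous_on Q h"
    unfolding continuous_on_def
  proof
    fix z assume z: "z \<in> Q"
    show "(h \<longlongrightarrow> h z) (at z within Q)"
    proof (cases "z = 0")
      case True
      then show ?thesis using tend0 by (simp add: h_def)
    next
      case False
      have "at z within Q = at z within (Q - {0})"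
        by (rule at_within_nhd[of z "- {0}"]) (use False in \<open>auto intro: open_Compl\<close>)
      then show ?thesis using ch z False unfolding continuous_on_def by simp
    qed
  qed
  have "compact Q" unfolding Q_def by (intro compact_Times compact_Icc)
  from homeomorphism_compact[OF this cont refl inj] obtain h' where h': "homeomorphism Q (h ` Q) h h'" by blast
  have "maps_orbits saddle Q B h"
    unfolding maps_orbits_def
  proof (intro allI impI)
    fix s :: "real \<Rightarrow> real \<times> real" and I :: "real set"
    assume s: "solves saddle s I \<and> s ` I \<subseteq> Q"
    then have I: "is_interval I" by (simp add: solves_def)
    obtain P P' where P: "\<And>t. t \<in> I \<Longrightarrow> s t = (P * exp t, P' * exp (- t))"
      using saddle_solution s by blast
    show "\<exists>\<gamma> \<tau>. continuous_on I \<tau> \<and> strict_mono_on I \<tau> \<and> solves B \<gamma> (\<tau> ` I) \<and> (\<forall>t\<in>I. h (s t) = \<gamma> (\<tau> t))"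
    proof (cases "\<exists>t\<in>I. s t = 0")
      \<comment> \<open>A solution through the corner is the equilibrium of the saddle, and it goes
        to the equilibrium of \<open>B\<close>.\<close>
      case True
      then obtain t0 where t0: "t0 \<in> I" "s t0 = 0" by blast
      then have "P = 0" "P' = 0" using P[OF t0(1)] by (auto simp: zero_prod_def)
      then have "h (s t) = 0" if "t \<in> I" for t using P[OF that] by (simp add: h_def zero_prod_def)
      moreover have "solves B (\<lambda>_. 0) ((\<lambda>t. t) ` I)" using I by (simp add: solves_def)
      ultimately show ?thesis
        by (intro exI[of _ "\<lambda>_. 0"] exI[of _ "\<lambda>t. t"]) (auto intro: strict_mono_onI continuous_on_id)
    next
      case False
      then have sQ: "s t \<in> Q" "s t \<noteq> 0" if "t \<in> I" for t using s that by auto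
      \<comment> \<open>The angle along the hyperbola in the time of the saddle. Its derivative is
        \<open>a\<close>, whose positivity preserves the sense of time.\<close>
      define A where "A = (\<lambda>t. m + \<delta> * (P * exp t - P' * exp (- t)) + k * ((P * exp t - P' * exp (- t)) / (P * exp t + P' * exp (- t))))"
      define a where "a = (\<lambda>t. \<delta> * (P * exp t + P' * exp (- t)) + k * (4 * (P * P') / (P * exp t + P' * exp (- t))\<^sup>2))"
      define r where "r = R - R / 2 * (P * P')"
      have exps: "exp t * exp (- t) = 1" for t :: real by (simp add: exp_minus)
      have fs: "fst (s t) * snd (s t) = P * P'" if "t \<in> I" for t
        using exps[of t] P[OF that] by (simp add: algebra_simps) 
      have ws: "w (s t) = polar r (A t)" if "t \<in> I" for t
        unfolding w_def \<rho>_def fs[OF that] by (simp add: r_def \<Theta>_def \<sigma>_def A_def P[OF that])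
      have den: "0 < P * exp t + P' * exp (- t)" if "t \<in> I" for t
        using sum_pos[OF sQ[OF that]] P[OF that] by simp
      have dA: "(A has_real_derivative a t) (at t within I)" if "t \<in> I" for t
      proof -
        let ?n = "P * exp t - P' * exp (- t)" and ?d = "P * exp t + P' * exp (- t)"
        have "(A has_real_derivative \<delta> * ?d + k * ((?d * ?d - ?n * ?n) / (?d * ?d))) (at t within I)"
        proof -
          have "((\<lambda>t. P * exp t - P' * exp (- t)) has_real_derivative ?d) (at t within I)"
            "((\<lambda>t. P * exp t + P' * exp (- t)) has_real_derivative ?n) (at t within I)"
            by (auto intro!: derivative_eq_intros)
          note d = this(1) DERIV_divide[OF this]
          show ?thesis
            unfolding A_def
            by (rule DERIV_cong[OF DERIV_add[OF DERIV_add[OF DERIV_const DERIV_cmult[OF d(1)]] DERIV_cmult[OF d(2)]]])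
              (use den[OF that] in simp_all)
        qed
        moreover have "?d * ?d - ?n * ?n = 4 * (P * P') * (exp t * exp (- t))" by (simp add: algebra_simps)
        ultimately show ?thesis unfolding exps a_def by (simp add: power2_eq_square)
      qed
      have apos: "0 < a t" if "t \<in> I" for t
      proof -
        have "0 \<le> P * P'" using Q[OF sQ(1)[OF that]] fs[OF that] by (metis mult_nonneg_nonneg)
        then have "0 \<le> k * (4 * (P * P') / (P * exp t + P' * exp (- t))\<^sup>2)" using mk(3) by simp
        moreover have "0 < \<delta> * (P * exp t + P' * exp (- t))" using \<delta>(1) den[OF that] by simp
        ultimately show ?thesis unfolding a_def by linarith
      qed
      have ca: "continuous_on I a"
        unfolding a_def
        by (intro continuous_on_add continuous_on_mult continuous_on_divide continuous_on_power
            continuous_on_exp continuous_on_minus continuous_on_const continuous_on_id) (use den in force)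
      define c where "c = (\<lambda>t. G (polar r (A t)))"
      have cD: "polar r (A t) \<in> D" if "t \<in> I" for t using wD[OF sQ[OF that]] ws[OF that] by simp
      have c0: "c t \<noteq> 0" if "t \<in> I" for t using Gw0[OF sQ[OF that]] ws[OF that] by (simp add: c_def)
      have hs: "h (s t) = inversion (c t)" if "t \<in> I" for t
        using sQ[OF that] ws[OF that] by (simp add: h_def c_def)
      have dc: "(c has_vector_derivative DFinv (c t) (a t *\<^sub>R rot (F (c t)))) (at t within I)" if "t \<in> I" for t
        unfolding c_def F_G[OF cD[OF that]]
        by (rule G_comp_has_vector_derivative[OF polar_has_vector_derivative[OF dA[OF that]] cD[OF that]])
      have ds: "((\<lambda>t. inversion (c t)) has_vector_derivative (a t * speed (c t)) *\<^sub>R B (inversion (c t))) (at t within I)"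
        if "t \<in> I" for t by (rule lift_has_vector_derivative[OF dc[OF that] c0[OF that]])
      have "continuous_on I c"
        unfolding continuous_on_eq_continuous_within using dc has_vector_derivative_continuous by blast
      then have "continuous_on I (\<lambda>t. a t * speed (c t))"
        by (intro continuous_on_mult ca continuous_on_speed c0)
      then obtain \<tau> where \<tau>: "\<And>t. t \<in> I \<Longrightarrow> (\<tau> has_real_derivative a t * speed (c t)) (at t within I)"
        using interval_antiderivative[OF I] by blast
      have pos: "0 < a t * speed (c t)" if "t \<in> I" for t using apos[OF that] speed_pos[OF c0[OF that]] by simp
      note rep = reparametrize_to_solution[OF I ds \<tau> pos]
      show ?thesis
        by (intro exI[of _ "\<lambda>r. inversion (c (the_inv_into I \<tau> r))"] exI[of _ \<tau>] conjI rep(1-3) ballI)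
          (simp_all add: hs rep(4))
    qed
  qed
  moreover have "h (0, 0) = 0" by (simp add: h_def zero_prod_def)
  ultimately have "hyperbolic_sector B 0 (h ` Q)"
    unfolding hyperbolic_sector_def using h' unfolding Q_def by blast
  then show ?thesis ..
qed

end

section \<open>Separatrices\<close>

text \<open>The image of the saddle orbit \<open>(0, exp (- t))\<close>, which tends to the corner
  along the vertical axis.\<close>

lemma separatrix:
  assumes "hyperbolic_sector W q S"
  obtains \<tau> :: "real \<Rightarrow> real" and \<gamma> where "continuous_on {0..} \<tau>" "strict_mono_on {0..} \<tau>" "solves W \<gamma> (\<tau> ` {0..})"
    "\<forall>t\<ge>0. \<gamma> (\<tau> t) \<noteq> q" "((\<lambda>t. \<gamma> (\<tau> t)) \<longlongrightarrow> q) at_top"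
proof -
  obtain h h' where h: "homeomorphism ({0..1} \<times> {0..1}) S h h'" "h (0, 0) = q"
    "maps_orbits saddle ({0..1} \<times> {0..1}) W h"
    using assms unfolding hyperbolic_sector_def by blast
  define \<sigma> where "\<sigma> = (\<lambda>t::real. (0::real, exp (- t)))"
  have "((\<lambda>t. exp (- t)) has_vector_derivative - exp (- t)) (at t within {0..})" for t :: real
    unfolding has_real_derivative_iff_has_vector_derivative[symmetric]
    by (auto intro!: derivative_eq_intros)
  then have "(\<sigma> has_vector_derivative (0, - exp (- t))) (at t within {0..})" for t
    unfolding \<sigma>_def by (intro has_vector_derivative_Pair has_vector_derivative_const)
  then have "solves saddle \<sigma> {0..}"
    by (simp add: solves_def saddle_def \<sigma>_def is_interval_ci)
  moreover have \<sigma>Q: "\<sigma> t \<in> {0..1} \<times> {0..1}" if "0 \<le> t" for t using that by (simp add: \<sigma>_def)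
  then have "\<sigma> ` {0..} \<subseteq> {0..1} \<times> {0..1}" by blast
  ultimately obtain \<gamma> \<tau> where \<gamma>: "continuous_on {0..} \<tau>" "strict_mono_on {0..} \<tau>" "solves W \<gamma> (\<tau> ` {0..})"
    "\<forall>t\<in>{0..}. h (\<sigma> t) = \<gamma> (\<tau> t)"
    using h(3) unfolding maps_orbits_def by blast
  have "\<gamma> (\<tau> t) \<noteq> q" if "0 \<le> t" for t
  proof
    assume "\<gamma> (\<tau> t) = q"
    then have "h (\<sigma> t) = h (0, 0)" using \<gamma>(4) that h(2) by simp
    moreover have "h' (h (\<sigma> t)) = \<sigma> t" by (rule homeomorphism_apply1[OF h(1) \<sigma>Q[OF that]])
    moreover have "h' (h (0, 0)) = (0, 0)" by (rule homeomorphism_apply1[OF h(1)]) simp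
    ultimately have "\<sigma> t = (0, 0)" by metis
    then show False by (simp add: \<sigma>_def)
  qed
  moreover have "((\<lambda>t. \<gamma> (\<tau> t)) \<longlongrightarrow> q) at_top"
  proof -
    have "filterlim (\<lambda>t::real. - t) at_bot at_top" by (rule filterlim_uminus_at_bot_at_top)
    then have "((\<lambda>t::real. exp (- t)) \<longlongrightarrow> 0) at_top" by (rule filterlim_compose[OF exp_at_bot])
    then have "(\<sigma> \<longlongrightarrow> (0, 0)) at_top" unfolding \<sigma>_def by (intro tendsto_Pair tendsto_const)
    moreover have "\<forall>\<^sub>F t in at_top. \<sigma> t \<in> {0..1} \<times> {0..1}"
      using eventually_ge_at_top[of 0] by eventually_elim (rule \<sigma>Q)
    ultimately have "((\<lambda>t. h (\<sigma> t)) \<longlongrightarrow> h (0, 0)) at_top"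
      by (intro continuous_on_tendsto_compose[OF homeomorphism_cont1[OF h(1)]]) auto
    moreover have "\<forall>\<^sub>F t in at_top. h (\<sigma> t) = \<gamma> (\<tau> t)"
      using eventually_ge_at_top[of 0] by eventually_elim (use \<gamma>(4) in auto)
    ultimately show ?thesis using h(2) tendsto_cong by fastforce
  qed
  ultimately show ?thesis using that[OF \<gamma>(1-3)] by blast
qed

lemma sector_excludes_first_integral:
  assumes "hyperbolic_sector W q S" "q \<in> U" "first_integral_on W U H" "Cn_on 0 U H"
    "isolated_minimum_at H q"
  shows False
proof -
  obtain \<tau> :: "real \<Rightarrow> real" and \<gamma> where \<gamma>: "continuous_on {0..} \<tau>" "strict_mono_on {0..} \<tau>" "solves W \<gamma> (\<tau> ` {0..})"
    "\<forall>t\<ge>0. \<gamma> (\<tau> t) \<noteq> q" "((\<lambda>t. \<gamma> (\<tau> t)) \<longlongrightarrow> q) at_top"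
    using separatrix[OF assms(1)] .
  have U: "open U" using assms(3) by (simp add: first_integral_on_def)
  have "\<forall>\<^sub>F t in at_top. \<gamma> (\<tau> t) \<in> U" using topological_tendstoD[OF \<gamma>(5) U assms(2)] .
  \<comment> \<open>\<open>H\<close> is a first integral on \<open>U\<close>, so the separatrix is
    cut down to a tail inside \<open>U\<close>.\<close>
  then obtain t1 where t1: "\<And>t. t1 \<le> t \<Longrightarrow> \<gamma> (\<tau> t) \<in> U"
    unfolding eventually_at_top_linorder by blast
  define t0 where "t0 = max 0 t1"
  have t0: "0 \<le> t0" "\<And>t. t0 \<le> t \<Longrightarrow> \<gamma> (\<tau> t) \<in> U" using t1 by (simp_all add: t0_def)
  have sub: "\<tau> ` {t0..} \<subseteq> \<tau> ` {0..}" using t0 by auto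
  have "connected (\<tau> ` {t0..})"
    by (intro connected_continuous_image continuous_on_subset[OF \<gamma>(1)]) (use t0 in auto)
  then have "solves W \<gamma> (\<tau> ` {t0..})"
    using \<gamma>(3) sub unfolding solves_def is_interval_connected_1
    by (meson has_vector_derivative_within_subset subsetD)
  moreover have "\<gamma> ` \<tau> ` {t0..} \<subseteq> U" using t0(2) by auto
  ultimately have "(\<lambda>t. H (\<gamma> t)) constant_on \<tau> ` {t0..}"
    using assms(3) unfolding first_integral_on_def by blast
  then obtain c where c: "\<And>t. t0 \<le> t \<Longrightarrow> H (\<gamma> (\<tau> t)) = c" unfolding constant_on_def by auto
  have ev0: "\<forall>\<^sub>F t in at_top. t0 \<le> t" by (rule eventually_ge_at_top)
  have "\<forall>\<^sub>F t in at_top. \<gamma> (\<tau> t) \<in> U" using ev0 by eventually_elim (rule t0(2))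
  then have "((\<lambda>t. H (\<gamma> (\<tau> t))) \<longlongrightarrow> H q) at_top"
    using assms(4) by (intro continuous_on_tendsto_compose[of U H, OF _ \<gamma>(5) assms(2)]) auto
  moreover have "((\<lambda>t. H (\<gamma> (\<tau> t))) \<longlongrightarrow> c) at_top"
    by (rule tendsto_eventually, rule eventually_mono[OF ev0], rule c)
  ultimately have "c = H q" using tendsto_unique[OF trivial_limit_at_top_linorder] by blast
  have "\<forall>\<^sub>F t in at_top. \<gamma> (\<tau> t) \<noteq> q" using ev0 by eventually_elim (use \<gamma>(4) t0(1) in auto)
  then have "filterlim (\<lambda>t. \<gamma> (\<tau> t)) (at q) at_top" using \<gamma>(5) by (simp add: filterlim_at)
  then have "\<forall>\<^sub>F t in at_top. H q < H (\<gamma> (\<tau> t))"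
    using assms(5) unfolding isolated_minimum_at_def filterlim_iff by blast
  then have "\<forall>\<^sub>F t in at_top. H q < H (\<gamma> (\<tau> t)) \<and> t0 \<le> t" using ev0 by (rule eventually_conj)
  then obtain t where "H q < H (\<gamma> (\<tau> t))" "t0 \<le> t" by (auto dest: eventually_happens)
  then show False using c \<open>c = H q\<close> by simp
qed

section \<open>Winding\<close>

text \<open>Logarithms of the same number differ by integer multiples of
  \<open>2 * pi * \<i>\<close>, so distinct values keep a distance of at least
  \<open>2 * pi\<close>.\<close>

lemma exp_constant_imp_constant:
  fixes f :: "'a::topological_space \<Rightarrow> complex"
  assumes "connected S" "continuous_on S f" "\<And>x. x \<in> S \<Longrightarrow> exp (f x) = c" "x \<in> S" "y \<in> S"
  shows "f x = f y"
proof -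
  have "f constant_on S"
  proof (rule continuous_discrete_range_constant[OF assms(1,2)])
    fix x assume x: "x \<in> S"
    have "2 * pi \<le> norm (f y - f x)" if "y \<in> S" "f y \<noteq> f x" for y
    proof -
      have "exp (f y) = exp (f x)" using assms(3) x that by simp
      then obtain n :: int where n: "f y = f x + (of_int (2 * n) * pi) * \<i>" unfolding exp_eq by blast
      with that have "n \<noteq> 0" by auto
      then have "1 \<le> \<bar>real_of_int n\<bar>" by linarith
      then have "2 * pi * 1 \<le> 2 * pi * \<bar>real_of_int n\<bar>" by (intro mult_left_mono) auto
      then show ?thesis unfolding n by (simp add: norm_mult)
    qed
    then show "\<exists>e>0. \<forall>y. y \<in> S \<and> f y \<noteq> f x \<longrightarrow> e \<le> norm (f y - f x)"
      by (intro exI[of _ "2 * pi"]) auto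
  qed
  then show ?thesis using assms(4,5) unfolding constant_on_def by metis
qed

text \<open>A closed curve with a periodic logarithm is contractible in the punctured plane, hence so is its
  image, which cannot be a circle about the origin.\<close>

lemma logarithm_not_periodic:
  fixes \<Phi> :: "complex \<Rightarrow> complex" and lg :: "real \<Rightarrow> complex"
  assumes \<Phi>: "continuous_on (- {0}) \<Phi>" "\<And>z. z \<noteq> 0 \<Longrightarrow> \<Phi> z \<noteq> 0"
    and lg: "continuous_on UNIV lg" and img: "\<And>t. \<Phi> (exp (lg t)) = c * exp (\<i> * of_real t)" "c \<noteq> 0"
  shows "\<exists>t. lg (t + 2 * pi) \<noteq> lg t"
proof (rule ccontr)
  assume "\<not> ?thesis"
  then have per: "lg (t + 2 * pi) = lg t" for t by blast
  define S where "S = {0..1::real} \<times> (UNIV :: real set)"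
  \<comment> \<open>Scaling the logarithm to zero contracts the curve \<open>exp (lg t)\<close> to
    the point \<open>1\<close> inside the punctured plane; \<open>K\<close> is the image of this
    contraction.\<close>
  define K where "K = (\<lambda>z::real \<times> real. \<Phi> (exp (of_real (fst z) * lg (snd z))))"
  have "convex S" unfolding S_def by (intro convex_Times) auto
  have clg: "continuous_on S (\<lambda>z. lg (snd z))"
    by (rule continuous_on_compose2[OF lg]) (auto intro: continuous_on_snd continuous_on_id)
  have cK: "continuous_on S K"
    unfolding K_def
    by (rule continuous_on_compose2[OF \<Phi>(1)])
      (auto intro!: continuous_on_exp continuous_on_mult continuous_on_of_real continuous_on_fst continuous_on_id clg)
  have "K z \<noteq> 0" for z unfolding K_def using \<Phi>(2) by simp
  then obtain L where L: "continuous_on S L" "\<And>z. z \<in> S \<Longrightarrow> K z = exp (L z)"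
    using continuous_logarithm_on_contractible[OF cK convex_imp_contractible[OF \<open>convex S\<close>]] by blast
  \<comment> \<open>The increment of \<open>L\<close> over one period. It is the same on the whole
    strip, yet it is zero at the constant end of the contraction and \<open>2 * pi * \<i>\<close> at
    the circle.\<close>
  define d where "d = (\<lambda>z. L (fst z, snd z + 2 * pi) - L z)"
  have "continuous_on S (\<lambda>z. L (fst z, snd z + 2 * pi))"
    by (rule continuous_on_compose2[OF L(1)])
      (auto simp: S_def intro!: continuous_on_Pair continuous_on_add continuous_on_fst continuous_on_snd
        continuous_on_id continuous_on_const)
  then have cd: "continuous_on S d" unfolding d_def by (intro continuous_on_diff L)
  have ed: "exp (d z) = 1" if "z \<in> S" for z
  proof -
    have "(fst z, snd z + 2 * pi) \<in> S" using that by (auto simp: S_def)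
    then have "exp (L (fst z, snd z + 2 * pi)) = exp (L z)"
      using L(2)[OF that] L(2)[of "(fst z, snd z + 2 * pi)"] by (simp add: K_def per)
    then show ?thesis by (simp add: d_def exp_diff)
  qed
  have "d (0, 0) = d (1, 0)"
    by (rule exp_constant_imp_constant[OF convex_connected[OF \<open>convex S\<close>] cd ed]) (auto simp: S_def)
  moreover have "L (0, 0) = L (0, 2 * pi)"
  proof (rule exp_constant_imp_constant[of UNIV "\<lambda>t. L (0, t)" "\<Phi> 1" 0 "2 * pi"])
    show "continuous_on UNIV (\<lambda>t. L (0, t))"
      by (rule continuous_on_compose2[OF L(1)])
        (auto simp: S_def intro!: continuous_on_Pair continuous_on_id continuous_on_const)
    show "exp (L (0, t)) = \<Phi> 1" for t using L(2)[of "(0, t)"] by (simp add: S_def K_def)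
  qed auto
  moreover have "L (1, 0) - \<i> * of_real 0 = L (1, 2 * pi) - \<i> * of_real (2 * pi)"
  proof (rule exp_constant_imp_constant[of UNIV "\<lambda>t. L (1, t) - \<i> * of_real t" c 0 "2 * pi"])
    show "continuous_on UNIV (\<lambda>t. L (1, t) - \<i> * of_real t)"
      by (intro continuous_on_diff continuous_on_mult continuous_on_const continuous_on_of_real continuous_on_id
          continuous_on_compose2[OF L(1)] continuous_on_Pair) (auto simp: S_def)
    show "exp (L (1, t) - \<i> * of_real t) = c" for t
    proof -
      have "exp (L (1, t)) = c * exp (\<i> * of_real t)"
        using L(2)[of "(1, t)"] img(1)[of t] by (simp add: S_def K_def)
      then show ?thesis by (simp add: exp_diff)
    qed
  qed auto
  ultimately have "\<i> * of_real (2 * pi) = (0::complex)" by (simp add: d_def)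
  then show False by simp
qed

text \<open>\<open>\<theta> t\<close> differs from \<open>d * t / (2 * pi)\<close> by a bounded
  function.\<close>

lemma periodic_increment_linear_growth:
  fixes \<theta> :: "real \<Rightarrow> real"
  assumes "continuous_on UNIV \<theta>" "\<And>t. \<theta> (t + 2 * pi) = \<theta> t + d" "d \<noteq> 0"
  shows "filterlim (\<lambda>t. \<bar>\<theta> t\<bar>) at_top at_top"
proof -
  have n: "\<theta> (t + 2 * pi * real n) = \<theta> t + d * real n" for t n
  proof (induction n)
    case (Suc n)
    have "\<theta> (t + 2 * pi * real (Suc n)) = \<theta> ((t + 2 * pi * real n) + 2 * pi)" by (simp add: algebra_simps)
    also have "\<dots> = \<theta> t + d * real (Suc n)" by (simp only: assms(2) Suc) (simp add: algebra_simps)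
    finally show ?case .
  qed simp
  have "compact (\<theta> ` {0..2 * pi})"
    by (intro compact_continuous_image continuous_on_subset[OF assms(1)]) auto
  then obtain C where C: "\<And>t. t \<in> {0..2 * pi} \<Longrightarrow> \<bar>\<theta> t\<bar> \<le> C"
    using compact_imp_bounded bounded_iff by (metis image_eqI real_norm_def)
  have lower: "\<bar>d\<bar> * (t / (2 * pi) - 1) - C \<le> \<bar>\<theta> t\<bar>" if "0 \<le> t" for t
  proof -
    define n where "n = nat \<lfloor>t / (2 * pi)\<rfloor>"
    have "0 \<le> t / (2 * pi)" using that by simp
    then have "real n \<le> t / (2 * pi)" "t / (2 * pi) < real n + 1" unfolding n_def by linarith+
    then have "2 * pi * real n \<le> t" "t \<le> 2 * pi * real n + 2 * pi"
      using pi_gt_zero by (simp_all add: field_simps)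
    then have "\<bar>\<theta> (t - 2 * pi * real n)\<bar> \<le> C" by (intro C) auto
    moreover have "\<theta> t = \<theta> (t - 2 * pi * real n) + d * real n" using n[of "t - 2 * pi * real n" n] by simp
    then have "\<bar>d * real n\<bar> \<le> \<bar>\<theta> t\<bar> + \<bar>\<theta> (t - 2 * pi * real n)\<bar>" by linarith
    moreover have "\<bar>d\<bar> * (t / (2 * pi) - 1) \<le> \<bar>d\<bar> * real n"
      using \<open>t / (2 * pi) < real n + 1\<close> by (intro mult_left_mono) auto
    moreover have "\<bar>d * real n\<bar> = \<bar>d\<bar> * real n" by (simp add: abs_mult)
    ultimately show ?thesis by linarith
  qed
  show ?thesis
    unfolding filterlim_at_top
  proof
    fix Z :: real
    define T where "T = max 0 (2 * pi * ((Z + C) / \<bar>d\<bar> + 1))"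
    have "Z \<le> \<bar>\<theta> t\<bar>" if "T \<le> t" for t
    proof -
      have "2 * pi * ((Z + C) / \<bar>d\<bar> + 1) \<le> t" "0 \<le> t" using that by (auto simp: T_def)
      then have "(Z + C) / \<bar>d\<bar> \<le> t / (2 * pi) - 1" using pi_gt_zero by (simp add: field_simps)
      then have "Z + C \<le> \<bar>d\<bar> * (t / (2 * pi) - 1)" using assms(3) by (simp add: divide_le_eq mult.commute)
      then show ?thesis using lower[OF \<open>0 \<le> t\<close>] by linarith
    qed
    then show "\<forall>\<^sub>F t in at_top. Z \<le> \<bar>\<theta> t\<bar>" by (auto simp: eventually_at_top_linorder)
  qed
qed

section \<open>Bijective maps\<close>

locale bijective_map = positive_jacobian +
  assumes bij_F: "bij F"
begin

text \<open>By invariance of domain the inverse of \<open>F\<close> is continuous, so it is a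
  section on the whole plane.\<close>

lemma D_UNIV: "D = UNIV"
proof -
  obtain \<psi> where \<psi>: "homeomorphism UNIV (F ` UNIV) F \<psi>"
    using invariance_of_domain_homeomorphism[OF open_UNIV continuous_on_F[of UNIV]] bij_is_inj[OF bij_F] by auto
  then have \<psi>: "homeomorphism UNIV UNIV F \<psi>" using bij_is_surj[OF bij_F] by simp
  have "starlike_section UNIV \<psi>"
    unfolding starlike_section_def
    using homeomorphism_cont2[OF \<psi>] homeomorphism_apply2[OF \<psi>] homeomorphism_apply1[OF \<psi>, of 0] by simp
  then show ?thesis using section_subset_D by blast
qed

lemma FG [simp]: "F (G w) = w" using F_G D_UNIV by simp

lemma GF [simp]: "G (F z) = z"
  using FG[of "F z"] bij_is_inj[OF bij_F] by (meson injD)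

lemma F_eq_0 [simp]: "F z = 0 \<longleftrightarrow> z = 0" by (metis GF F_0)

lemma G_eq_0 [simp]: "G w = 0 \<longleftrightarrow> w = 0" by (metis FG F_0 GF)

lemma continuous_on_G_UNIV: "continuous_on A G"
  using continuous_on_G D_UNIV continuous_on_subset by blast

text \<open>\<open>G\<close> maps the closed disc of radius \<open>M\<close> to a bounded set, and
  outside of that set \<open>F\<close> exceeds \<open>M\<close>.\<close>

lemma F_proper: obtains K where "0 < K" "\<And>z. K < norm z \<Longrightarrow> M < norm (F z)"
proof -
  have "compact (G ` cball 0 M)" by (intro compact_continuous_image continuous_on_G_UNIV compact_cball)
  then obtain K where K: "0 < K" "\<And>z. z \<in> G ` cball 0 M \<Longrightarrow> norm z \<le> K"
    using compact_imp_bounded bounded_pos by metis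
  have "M < norm (F z)" if "K < norm z" for z
  proof (rule ccontr)
    assume "\<not> M < norm (F z)"
    then have "F z \<in> cball 0 M" by simp
    then have "z \<in> G ` cball 0 M" by (rule rev_image_eqI) simp
    with K(2) that show False by fastforce
  qed
  with K(1) show ?thesis using that by blast
qed

lemma F_inversion_large:
  obtains d where "0 < d" "\<And>p. p \<noteq> 0 \<Longrightarrow> norm p < d \<Longrightarrow> M < norm (F (inversion p))"
proof -
  obtain K where K: "0 < K" "\<And>z. K < norm z \<Longrightarrow> M < norm (F z)"
    by (rule F_proper[of M]) (rule that; blast)
  have "M < norm (F (inversion p))" if "p \<noteq> 0" "norm p < inverse K" for p
  proof (rule K(2))
    have "inverse (inverse K) < inverse (norm p)" using that by (intro less_imp_inverse_less) auto
    then show "K < norm (inversion p)" by simp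
  qed
  with K(1) show ?thesis using that[of "inverse K"] by simp
qed

text \<open>A separatrix would tend to the origin with \<open>norm (F (inversion p))\<close>
  constant on it, but this function tends to infinity at the origin.\<close>

lemma no_hyperbolic_sector: "\<not> hyperbolic_sector B 0 S"
proof
  assume "hyperbolic_sector B 0 S"
  then obtain \<tau> :: "real \<Rightarrow> real" and \<gamma> where \<gamma>: "continuous_on {0..} \<tau>" "strict_mono_on {0..} \<tau>" "solves B \<gamma> (\<tau> ` {0..})"
    "\<forall>t\<ge>0. \<gamma> (\<tau> t) \<noteq> 0" "((\<lambda>t. \<gamma> (\<tau> t)) \<longlongrightarrow> 0) at_top"
    by (rule separatrix)
  have "(\<lambda>t. norm (F (inversion (\<gamma> t)))) constant_on \<tau> ` {0..}"
    by (rule solution_norm_constant[OF \<gamma>(3)]) (use \<gamma>(4) in auto)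
  then obtain c where c: "\<And>t. 0 \<le> t \<Longrightarrow> norm (F (inversion (\<gamma> (\<tau> t)))) = c" unfolding constant_on_def by auto
  obtain d where d: "0 < d" "\<And>p. p \<noteq> 0 \<Longrightarrow> norm p < d \<Longrightarrow> c < norm (F (inversion p))"
    by (rule F_inversion_large[of c]) (rule that; blast)
  have "\<forall>\<^sub>F t in at_top. dist (\<gamma> (\<tau> t)) 0 < d \<and> (0::real) \<le> t"
    using tendstoD[OF \<gamma>(5) d(1)] eventually_ge_at_top by (rule eventually_conj)
  then obtain t where t: "dist (\<gamma> (\<tau> t)) 0 < d" "(0::real) \<le> t" by (auto dest: eventually_happens)
  then show False using d(2)[OF \<gamma>(4)[rule_format, OF t(2)]] c[OF t(2)] by simp
qed

lemma B_nonzero: "B p \<noteq> 0" if "p \<noteq> 0"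
proof
  assume "B p = 0"
  then have "norm p ^ (2 * dd) *\<^sub>R inversion_deriv p (inversion_deriv (inversion p) (X (inversion p))) = inversion_deriv p 0"
    unfolding B_eq[OF that] inversion_deriv_scaleR[symmetric] by simp
  then have "norm p ^ (2 * dd) *\<^sub>R X (inversion p) = 0"
    unfolding inversion_deriv_inverse[OF that] by (simp add: inversion_deriv_def zero_prod_def)
  then have "X (inversion p) = 0" using that by simp
  then have "J (inversion p) *\<^sub>R rot (F (inversion p)) = 0"
    using DF_X[of "inversion p"] by (simp add: DF_def zero_prod_def)
  then have "rot (F (inversion p)) = 0" using J_pos[of "inversion p"] by simp
  then have "F (inversion p) = 0" by (simp add: rot_def prod_eq_iff)
  then show False using that by simp
qed

text \<open>The orbit is the lift of a full circle, and \<open>\<tau>\<close> gives the time of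
  \<open>B\<close> as a function of the angle; \<open>T\<close> is the time of one turn.\<close>

lemma periodic_orbit:
  assumes "p \<noteq> 0"
  obtains r T :: real and \<gamma> \<tau> a where "0 < r" "0 < T" "solves B \<gamma> UNIV" "\<gamma> 0 = p" "\<forall>t. \<gamma> (t + T) = \<gamma> t"
    "homeomorphism UNIV UNIV \<tau> (inv \<tau>)" "strict_mono \<tau>" "\<tau> 0 = 0"
    "\<forall>t. \<gamma> (\<tau> t) = inversion (G (polar r (a + t)))" "r = norm (F (inversion p))"
proof -
  define r where "r = norm (F (inversion p))"
  have r: "0 < r" using assms by (simp add: r_def)
  obtain a where a: "F (inversion p) = polar r a" using polar_ex r_def by blast
  define c where "c = (\<lambda>t. G (polar r (a + t)))"
  have c0: "c t \<noteq> 0" for t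
  proof -
    have "norm (polar r (a + t)) \<noteq> 0" using r by simp
    then have "polar r (a + t) \<noteq> 0" by (metis norm_zero)
    then show ?thesis by (simp add: c_def)
  qed
  have dc: "(c has_vector_derivative DFinv (c t) (1 *\<^sub>R rot (F (c t)))) (at t)" for t
    unfolding c_def FG
    by (rule G_comp_has_vector_derivative[OF polar_has_vector_derivative])
      (auto simp: D_UNIV intro!: derivative_eq_intros)
  have ds: "((\<lambda>t. inversion (c t)) has_vector_derivative speed (c t) *\<^sub>R B (inversion (c t))) (at t)" for t
    using lift_has_vector_derivative[OF dc c0] by simp
  have "continuous_on UNIV c"
    unfolding continuous_on_eq_continuous_within using dc has_vector_derivative_continuous by blast
  then have cs: "continuous_on UNIV (\<lambda>t. speed (c t))" by (intro continuous_on_speed c0)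
  obtain \<tau>0 where \<tau>0: "\<And>t. (\<tau>0 has_real_derivative speed (c t)) (at t)"
    using interval_antiderivative[OF is_interval_univ cs] by auto
  define \<tau> where "\<tau> = (\<lambda>t. \<tau>0 t - \<tau>0 0)"
  have \<tau>: "(\<tau> has_real_derivative speed (c t)) (at t)" for t
    unfolding \<tau>_def using \<tau>0 by (auto intro!: derivative_eq_intros)
  have \<tau>_0: "\<tau> 0 = 0" by (simp add: \<tau>_def)
  have pos: "0 < speed (c t)" for t using speed_pos[OF c0] .
  note rep = reparametrize_to_solution[OF is_interval_univ ds \<tau> pos]
  have sm: "strict_mono \<tau>" using rep(2) by simp
  define T where "T = \<tau> (2 * pi)"
  have T: "0 < T" using strict_monoD[OF sm, of 0 "2 * pi"] \<tau>_0 by (simp add: T_def)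
  have cper: "c (t + 2 * pi) = c t" for t
    using polar_2pi[of r "a + t"] by (simp add: c_def add.assoc)
  have \<tau>per: "\<tau> (t + 2 * pi) = \<tau> t + T" for t
  proof -
    have "((\<lambda>t. \<tau> (t + 2 * pi) - \<tau> t) has_real_derivative 0) (at t)" for t
      using \<tau>[of t] DERIV_shift[of \<tau> "speed (c t)" t "2 * pi"] \<tau>[of "t + 2 * pi"] cper[of t]
      by (auto intro!: derivative_eq_intros)
    then have "\<tau> (t + 2 * pi) - \<tau> t = \<tau> (0 + 2 * pi) - \<tau> 0"
      by (rule DERIV_isconst_all[rule_format, of "\<lambda>t. \<tau> (t + 2 * pi) - \<tau> t" t 0])
    then show ?thesis by (simp add: T_def \<tau>_0)
  qed
  have \<tau>n: "\<tau> (2 * pi * real n) = T * real n" "\<tau> (- (2 * pi * real n)) = - (T * real n)" for n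
  proof (induction n)
    case (Suc n)
    show "\<tau> (2 * pi * real (Suc n)) = T * real (Suc n)"
      using \<tau>per[of "2 * pi * real n"] Suc(1) by (simp add: algebra_simps)
    show "\<tau> (- (2 * pi * real (Suc n))) = - (T * real (Suc n))"
      using \<tau>per[of "- (2 * pi * real (Suc n))"] Suc(2) by (simp add: algebra_simps)
  qed (simp_all add: \<tau>_0)
  \<comment> \<open>Since \<open>\<tau>\<close> advances by \<open>T\<close> with every turn, it is
    unbounded in both directions, which makes the solution global.\<close>
  have surj: "\<tau> ` UNIV = UNIV"
  proof -
    have "y \<in> range \<tau>" for y
    proof -
      obtain n :: nat where n: "\<bar>y\<bar> < real n * T" using reals_Archimedean3[OF T] by blast
      have "is_interval (range \<tau>)"
        using connected_continuous_image[OF rep(1)] is_interval_connected_1 connected_UNIV by blast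
      moreover have "- (T * real n) \<in> range \<tau>" "T * real n \<in> range \<tau>" using \<tau>n[of n] by (metis rangeI)+
      ultimately show ?thesis
        by (rule mem_is_interval_1_I) (use n in \<open>auto simp: mult.commute abs_less_iff\<close>)
    qed
    then show ?thesis by blast
  qed
  have inj: "inj \<tau>" using sm by (rule strict_mono_imp_inj_on)
  have inv_eq: "the_inv_into UNIV \<tau> = inv \<tau>"
    using inj surj by (metis ext f_inv_into_f inv_f_f the_inv_f_f UNIV_I)
  obtain \<tau>' where "homeomorphism UNIV (\<tau> ` UNIV) \<tau> \<tau>'"
    using injective_into_1d_eq_homeomorphism[OF rep(1) path_connected_UNIV] inj by blast
  then have h': "homeomorphism UNIV UNIV \<tau> \<tau>'" using surj by simp
  then have "\<tau>' = inv \<tau>" using inj by (metis ext homeomorphism_apply2 inv_f_f UNIV_I)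
  with h' have hom: "homeomorphism UNIV UNIV \<tau> (inv \<tau>)" by simp
  define \<gamma> where "\<gamma> = (\<lambda>r. inversion (c (the_inv_into UNIV \<tau> r)))"
  have \<gamma>\<tau>: "\<gamma> (\<tau> t) = inversion (c t)" for t using rep(4)[of t] by (simp add: \<gamma>_def)
  have "solves B \<gamma> UNIV" using rep(3) surj by (simp add: \<gamma>_def)
  moreover have "c 0 = inversion p" unfolding c_def add_0_right a[symmetric] by (rule GF)
  then have "\<gamma> 0 = p" using \<gamma>\<tau>[of 0] \<tau>_0 by simp
  moreover have "\<gamma> (t + T) = \<gamma> t" for t
  proof -
    obtain s where "t = \<tau> s" using surj by blast
    then have "t + T = \<tau> (s + 2 * pi)" using \<tau>per by simp
    then show ?thesis using \<open>t = \<tau> s\<close> \<gamma>\<tau> cper by simp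
  qed
  ultimately show ?thesis
    using that[OF r T _ _ _ hom sm \<tau>_0, of \<gamma> a] \<gamma>\<tau> r_def by (simp add: c_def)
qed

lemma is_center_B: "is_center B 0"
  unfolding is_center_def
proof (intro conjI exI[of _ UNIV] ballI)
  fix p :: "real \<times> real" assume p: "p \<in> UNIV - {0}"
  then show "B p \<noteq> 0" using B_nonzero by blast
  from p have "p \<noteq> 0" by simp
  then obtain r T :: real and \<gamma> \<tau> a where \<gamma>: "0 < r" "0 < T" "solves B \<gamma> UNIV" "\<gamma> 0 = p"
    "\<forall>t. \<gamma> (t + T) = \<gamma> t" "homeomorphism UNIV UNIV \<tau> (inv \<tau>)" "strict_mono \<tau>" "\<tau> 0 = 0"
    "\<forall>t. \<gamma> (\<tau> t) = inversion (G (polar r (a + t)))" "r = norm (F (inversion p))"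
    by (rule periodic_orbit)
  have nz: "\<gamma> t \<noteq> 0" for t
  proof -
    obtain s where "t = \<tau> s" using homeomorphism_apply2[OF \<gamma>(6)] by (metis UNIV_I)
    moreover have "norm (polar r (a + s)) \<noteq> 0" using \<gamma>(1) by simp
    then have "polar r (a + s) \<noteq> 0" by (metis norm_zero)
    then have "\<gamma> (\<tau> s) \<noteq> 0" unfolding \<gamma>(9)[rule_format] by simp
    ultimately show ?thesis by simp
  qed
  have "range \<gamma> \<subseteq> UNIV - {0}" by (rule image_subsetI) (simp add: nz)
  then show "\<exists>\<gamma> T. T > 0 \<and> solves B \<gamma> UNIV \<and> \<gamma> 0 = p \<and> (\<forall>t. \<gamma> (t + T) = \<gamma> t) \<and> range \<gamma> \<subseteq> UNIV - {0}"
    using \<gamma> by blast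
qed auto

end

section \<open>Winding of the closed orbits\<close>

definition to_complex :: "real \<times> real \<Rightarrow> complex" where
  "to_complex z = Complex (fst z) (snd z)"

lemma to_complex_eq_0 [simp]: "to_complex z = 0 \<longleftrightarrow> z = 0"
  by (simp add: to_complex_def complex_eq_iff prod_eq_iff)

lemma to_complex_inverse [simp]: "(Re (to_complex z), Im (to_complex z)) = z"
  by (simp add: to_complex_def)

lemma norm_to_complex [simp]: "norm (to_complex z) = norm z"
  by (simp add: to_complex_def norm_prod_def cmod_def)

lemma continuous_on_to_complex:
  assumes "continuous_on A c"
  shows "continuous_on A (\<lambda>x. to_complex (c x))"
proof -
  have "continuous_on A (\<lambda>x. complex_of_real (fst (c x)) + \<i> * complex_of_real (snd (c x)))"
    by (intro continuous_on_add continuous_on_mult continuous_on_const continuous_on_of_real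
        continuous_on_fst continuous_on_snd assms)
  then show ?thesis by (simp add: to_complex_def Complex_eq)
qed

context bijective_map
begin

text \<open>The angle is the imaginary part of a continuous logarithm of the orbit. Its increment
  over a turn is constant, and nonzero because \<open>F\<close> carries the orbit to a circle about
  the origin, which excludes a periodic logarithm.\<close>

lemma angle_of_orbit:
  assumes r: "0 < r"
  obtains \<theta> where "continuous_on UNIV \<theta>" "filterlim (\<lambda>t. \<bar>\<theta> t\<bar>) at_top at_top"
    "\<forall>t. G (polar r (a + t)) = norm (G (polar r (a + t))) *\<^sub>R (cos (\<theta> t), sin (\<theta> t))"
proof -
  define c where "c = (\<lambda>t. G (polar r (a + t)))"
  have c0: "c t \<noteq> 0" for t
  proof -
    have "norm (polar r (a + t)) \<noteq> 0" using r by simp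
    then have "polar r (a + t) \<noteq> 0" by (metis norm_zero)
    then show ?thesis by (simp add: c_def)
  qed
  have cc: "continuous_on UNIV c"
    unfolding c_def
    by (intro continuous_on_compose2[OF continuous_on_G_UNIV[of UNIV]] continuous_on_polar continuous_on_const
        continuous_on_add continuous_on_id) auto
  obtain l where l: "continuous_on UNIV l" "\<And>t. to_complex (c t) = exp (l t)"
    using continuous_logarithm_on_contractible[OF continuous_on_to_complex[OF cc] convex_imp_contractible[OF convex_UNIV]]
      c0 by auto
  define \<Phi> where "\<Phi> = (\<lambda>z. to_complex (F (Re z, Im z)))"
  have \<Phi>c: "continuous_on (- {0}) \<Phi>"
    unfolding \<Phi>_def
    by (intro continuous_on_to_complex continuous_on_compose2[OF continuous_on_F[of UNIV]] continuous_on_Pair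
        continuous_on_Re continuous_on_Im continuous_on_id) auto
  have \<Phi>0: "\<Phi> z \<noteq> 0" if "z \<noteq> 0" for z
  proof -
    have "(Re z, Im z) \<noteq> 0" using that by (simp add: zero_prod_def complex_eq_iff)
    then show ?thesis by (simp add: \<Phi>_def)
  qed
  have pol: "to_complex (polar r (a + t)) = (of_real r * exp (\<i> * of_real a)) * exp (\<i> * of_real t)" for t
    by (simp add: to_complex_def polar_def complex_eq_iff cos_add sin_add Re_exp Im_exp algebra_simps)
  have img: "\<Phi> (exp (l t)) = (of_real r * exp (\<i> * of_real a)) * exp (\<i> * of_real t)" for t
  proof -
    have "\<Phi> (exp (l t)) = to_complex (F (c t))" unfolding l(2)[symmetric] \<Phi>_def to_complex_inverse ..
    then show ?thesis using pol by (simp add: c_def)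
  qed
  have "of_real r * exp (\<i> * of_real a) \<noteq> (0::complex)" using r by simp
  from logarithm_not_periodic[OF \<Phi>c \<Phi>0 l(1) img this]
  obtain t0 where t0: "l (t0 + 2 * pi) \<noteq> l t0" by blast
  define \<Delta> where "\<Delta> = (\<lambda>t. l (t + 2 * pi) - l t)"
  have c\<Delta>: "continuous_on UNIV \<Delta>"
    unfolding \<Delta>_def
    by (intro continuous_on_diff l(1) continuous_on_compose2[OF l(1)] continuous_on_add continuous_on_id
        continuous_on_const) auto
  have "exp (l (t + 2 * pi)) = exp (l t)" for t
    unfolding l(2)[symmetric] c_def using polar_2pi[of r "a + t"] by (simp add: add.assoc)
  then have e\<Delta>: "exp (\<Delta> t) = 1" for t by (simp add: \<Delta>_def exp_diff)
  have \<Delta>: "\<Delta> t = \<Delta> t0" for t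
    by (rule exp_constant_imp_constant[OF connected_UNIV c\<Delta> e\<Delta>]) auto
  \<comment> \<open>The increment is purely imaginary, so a nonzero increment shows in the
    angle.\<close>
  have "Re (\<Delta> t0) = 0" using e\<Delta>[of t0] exp_eq_1[of "\<Delta> t0"] by simp
  moreover have "\<Delta> t0 \<noteq> 0" using t0 by (simp add: \<Delta>_def)
  ultimately have d0: "Im (\<Delta> t0) \<noteq> 0" by (simp add: complex_eq_iff)
  define \<theta> where "\<theta> = (\<lambda>t. Im (l t))"
  have c\<theta>: "continuous_on UNIV \<theta>" unfolding \<theta>_def by (intro continuous_on_Im l(1))
  have inc: "\<theta> (t + 2 * pi) = \<theta> t + Im (\<Delta> t0)" for t
    using \<Delta>[of t] by (simp add: \<theta>_def \<Delta>_def complex_eq_iff)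
  have "c t = norm (c t) *\<^sub>R (cos (\<theta> t), sin (\<theta> t))" for t
  proof -
    have "norm (c t) = exp (Re (l t))" using l(2)[of t] by (metis norm_exp_eq_Re norm_to_complex)
    moreover have "c t = (Re (exp (l t)), Im (exp (l t)))" unfolding l(2)[symmetric] by simp
    ultimately show ?thesis by (simp add: \<theta>_def Re_exp Im_exp)
  qed
  then show ?thesis
    using that[OF c\<theta> periodic_increment_linear_growth[OF c\<theta> inc d0]] by (simp add: c_def)
qed

lemma is_monodromic_B: "is_monodromic B 0"
  unfolding is_monodromic_def
proof (intro conjI allI impI)
  show "B 0 = 0" by simp
  fix V :: "(real \<times> real) set" assume V: "open V \<and> 0 \<in> V"
  then obtain e where e: "0 < e" "ball 0 e \<subseteq> V" using open_contains_ball by blast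
  \<comment> \<open>\<open>M\<close> bounds \<open>F\<close> on the disc of radius
    \<open>inverse e\<close>. An orbit on a level \<open>r > M\<close> stays outside that disc, so
    its inversion stays in the ball of radius \<open>e\<close>.\<close>
  have "compact (F ` cball 0 (inverse e))" by (intro compact_continuous_image continuous_on_F compact_cball)
  then obtain M where M: "\<And>w. w \<in> F ` cball 0 (inverse e) \<Longrightarrow> norm w \<le> M"
    using compact_imp_bounded bounded_iff by metis
  obtain d where d: "0 < d" "\<And>p. p \<noteq> 0 \<Longrightarrow> norm p < d \<Longrightarrow> M < norm (F (inversion p))"
    by (rule F_inversion_large[of M]) (rule that; blast)
  have "turns_around B 0 V p" if p: "p \<in> ball 0 (min e d) - {0}" for p
  proof -
    have "p \<noteq> 0" "norm p < d" using p by auto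
    from \<open>p \<noteq> 0\<close> obtain r T :: real and \<gamma> \<tau> a where \<gamma>: "0 < r" "0 < T" "solves B \<gamma> UNIV" "\<gamma> 0 = p"
      "\<forall>t. \<gamma> (t + T) = \<gamma> t" "homeomorphism UNIV UNIV \<tau> (inv \<tau>)" "strict_mono \<tau>" "\<tau> 0 = 0"
      "\<forall>t. \<gamma> (\<tau> t) = inversion (G (polar r (a + t)))" "r = norm (F (inversion p))"
      by (rule periodic_orbit)
    from \<gamma>(1) obtain \<theta> where \<theta>: "continuous_on UNIV \<theta>" "filterlim (\<lambda>t. \<bar>\<theta> t\<bar>) at_top at_top"
      "\<forall>t. G (polar r (a + t)) = norm (G (polar r (a + t))) *\<^sub>R (cos (\<theta> t), sin (\<theta> t))"
      by (rule angle_of_orbit)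
    have Mr: "M < r" using d(2)[OF \<open>p \<noteq> 0\<close> \<open>norm p < d\<close>] \<gamma>(10) by simp
    have surj: "\<tau> (inv \<tau> s) = s" for s using homeomorphism_apply2[OF \<gamma>(6)] by simp
    have \<gamma>s: "\<gamma> s = inversion (G (polar r (a + inv \<tau> s)))" for s
      using \<gamma>(9)[rule_format, of "inv \<tau> s"] surj by simp
    have nz: "polar r t \<noteq> 0" for t
    proof -
      have "norm (polar r t) \<noteq> 0" using \<gamma>(1) by simp
      then show ?thesis by (metis norm_zero)
    qed
    have \<gamma>V: "\<gamma> s \<in> V - {0}" for s
    proof -
      let ?z = "G (polar r (a + inv \<tau> s))"
      have "\<not> norm ?z \<le> inverse e"
      proof
        assume "norm ?z \<le> inverse e"
        then have "F ?z \<in> F ` cball 0 (inverse e)" by (intro imageI) simp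
        then have "norm (F ?z) \<le> M" by (rule M)
        then show False using Mr \<gamma>(1) by simp
      qed
      then have "inverse (norm ?z) < inverse (inverse e)"
        using e(1) by (intro less_imp_inverse_less) auto
      then have "\<gamma> s \<in> ball 0 e" unfolding \<gamma>s by simp
      moreover have "\<gamma> s \<noteq> 0" unfolding \<gamma>s using nz by simp
      ultimately show ?thesis using e(2) by blast
    qed
    have dir: "\<gamma> s = norm (\<gamma> s) *\<^sub>R (cos (\<theta> (inv \<tau> s)), sin (\<theta> (inv \<tau> s)))" for s
    proof -
      define z u where "z = G (polar r (a + inv \<tau> s))" and "u = (cos (\<theta> (inv \<tau> s)), sin (\<theta> (inv \<tau> s)))"
      have z: "z = norm z *\<^sub>R u" using \<theta>(3)[rule_format, of "inv \<tau> s"] by (simp add: z_def u_def)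
      have "z \<noteq> 0" using nz by (simp add: z_def)
      have "inversion z = (norm z *\<^sub>R u) /\<^sub>R (norm z)\<^sup>2" unfolding inversion_altdef using z by simp
      also have "\<dots> = inverse (norm z) *\<^sub>R u" using \<open>z \<noteq> 0\<close> by (simp add: power2_eq_square)
      also have "\<dots> = norm (inversion z) *\<^sub>R u" by simp
      finally show ?thesis unfolding \<gamma>s z_def[symmetric] u_def[symmetric] .
    qed
    have "continuous_on {0..} (inv \<tau>)"
      by (rule continuous_on_subset[OF homeomorphism_cont2[OF \<gamma>(6)]]) simp
    then have c: "continuous_on {0..} (\<lambda>s. \<theta> (inv \<tau> s))"
      by (rule continuous_on_compose2[OF \<theta>(1)]) simp
    have "filterlim (inv \<tau>) at_top at_top"
      unfolding filterlim_at_top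
    proof
      fix Z
      have "Z \<le> inv \<tau> s" if "\<tau> Z \<le> s" for s
        using that surj[of s] strict_mono_less_eq[OF \<gamma>(7), of Z "inv \<tau> s"] by simp
      then show "\<forall>\<^sub>F s in at_top. Z \<le> inv \<tau> s" unfolding eventually_at_top_linorder by blast
    qed
    from filterlim_compose[OF \<theta>(2) this] have f: "filterlim (\<lambda>s. \<bar>\<theta> (inv \<tau> s)\<bar>) at_top at_top" .
    have s: "solves B \<gamma> {0..}"
      using \<gamma>(3) unfolding solves_def
      by (auto simp: is_interval_ci intro: has_vector_derivative_at_within)
    show ?thesis
      unfolding turns_around_def
    proof (intro exI[of _ \<gamma>] exI[of _ "\<lambda>s. \<theta> (inv \<tau> s)"] conjI s c f \<gamma>(4) allI impI)
      show "\<gamma> ` {0..} \<subseteq> V - {0}" by (rule image_subsetI) (rule \<gamma>V)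
      show "\<gamma> t - 0 = norm (\<gamma> t - 0) *\<^sub>R (cos (\<theta> (inv \<tau> t)), sin (\<theta> (inv \<tau> t)))" for t
        using dir[of t] by simp
    qed
  qed
  moreover have "ball 0 (min e d) \<subseteq> V" using e(2) by auto
  moreover have "0 \<in> ball 0 (min e d)" using e(1) d(1) by simp
  ultimately show "\<exists>U. open U \<and> 0 \<in> U \<and> U \<subseteq> V \<and>
     (\<forall>p\<in>U - {0}. turns_around B 0 V p \<or> turns_around (\<lambda>z. - B z) 0 V p)"
    using open_ball by blast
qed

end

section \<open>Growth of proper polynomials\<close>

lemma poly_bounded_below:
  fixes a :: "real poly"
  assumes "a \<noteq> 0"
  obtains c K where "0 < c" "\<forall>q\<ge>K. c \<le> \<bar>poly a q\<bar>"
proof (cases "degree a = 0")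
  case True
  then obtain b where "a = [:b:]" by (rule degree_eq_zeroE)
  then show ?thesis using that[of "\<bar>b\<bar>" 0] assms by simp
next
  case False
  then obtain b p where p: "a = pCons b p" "p \<noteq> 0" by (cases a) (auto split: if_splits)
  obtain r where r: "\<And>z. r \<le> norm z \<Longrightarrow> 1 \<le> norm (poly (pCons b p) z)"
    using poly_infinity[OF p(2), of 1 b] by blast
  have "1 \<le> \<bar>poly a q\<bar>" if "max r 0 \<le> q" for q
    using r[of q] that p(1) by simp
  then show ?thesis using that[of 1 "max r 0"] by simp
qed

lemma poly_bounded_above:
  fixes a :: "real poly"
  assumes "1 \<le> q" "degree a \<le> M"
  shows "\<bar>poly a q\<bar> \<le> (\<Sum>j\<le>degree a. \<bar>coeff a j\<bar>) * q ^ M"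
proof -
  have "\<bar>poly a q\<bar> \<le> (\<Sum>j\<le>degree a. \<bar>coeff a j * q ^ j\<bar>)"
    unfolding poly_altdef by (rule sum_abs)
  also have "\<dots> \<le> (\<Sum>j\<le>degree a. \<bar>coeff a j\<bar> * q ^ M)"
    using assms by (intro sum_mono) (auto simp: abs_mult intro!: mult_left_mono power_increasing)
  finally show ?thesis by (simp add: sum_distrib_right)
qed

text \<open>A bound for roots: the leading coefficient \<open>a N\<close> of the relation in
  \<open>s\<close> stays away from zero for large \<open>q\<close>, while for \<open>s > 1\<close>
  the lower terms are at most \<open>s ^ (N - 1)\<close> times a power of \<open>q\<close>, up to
  constants.\<close>

lemma algebraic_relation_growth:
  fixes a :: "nat \<Rightarrow> real poly"
  assumes "i0 \<le> n" "a i0 \<noteq> 0"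
  obtains C M K where "0 < C" "1 \<le> K" "\<forall>s q. 0 \<le> s \<longrightarrow> K \<le> q \<longrightarrow> (\<Sum>i\<le>n. s ^ i * poly (a i) q) = 0 \<longrightarrow> s \<le> C * q ^ M"
proof -
  define N where "N = Max {i. i \<le> n \<and> a i \<noteq> 0}"
  have fin: "finite {i. i \<le> n \<and> a i \<noteq> 0}" by simp
  have "N \<in> {i. i \<le> n \<and> a i \<noteq> 0}" unfolding N_def using assms by (intro Max_in fin) auto
  then have N: "N \<le> n" "a N \<noteq> 0" by auto
  have above: "a i = 0" if "N < i" "i \<le> n" for i
  proof (rule ccontr)
    assume "a i \<noteq> 0"
    then have "i \<le> N" unfolding N_def using that(2) by (intro Max_ge fin) simp
    with that(1) show False by simp
  qed
  obtain c K where c: "0 < c" "\<forall>q\<ge>K. c \<le> \<bar>poly (a N) q\<bar>" using poly_bounded_below[OF N(2)] .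
  define M where "M = (\<Sum>i\<le>n. degree (a i))"
  define C1 where "C1 = (\<Sum>i\<le>n. \<Sum>j\<le>degree (a i). \<bar>coeff (a i) j\<bar>)"
  have C1: "0 \<le> C1" unfolding C1_def by (intro sum_nonneg) auto
  have ub: "\<bar>poly (a i) q\<bar> \<le> C1 * q ^ M" if "i \<le> n" "1 \<le> q" for i q
  proof -
    have "degree (a i) \<le> M" unfolding M_def by (rule member_le_sum) (use that in auto)
    then have "\<bar>poly (a i) q\<bar> \<le> (\<Sum>j\<le>degree (a i). \<bar>coeff (a i) j\<bar>) * q ^ M"
      by (rule poly_bounded_above[OF that(2)])
    also have "(\<Sum>j\<le>degree (a i). \<bar>coeff (a i) j\<bar>) \<le> C1"
      unfolding C1_def by (rule member_le_sum[of i]) (use that in \<open>auto intro!: sum_nonneg\<close>)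
    then have "(\<Sum>j\<le>degree (a i). \<bar>coeff (a i) j\<bar>) * q ^ M \<le> C1 * q ^ M"
      using that by (intro mult_right_mono) auto
    finally show ?thesis .
  qed
  \<comment> \<open>The summand \<open>1\<close> covers \<open>s \<le> 1\<close>; the rest is the
    ratio of the bounds for the lower terms and for the leading coefficient.\<close>
  define C where "C = 1 + real N * C1 / c"
  have Cpos: "1 \<le> C" unfolding C_def using C1 c by simp
  have "s \<le> C * q ^ M" if s: "0 \<le> s" and q: "max 1 K \<le> q" and eq: "(\<Sum>i\<le>n. s ^ i * poly (a i) q) = 0" for s q
  proof (cases "s \<le> 1")
    case True
    have "1 * 1 \<le> C * q ^ M" using Cpos q by (intro mult_mono one_le_power) auto
    with True show ?thesis by simp
  next
    case False
    have q1: "1 \<le> q" "K \<le> q" using q by auto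
    have "(\<Sum>i\<le>n. s ^ i * poly (a i) q) = (\<Sum>i\<le>N. s ^ i * poly (a i) q)"
      by (rule sum.mono_neutral_right) (use N above in auto)
    then have "(\<Sum>i<N. s ^ i * poly (a i) q) + s ^ N * poly (a N) q = 0"
      using eq by (simp add: lessThan_Suc_atMost[symmetric])
    then have "s ^ N * poly (a N) q = - (\<Sum>i<N. s ^ i * poly (a i) q)" by linarith
    then have "\<bar>s ^ N * poly (a N) q\<bar> = \<bar>\<Sum>i<N. s ^ i * poly (a i) q\<bar>" by simp
    also have "\<dots> \<le> (\<Sum>i<N. \<bar>s ^ i * poly (a i) q\<bar>)" by (rule sum_abs)
    also have "\<dots> \<le> (\<Sum>i<N. s ^ (N - 1) * (C1 * q ^ M))"
    proof (rule sum_mono)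
      fix i assume "i \<in> {..<N}"
      then have "s ^ i \<le> s ^ (N - 1)" "i \<le> n" using False N by (auto intro!: power_increasing)
      then show "\<bar>s ^ i * poly (a i) q\<bar> \<le> s ^ (N - 1) * (C1 * q ^ M)"
        unfolding abs_mult using s ub[of i q] q1 by (intro mult_mono) auto
    qed
    finally have le: "\<bar>s ^ N * poly (a N) q\<bar> \<le> real N * (s ^ (N - 1) * (C1 * q ^ M))" by simp
    have ge: "s ^ N * c \<le> \<bar>s ^ N * poly (a N) q\<bar>"
      unfolding abs_mult using s c q1 by (intro mult_mono) auto
    have sN: "0 < s ^ N * c" using False c(1) by simp
    have "N \<noteq> 0"
    proof
      assume "N = 0"
      with le ge sN show False by simp
    qed
    then have "s ^ N = s ^ (N - 1) * s" by (metis power_minus_mult neq0_conv)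
    then have "s ^ (N - 1) * (s * c) \<le> s ^ (N - 1) * (real N * C1 * q ^ M)"
      using le ge by (simp add: mult_ac)
    then have "s * c \<le> real N * C1 * q ^ M"
      using False by (subst (asm) mult_le_cancel_left_pos) auto
    then have "s \<le> real N * C1 * q ^ M / c" using c(1) by (simp add: pos_le_divide_eq)
    also have "\<dots> = real N * C1 / c * q ^ M" by simp
    also have "\<dots> \<le> C * q ^ M" unfolding C_def using q1 by (intro mult_right_mono) auto
    finally show ?thesis .
  qed
  then show ?thesis using that[of C "max 1 K" M] Cpos by auto
qed

lemma ellipse_param:
  assumes "0 < \<kappa>" "0 \<le> \<rho>"
  shows "x\<^sup>2 + \<kappa> * y\<^sup>2 = \<rho> \<Longrightarrow> \<exists>t. x = sqrt \<rho> * cos t \<and> y = sqrt (\<rho> / \<kappa>) * sin t"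
    and "(sqrt \<rho> * cos t)\<^sup>2 + \<kappa> * (sqrt (\<rho> / \<kappa>) * sin t)\<^sup>2 = \<rho>"
proof -
  show "(sqrt \<rho> * cos t)\<^sup>2 + \<kappa> * (sqrt (\<rho> / \<kappa>) * sin t)\<^sup>2 = \<rho>"
    using assms by (simp add: power_mult_distrib flip: distrib_left)
next
  assume e: "x\<^sup>2 + \<kappa> * y\<^sup>2 = \<rho>"
  obtain t where t: "(x, sqrt \<kappa> * y) = polar (norm (x, sqrt \<kappa> * y)) t" using polar_ex by blast
  have "(norm (x, sqrt \<kappa> * y))\<^sup>2 = \<rho>" unfolding norm_prod_power2 using assms e by (simp add: power_mult_distrib)
  then have n: "norm (x, sqrt \<kappa> * y) = sqrt \<rho>" by (metis norm_ge_zero real_sqrt_unique)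
  have "x = sqrt \<rho> * cos t" "sqrt \<kappa> * y = sqrt \<rho> * sin t" using t unfolding n polar_def by simp_all
  moreover have "sqrt \<kappa> \<noteq> 0" using assms by simp
  ultimately have "y = sqrt \<rho> / sqrt \<kappa> * sin t" by (simp add: field_simps)
  then show "\<exists>t. x = sqrt \<rho> * cos t \<and> y = sqrt (\<rho> / \<kappa>) * sin t"
    using \<open>x = sqrt \<rho> * cos t\<close> by (auto simp: real_sqrt_divide)
qed

text \<open>The last equation says that the derivative of \<open>p\<close> along the ellipse vanishes.\<close>

lemma ellipse_minimum:
  assumes \<kappa>: "0 < \<kappa>" and \<rho>: "0 < \<rho>"
  obtains x y where "x\<^sup>2 + \<kappa> * y\<^sup>2 = \<rho>"
    "\<forall>x' y'. x'\<^sup>2 + \<kappa> * y'\<^sup>2 = \<rho> \<longrightarrow> eval_xy p x y \<le> eval_xy p x' y'"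
    "x * eval_xy (deriv_y p) x y - \<kappa> * (y * eval_xy (deriv_x p) x y) = 0"
proof -
  define a b where "a = sqrt \<rho>" and "b = sqrt (\<rho> / \<kappa>)"
  have ab: "0 < a" "0 < b" "a * a = \<rho>" "\<kappa> * (b * b) = \<rho>" using assms by (auto simp: a_def b_def)
  define m where "m = (\<lambda>t. eval_xy p (a * cos t) (b * sin t))"
  have cm: "continuous_on UNIV m"
    unfolding m_def by (intro continuous_on_eval_xy continuous_on_mult continuous_on_const
        continuous_on_cos continuous_on_sin continuous_on_id)
  obtain t0 where t0: "t0 \<in> {0..2 * pi}" "\<And>t. t \<in> {0..2 * pi} \<Longrightarrow> m t0 \<le> m t"
    using continuous_attains_inf[of "{0..2 * pi}" m] continuous_on_subset[OF cm] by auto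
  have min: "m t0 \<le> m t" for t
  proof -
    obtain s where s: "0 \<le> s" "s < 2 * pi" "cos t = cos s" "sin t = sin s"
      using sincos_total_2pi[of "cos t" "sin t"] by (metis sin_cos_squared_add2 sin_cos_squared_add)
    then have "m t = m s" by (simp add: m_def)
    with t0(2)[of s] s show ?thesis by simp
  qed
  have dxy: "((\<lambda>t. (a * cos t, b * sin t)) has_derivative (\<lambda>h. (h * - (a * sin t0), h * (b * cos t0)))) (at t0)"
    by (rule has_derivative_Pair; (rule has_derivative_eq_rhs, (rule derivative_eq_intros refl)+)) auto
  have "(m has_derivative (\<lambda>h. eval_xy (deriv_x p) (a * cos t0) (b * sin t0) * (h * - (a * sin t0)) +
      eval_xy (deriv_y p) (a * cos t0) (b * sin t0) * (h * (b * cos t0)))) (at t0)"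
    using has_derivative_compose[OF dxy eval_xy_has_derivative[of p]] by (simp add: m_def)
  then have "(m has_real_derivative (eval_xy (deriv_y p) (a * cos t0) (b * sin t0) * (b * cos t0) -
      eval_xy (deriv_x p) (a * cos t0) (b * sin t0) * (a * sin t0))) (at t0)"
    unfolding has_field_derivative_def by (rule has_derivative_eq_rhs) (auto simp: algebra_simps)
  then have z: "eval_xy (deriv_y p) (a * cos t0) (b * sin t0) * (b * cos t0) -
      eval_xy (deriv_x p) (a * cos t0) (b * sin t0) * (a * sin t0) = 0"
    by (rule DERIV_local_min[OF _ zero_less_one]) (use min in auto)
  define x y where "x = a * cos t0" and "y = b * sin t0"
  have "a * (eval_xy (deriv_y p) x y * (b * cos t0) - eval_xy (deriv_x p) x y * (a * sin t0)) = 0"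
    using z unfolding x_def y_def by simp
  moreover have "a * (eval_xy (deriv_y p) x y * (b * cos t0) - eval_xy (deriv_x p) x y * (a * sin t0))
      = b * (x * eval_xy (deriv_y p) x y - \<kappa> * (y * eval_xy (deriv_x p) x y))"
  proof -
    have "a * (eval_xy (deriv_x p) x y * (a * sin t0)) = (a * a) * (eval_xy (deriv_x p) x y * sin t0)" by simp
    also have "\<dots> = b * (\<kappa> * (y * eval_xy (deriv_x p) x y))" unfolding ab(3) ab(4)[symmetric] y_def by simp
    finally show ?thesis by (simp add: right_diff_distrib x_def)
  qed
  ultimately have 3: "x * eval_xy (deriv_y p) x y - \<kappa> * (y * eval_xy (deriv_x p) x y) = 0"
    using ab(2) by simp
  have 1: "x\<^sup>2 + \<kappa> * y\<^sup>2 = \<rho>" unfolding x_def y_def a_def b_def by (rule ellipse_param(2)) (use assms in auto)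
  have 2: "eval_xy p x y \<le> eval_xy p x' y'" if e: "x'\<^sup>2 + \<kappa> * y'\<^sup>2 = \<rho>" for x' y'
  proof -
    obtain t where "x' = a * cos t" "y' = b * sin t"
      using ellipse_param(1)[OF \<kappa> less_imp_le[OF \<rho>] e] by (auto simp: a_def b_def)
    then show ?thesis using min[of t] by (simp add: m_def x_def y_def)
  qed
  show ?thesis using that[OF 1 _ 3] 2 by blast
qed

text \<open>A Lojasiewicz inequality at infinity. At a minimum of \<open>p\<close> on the ellipse \<open>Q = \<rho>\<close> the polynomial
  \<open>L\<close> vanishes; after cancelling a power of \<open>L\<close>, an algebraic relation between \<open>Q\<close>, \<open>p\<close> and \<open>L\<close>
  becomes one between \<open>\<rho>\<close> and that minimum.\<close>

lemma polynomial_growth: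
  fixes p :: poly_xy and \<kappa> :: real
  defines "Q \<equiv> var_x\<^sup>2 + [:[:\<kappa>:]:] * var_y\<^sup>2"
  defines "L \<equiv> var_x * deriv_y p - [:[:\<kappa>:]:] * (var_y * deriv_x p)"
  assumes \<kappa>: "1 \<le> \<kappa>" and L: "L \<noteq> 0"
    and proper: "\<And>M. \<exists>r. \<forall>x y. r \<le> x\<^sup>2 + y\<^sup>2 \<longrightarrow> M \<le> eval_xy p x y"
  obtains C N r where "0 < C" "\<forall>x y. r \<le> x\<^sup>2 + y\<^sup>2 \<longrightarrow> x\<^sup>2 + y\<^sup>2 \<le> C * eval_xy p x y ^ N"
proof -
  obtain n c where c: "\<exists>i\<le>n. \<exists>j\<le>n. \<exists>k\<le>n. c i j k \<noteq> (0::real)"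
    and rel: "(\<Sum>k\<le>n. \<Sum>i\<le>n. \<Sum>j\<le>n. [:[:c i j k:]:] * (Q ^ i * p ^ j * L ^ k)) = 0"
    using three_polynomials_dependent[of Q p L] by blast
  define A where "A = (\<lambda>k. \<Sum>i\<le>n. \<Sum>j\<le>n. [:[:c i j k:]:] * (Q ^ i * p ^ j))"
  \<comment> \<open>The lowest power of \<open>L\<close> in the relation. After division by
    \<open>L ^ k0\<close>, a zero of \<open>L\<close> removes all terms except those with
    \<open>k = k0\<close>.\<close>
  define k0 where "k0 = (LEAST k. k \<le> n \<and> (\<exists>i\<le>n. \<exists>j\<le>n. c i j k \<noteq> 0))"
  have "\<exists>k. k \<le> n \<and> (\<exists>i\<le>n. \<exists>j\<le>n. c i j k \<noteq> 0)" using c by blast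
  from LeastI_ex[OF this] have k0: "k0 \<le> n" "\<exists>i\<le>n. \<exists>j\<le>n. c i j k0 \<noteq> 0" unfolding k0_def by blast+
  have k0_min: "c i j k = 0" if "k < k0" "i \<le> n" "j \<le> n" for i j k
    using not_less_Least[of k "\<lambda>k. k \<le> n \<and> (\<exists>i\<le>n. \<exists>j\<le>n. c i j k \<noteq> 0)"] that k0(1) unfolding k0_def by force
  have "(\<Sum>k\<le>n. A k * L ^ k) = 0"
    using rel by (simp add: A_def sum_distrib_right mult.assoc)
  moreover have "(\<Sum>k\<le>n. A k * L ^ k) = (\<Sum>k\<in>{k0..n}. A k * L ^ k)"
  proof (rule sum.mono_neutral_right)
    show "\<forall>k\<in>{..n} - {k0..n}. A k * L ^ k = 0"
    proof
      fix k assume "k \<in> {..n} - {k0..n}"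
      then have "A k = 0" unfolding A_def using k0_min[of k] by (intro sum.neutral ballI) auto
      then show "A k * L ^ k = 0" by simp
    qed
  qed auto
  moreover have "(\<Sum>k\<in>{k0..n}. A k * L ^ k) = L ^ k0 * (\<Sum>k\<in>{k0..n}. A k * L ^ (k - k0))"
    unfolding sum_distrib_left by (rule sum.cong) (auto simp: mult_ac simp flip: power_add)
  ultimately have rel2: "(\<Sum>k\<in>{k0..n}. A k * L ^ (k - k0)) = 0" using L by simp
  define a where "a = (\<lambda>i. \<Sum>j\<le>n. monom (c i j k0) j)"
  obtain i0 j0 where i0: "i0 \<le> n" "j0 \<le> n" "c i0 j0 k0 \<noteq> 0" using k0(2) by blast
  have "coeff (a i0) j0 = c i0 j0 k0" unfolding a_def coeff_sum using i0(2) by (simp add: if_distrib cong: if_cong)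
  then have "a i0 \<noteq> 0" using i0(3) by auto
  from algebraic_relation_growth[where a = a, OF i0(1) this] obtain C M K where
    C: "0 < C" "1 \<le> K" "\<forall>s q. 0 \<le> s \<longrightarrow> K \<le> q \<longrightarrow> (\<Sum>i\<le>n. s ^ i * poly (a i) q) = 0 \<longrightarrow> s \<le> C * q ^ M" .
  obtain r where r: "\<forall>x y. r \<le> x\<^sup>2 + y\<^sup>2 \<longrightarrow> K \<le> eval_xy p x y" using proper by blast
  \<comment> \<open>The factor \<open>\<kappa>\<close> makes up for the eccentricity: the minimum
    point \<open>(u, v)\<close> on the ellipse through \<open>(x, y)\<close> still satisfies
    \<open>r \<le> u\<^sup>2 + v\<^sup>2\<close>.\<close>
  have "x\<^sup>2 + y\<^sup>2 \<le> C * eval_xy p x y ^ M" if xy: "max 1 (\<kappa> * \<bar>r\<bar>) \<le> x\<^sup>2 + y\<^sup>2" for x y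
  proof -
    define \<rho> where "\<rho> = x\<^sup>2 + \<kappa> * y\<^sup>2"
    have le: "x\<^sup>2 + y\<^sup>2 \<le> \<rho>" unfolding \<rho>_def using mult_right_mono[OF \<kappa>, of "y\<^sup>2"] by simp
    then have \<rho>: "0 < \<rho>" "\<kappa> * \<bar>r\<bar> \<le> \<rho>" using xy by auto
    obtain u v where uv: "u\<^sup>2 + \<kappa> * v\<^sup>2 = \<rho>"
      "\<forall>x' y'. x'\<^sup>2 + \<kappa> * y'\<^sup>2 = \<rho> \<longrightarrow> eval_xy p u v \<le> eval_xy p x' y'"
      "u * eval_xy (deriv_y p) u v - \<kappa> * (v * eval_xy (deriv_x p) u v) = 0"
      using ellipse_minimum[of \<kappa> \<rho> p] \<kappa> \<rho>(1) by auto
    have Luv: "eval_xy L u v = 0" using uv(3) by (simp add: L_def)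
    have Quv: "eval_xy Q u v = \<rho>" using uv(1) by (simp add: Q_def)
    have "\<rho> \<le> \<kappa> * (u\<^sup>2 + v\<^sup>2)"
      using uv(1) mult_right_mono[OF \<kappa>, of "u\<^sup>2"] by (simp add: distrib_left)
    then have "\<kappa> * \<bar>r\<bar> \<le> \<kappa> * (u\<^sup>2 + v\<^sup>2)" using \<rho> by linarith
    then have "\<bar>r\<bar> \<le> u\<^sup>2 + v\<^sup>2" using \<kappa> by simp
    then have "K \<le> eval_xy p u v" using r by simp
    have "0 = eval_xy (\<Sum>k\<in>{k0..n}. A k * L ^ (k - k0)) u v" unfolding rel2 by simp
    also have "\<dots> = (\<Sum>k\<in>{k0..n}. eval_xy (A k) u v * 0 ^ (k - k0))" by (simp add: Luv)
    also have "\<dots> = (\<Sum>k\<in>{k0}. eval_xy (A k) u v * 0 ^ (k - k0))"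
      by (rule sum.mono_neutral_right) (use k0(1) in auto)
    also have "\<dots> = eval_xy (A k0) u v" by simp
    also have "\<dots> = (\<Sum>i\<le>n. \<rho> ^ i * poly (a i) (eval_xy p u v))"
      unfolding A_def a_def by (simp add: Quv poly_sum poly_monom sum_distrib_left mult_ac)
    finally have "(\<Sum>i\<le>n. \<rho> ^ i * poly (a i) (eval_xy p u v)) = 0" by simp
    then have "\<rho> \<le> C * eval_xy p u v ^ M" using C(3) \<rho>(1) \<open>K \<le> eval_xy p u v\<close> by simp
    also have "\<dots> \<le> C * eval_xy p x y ^ M"
    proof -
      have "eval_xy p u v \<le> eval_xy p x y" using uv(2) by (simp add: \<rho>_def)
      then have "eval_xy p u v ^ M \<le> eval_xy p x y ^ M"
        using \<open>K \<le> eval_xy p u v\<close> C(2) by (intro power_mono) auto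
      then show ?thesis using C(1) by simp
    qed
    finally show ?thesis using le by linarith
  qed
  then show ?thesis using that[OF C(1), of "max 1 (\<kappa> * \<bar>r\<bar>)" M] by blast
qed

section \<open>Smoothness\<close>

text \<open>Induction on the order. It replaces the computation of higher derivatives by the search
  for a class that is closed under first ones.\<close>

lemma Cn_on_closed_class:
  fixes \<C> :: "('a::euclidean_space \<Rightarrow> 'b::real_normed_vector) set"
  assumes diff: "\<And>\<phi> z. \<phi> \<in> \<C> \<Longrightarrow> \<phi> differentiable (at z)"
    and closed: "\<And>\<phi> b. \<phi> \<in> \<C> \<Longrightarrow> b \<in> Basis \<Longrightarrow> (\<lambda>z. frechet_derivative \<phi> (at z) b) \<in> \<C>"
    and "\<phi> \<in> \<C>"
  shows "Cn_on n UNIV \<phi>"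
  using \<open>\<phi> \<in> \<C>\<close>
proof (induction n arbitrary: \<phi>)
  case 0
  then have "\<phi> differentiable_on UNIV"
    using diff by (simp add: differentiable_on_def)
  then show ?case by (simp add: differentiable_imp_continuous_on)
next
  case (Suc n)
  then show ?case using diff closed by simp
qed

lemma Basis_real_prod: "b \<in> Basis \<Longrightarrow> b = (1, 0) \<or> b = (0, 1)" for b :: "real \<times> real"
  by (auto simp: Basis_prod_def)

lemma Cn_on_poly_map: "Cn_on n UNIV (poly_map (p, q))"
proof (rule Cn_on_closed_class[where \<C> = "range poly_map"])
  have d: "(poly_map (a, b) has_derivative (\<lambda>h.
      (eval_xy (deriv_x a) (fst z) (snd z) * fst h + eval_xy (deriv_y a) (fst z) (snd z) * snd h,
       eval_xy (deriv_x b) (fst z) (snd z) * fst h + eval_xy (deriv_y b) (fst z) (snd z) * snd h))) (at z)" for a b z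
    unfolding poly_map_def fst_conv snd_conv by (intro has_derivative_Pair eval_xy_has_derivative)
  fix \<phi> :: "real \<times> real \<Rightarrow> real \<times> real" assume "\<phi> \<in> range poly_map"
  then obtain a b where \<phi>: "\<phi> = poly_map (a, b)" by auto
  show "\<phi> differentiable (at z)" for z unfolding \<phi> differentiable_def using d by blast
  fix e :: "real \<times> real" assume "e \<in> Basis"
  then consider "e = (1, 0)" | "e = (0, 1)" using Basis_real_prod by blast
  then show "(\<lambda>z. frechet_derivative \<phi> (at z) e) \<in> range poly_map"
  proof cases
    case 1
    then have "(\<lambda>z. frechet_derivative \<phi> (at z) e) = poly_map (deriv_x a, deriv_x b)"
      unfolding \<phi> frechet_derivative_at[OF d, symmetric] by (simp add: poly_map_def fun_eq_iff)
    then show ?thesis by simp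
  next
    case 2
    then have "(\<lambda>z. frechet_derivative \<phi> (at z) e) = poly_map (deriv_y a, deriv_y b)"
      unfolding \<phi> frechet_derivative_at[OF d, symmetric] by (simp add: poly_map_def fun_eq_iff)
    then show ?thesis by simp
  qed
qed simp

context positive_jacobian
begin

definition gradient :: "poly_xy \<Rightarrow> real \<times> real \<Rightarrow> real \<times> real \<Rightarrow> real" where
  "gradient P z h = eval_xy (deriv_x P) (fst z) (snd z) * fst h + eval_xy (deriv_y P) (fst z) (snd z) * snd h"

lemma has_derivative_gradient: "((\<lambda>z. eval_xy P (fst z) (snd z)) has_derivative gradient P z) (at z)"
  unfolding gradient_def[abs_def] by (rule eval_xy_has_derivative)

definition sq :: poly_xy where "sq = f\<^sup>2 + g\<^sup>2"

lemma eval_sq: "eval_xy sq (fst z) (snd z) = (norm (F z))\<^sup>2"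
  unfolding norm_prod_power2 by (simp add: sq_def F_def poly_map_def)

lemma deriv_sq:
  "eval_xy (deriv_x sq) (fst z) (snd z) = 2 * (fst (F z) * fx z + snd (F z) * gx z)"
  "eval_xy (deriv_y sq) (fst z) (snd z) = 2 * (fst (F z) * fy z + snd (F z) * gy z)"
proof -
  have "((\<lambda>x. eval_xy sq x (snd z)) has_field_derivative 2 * (fst (F z) * fx z + snd (F z) * gx z)) (at (fst z))"
    unfolding sq_def
    by (auto intro!: derivative_eq_intros has_field_derivative_eval_x simp: F_def poly_map_def fx_def gx_def)
  then show "eval_xy (deriv_x sq) (fst z) (snd z) = 2 * (fst (F z) * fx z + snd (F z) * gx z)"
    using has_field_derivative_eval_x DERIV_unique by blast
  have "((\<lambda>y. eval_xy sq (fst z) y) has_field_derivative 2 * (fst (F z) * fy z + snd (F z) * gy z)) (at (snd z))"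
    unfolding sq_def
    by (auto intro!: derivative_eq_intros has_field_derivative_eval_y simp: F_def poly_map_def fy_def gy_def)
  then show "eval_xy (deriv_y sq) (fst z) (snd z) = 2 * (fst (F z) * fy z + snd (F z) * gy z)"
    using has_field_derivative_eval_y DERIV_unique by blast
qed

text \<open>\<open>X\<close> is the Hamiltonian field of \<open>sq / 2\<close>, which is constant
  along its own flow.\<close>

lemma gradient_sq_X: "gradient sq z (X z) = 0"
proof -
  have "X z = (- (fst (F z) * fy z + snd (F z) * gy z), fst (F z) * fx z + snd (F z) * gx z)"
    by (simp add: X_def hamiltonian_field_def F_def poly_map_def fx_def fy_def gx_def gy_def)
  then show ?thesis unfolding gradient_def deriv_sq by (simp add: algebra_simps)
qed

end

section \<open>The flat first integral\<close>

context bijective_map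
begin

text \<open>The gradient of \<open>sq / 2\<close> is the transpose of \<open>DF z\<close> applied to
  \<open>F z\<close>, and \<open>DF z\<close> is invertible.\<close>

lemma sq_not_critical:
  assumes "z \<noteq> 0"
  shows "eval_xy (deriv_x sq) (fst z) (snd z) \<noteq> 0 \<or> eval_xy (deriv_y sq) (fst z) (snd z) \<noteq> 0"
proof (rule ccontr)
  assume "\<not> ?thesis"
  then have z: "fst (F z) * fx z + snd (F z) * gx z = 0" "fst (F z) * fy z + snd (F z) * gy z = 0"
    unfolding deriv_sq by auto
  have "fst (F z) * J z = (fst (F z) * fx z + snd (F z) * gx z) * gy z - (fst (F z) * fy z + snd (F z) * gy z) * gx z"
    "snd (F z) * J z = (fst (F z) * fy z + snd (F z) * gy z) * fx z - (fst (F z) * fx z + snd (F z) * gx z) * fy z"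
    unfolding J_eq by algebra+
  then have "fst (F z) * J z = 0" "snd (F z) * J z = 0" unfolding z by simp_all
  then have "F z = 0" using J_pos[of z] by (simp add: prod_eq_iff)
  with assms show False by simp
qed

text \<open>Two ellipses are tried. \<open>L 1\<close> is zero if \<open>norm (F z)\<close> is
  constant on circles, but \<open>L 1\<close> and \<open>L 2\<close> cannot both be zero: their
  values at \<open>(1, 1)\<close> would make that point critical for \<open>sq\<close>.\<close>

lemma sq_growth:
  obtains C N r where "0 < C" "\<forall>z. r \<le> norm z \<longrightarrow> (norm z)\<^sup>2 \<le> C * ((norm (F z))\<^sup>2) ^ N"
proof -
  define L where "L = (\<lambda>\<kappa>. var_x * deriv_y sq - [:[:\<kappa>:]:] * (var_y * deriv_x sq))"
  have "L 1 \<noteq> 0 \<or> L 2 \<noteq> 0"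
  proof (rule ccontr)
    assume "\<not> ?thesis"
    then have "eval_xy (L 1) 1 1 = 0" "eval_xy (L 2) 1 1 = 0" by simp_all
    then have "eval_xy (deriv_x sq) 1 1 = 0" "eval_xy (deriv_y sq) 1 1 = 0" by (simp_all add: L_def)
    then show False using sq_not_critical[of "(1, 1)"] by (simp add: zero_prod_def)
  qed
  then obtain \<kappa> :: real where \<kappa>: "1 \<le> \<kappa>" "L \<kappa> \<noteq> 0" by (metis one_le_numeral order.refl)
  have proper: "\<exists>r. \<forall>x y. r \<le> x\<^sup>2 + y\<^sup>2 \<longrightarrow> M \<le> eval_xy sq x y" for M
  proof -
    obtain K where K: "0 < K" "\<And>z. K < norm z \<Longrightarrow> \<bar>M\<bar> + 1 < norm (F z)"
      by (rule F_proper[of "\<bar>M\<bar> + 1"]) (rule that; blast)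
    have "M \<le> eval_xy sq x y" if "(K + 1)\<^sup>2 \<le> x\<^sup>2 + y\<^sup>2" for x y
    proof -
      have "(K + 1)\<^sup>2 \<le> (norm (x, y))\<^sup>2" unfolding norm_prod_power2 using that by simp
      then have "K + 1 \<le> norm (x, y)" by (rule power2_le_imp_le) simp
      then have n: "\<bar>M\<bar> + 1 < norm (F (x, y))" by (intro K(2)) simp
      then have "(\<bar>M\<bar> + 1) * 1 \<le> norm (F (x, y)) * norm (F (x, y))" by (intro mult_mono) auto
      then show ?thesis using eval_sq[of "(x, y)"] by (simp add: power2_eq_square)
    qed
    then show ?thesis by blast
  qed
  obtain C N r where C: "0 < C" "\<forall>x y. r \<le> x\<^sup>2 + y\<^sup>2 \<longrightarrow> x\<^sup>2 + y\<^sup>2 \<le> C * eval_xy sq x y ^ N"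
    using polynomial_growth[OF \<kappa>(1) \<kappa>(2)[unfolded L_def] proper] .
  have "(norm z)\<^sup>2 \<le> C * ((norm (F z))\<^sup>2) ^ N" if "1 + \<bar>r\<bar> \<le> norm z" for z
  proof -
    have "1 * (1 + \<bar>r\<bar>) \<le> norm z * norm z" using that by (intro mult_mono) auto
    moreover have "r \<le> 1 * (1 + \<bar>r\<bar>)" by simp
    ultimately have "r \<le> (norm z)\<^sup>2" unfolding power2_eq_square by (rule order_trans[rotated])
    then have "r \<le> (fst z)\<^sup>2 + (snd z)\<^sup>2" unfolding norm_prod_power2 .
    then have "(fst z)\<^sup>2 + (snd z)\<^sup>2 \<le> C * eval_xy sq (fst z) (snd z) ^ N" using C(2) by blast
    then show ?thesis unfolding eval_sq norm_prod_power2[of z] .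
  qed
  then show ?thesis using that C(1) by blast
qed

lemma sq_at_top: "filterlim (\<lambda>z. (norm (F z))\<^sup>2) at_top at_infinity"
  unfolding filterlim_at_top
proof
  fix Z :: real
  obtain K where K: "0 < K" "\<And>z. K < norm z \<Longrightarrow> \<bar>Z\<bar> + 1 < norm (F z)"
    by (rule F_proper[of "\<bar>Z\<bar> + 1"]) (rule that; blast)
  have "Z \<le> (norm (F z))\<^sup>2" if "K + 1 \<le> norm z" for z
  proof -
    have "\<bar>Z\<bar> + 1 < norm (F z)" using K(2) that by simp
    then have "(\<bar>Z\<bar> + 1) * 1 \<le> norm (F z) * norm (F z)" by (intro mult_mono) auto
    then show ?thesis by (simp add: power2_eq_square)
  qed
  then show "\<forall>\<^sub>F z in at_infinity. Z \<le> (norm (F z))\<^sup>2" unfolding eventually_at_infinity by blast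
qed

text \<open>The factor \<open>norm z\<close> stands for the reciprocal of the increment in a
  difference quotient at the inverted origin. By \<open>sq_growth\<close> powers of
  \<open>norm z\<close> are bounded by powers of \<open>(norm (F z))\<^sup>2\<close>, which the
  exponential outweighs.\<close>

lemma exponential_decay:
  "((\<lambda>z. norm z * \<bar>eval_xy P (fst z) (snd z)\<bar> * exp (- (norm (F z))\<^sup>2)) \<longlongrightarrow> 0) at_infinity"
proof -
  obtain C N r where C: "0 < C" "\<forall>z. r \<le> norm z \<longrightarrow> (norm z)\<^sup>2 \<le> C * ((norm (F z))\<^sup>2) ^ N"
    using sq_growth .
  obtain C1 M where C1: "0 \<le> C1" "\<And>x y. \<bar>eval_xy P x y\<bar> \<le> C1 * (1 + norm (x, y)) ^ M"
    using eval_xy_polynomial_growth[of P] by blast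
  define k where "k = N * (M + 1)"
  define C2 where "C2 = C1 * (2 * C) ^ (M + 1)"
  have bound: "norm z * \<bar>eval_xy P (fst z) (snd z)\<bar> \<le> C2 * ((norm (F z))\<^sup>2) ^ k" if "max 1 r \<le> norm z" for z
  proof -
    have "1 * 1 \<le> norm z * norm z" "norm z * 1 \<le> norm z * norm z" using that by (intro mult_mono; simp)+
    then have "1 + norm z \<le> 2 * (norm z)\<^sup>2" by (simp add: power2_eq_square)
    also have "(norm z)\<^sup>2 \<le> C * ((norm (F z))\<^sup>2) ^ N" using C(2)[rule_format, of z] that by simp
    then have "2 * (norm z)\<^sup>2 \<le> 2 * (C * ((norm (F z))\<^sup>2) ^ N)" by simp
    finally have b: "1 + norm z \<le> 2 * C * ((norm (F z))\<^sup>2) ^ N" by simp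
    have "norm z * \<bar>eval_xy P (fst z) (snd z)\<bar> \<le> (1 + norm z) * (C1 * (1 + norm z) ^ M)"
      using C1(2)[of "fst z" "snd z"] by (intro mult_mono) auto
    also have "\<dots> = C1 * (1 + norm z) ^ (M + 1)" by simp
    also have "\<dots> \<le> C1 * (2 * C * ((norm (F z))\<^sup>2) ^ N) ^ (M + 1)"
      using C1(1) b by (intro mult_left_mono power_mono) auto
    also have "\<dots> = C2 * ((norm (F z))\<^sup>2) ^ k"
      unfolding C2_def k_def by (simp only: power_mult_distrib power_mult mult.assoc)
    finally show ?thesis .
  qed
  have lim: "((\<lambda>z. C2 * (((norm (F z))\<^sup>2) ^ k / exp ((norm (F z))\<^sup>2))) \<longlongrightarrow> C2 * 0) at_infinity"
    by (intro tendsto_mult tendsto_const filterlim_compose[OF tendsto_power_div_exp_0 sq_at_top])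
  show ?thesis
  proof (rule Lim_null_comparison)
    have "norm (norm z * \<bar>eval_xy P (fst z) (snd z)\<bar> * exp (- (norm (F z))\<^sup>2))
        \<le> C2 * (((norm (F z))\<^sup>2) ^ k / exp ((norm (F z))\<^sup>2))" if "max 1 r \<le> norm z" for z
    proof -
      have "norm z * \<bar>eval_xy P (fst z) (snd z)\<bar> * exp (- (norm (F z))\<^sup>2)
          \<le> C2 * ((norm (F z))\<^sup>2) ^ k * exp (- (norm (F z))\<^sup>2)"
        by (intro mult_right_mono bound that) simp
      also have "\<dots> = C2 * (((norm (F z))\<^sup>2) ^ k / exp ((norm (F z))\<^sup>2))"
        by (simp only: exp_minus divide_inverse mult.assoc)
      finally show ?thesis by (simp add: abs_mult)
    qed
    then show "\<forall>\<^sub>F z in at_infinity. norm (norm z * \<bar>eval_xy P (fst z) (snd z)\<bar> * exp (- (norm (F z))\<^sup>2))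
        \<le> C2 * (((norm (F z))\<^sup>2) ^ k / exp ((norm (F z))\<^sup>2))"
      unfolding eventually_at_infinity by blast
  qed (use lim in simp)
qed

text \<open>These functions form a class that is closed under partial derivatives, because the derivative of
  the inversion is a polynomial in the inverted point.\<close>

definition flat :: "poly_xy \<Rightarrow> real \<times> real \<Rightarrow> real" where
  "flat P u = (if u = 0 then 0 else eval_xy P (fst (inversion u)) (snd (inversion u)) * exp (- (norm (F (inversion u)))\<^sup>2))"

definition flat_deriv :: "poly_xy \<Rightarrow> real \<times> real \<Rightarrow> real \<times> real \<Rightarrow> real" where
  "flat_deriv P u h = (if u = 0 then 0 else
     exp (- (norm (F (inversion u)))\<^sup>2) * (gradient P (inversion u) (inversion_deriv u h) -
       eval_xy P (fst (inversion u)) (snd (inversion u)) * gradient sq (inversion u) (inversion_deriv u h)))"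

text \<open>At the origin the difference quotient in \<open>h\<close>, written in terms of
  \<open>inversion h\<close>, is the expression of \<open>exponential_decay\<close>; elsewhere the
  chain rule applies.\<close>

lemma flat_has_derivative: "(flat P has_derivative flat_deriv P u) (at u)"
proof (cases "u = 0")
  case True
  have "((\<lambda>h. norm (flat P (0 + h) - flat P 0 - 0) / norm h) \<longlongrightarrow> 0) (at 0)"
  proof (rule tendstoI)
    fix e :: real assume e: "0 < e"
    obtain b where b: "\<And>z. b \<le> norm z \<Longrightarrow>
        dist (norm z * \<bar>eval_xy P (fst z) (snd z)\<bar> * exp (- (norm (F z))\<^sup>2)) 0 < e"
      using tendstoD[OF exponential_decay e, unfolded eventually_at_infinity] by blast
    have "dist (norm (flat P (0 + h) - flat P 0 - 0) / norm h) 0 < e"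
      if h: "h \<noteq> 0" "dist h 0 < inverse (\<bar>b\<bar> + 1)" for h
    proof -
      have "inverse (inverse (\<bar>b\<bar> + 1)) < inverse (norm h)" using h by (intro less_imp_inverse_less) auto
      then have "b \<le> norm (inversion h)" by simp
      from b[OF this] show ?thesis using h(1) by (simp add: flat_def abs_mult divide_inverse mult_ac)
    qed
    moreover have "0 < inverse (\<bar>b\<bar> + 1)" by simp
    ultimately show "\<forall>\<^sub>F h in at 0. dist (norm (flat P (0 + h) - flat P 0 - 0) / norm h) 0 < e"
      unfolding eventually_at by blast
  qed
  moreover have "flat_deriv P 0 = (\<lambda>h. 0)" by (simp add: flat_deriv_def fun_eq_iff)
  ultimately show ?thesis unfolding True has_derivative_at by simp
next
  case False
  define \<Phi> where "\<Phi> = (\<lambda>z. eval_xy P (fst z) (snd z) * exp (- eval_xy sq (fst z) (snd z)))"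
  have d\<Phi>: "(\<Phi> has_derivative (\<lambda>h. exp (- eval_xy sq (fst z) (snd z)) * (gradient P z h -
      eval_xy P (fst z) (snd z) * gradient sq z h))) (at z)" for z
    unfolding \<Phi>_def
    by (rule has_derivative_eq_rhs, (rule derivative_eq_intros has_derivative_gradient refl)+)
      (simp add: fun_eq_iff algebra_simps)
  have "((\<lambda>u. \<Phi> (inversion u)) has_derivative (\<lambda>h. exp (- eval_xy sq (fst (inversion u)) (snd (inversion u))) *
      (gradient P (inversion u) (inversion_deriv u h) -
      eval_xy P (fst (inversion u)) (snd (inversion u)) * gradient sq (inversion u) (inversion_deriv u h)))) (at u)"
    by (rule has_derivative_compose[OF inversion_has_derivative[OF False] d\<Phi>])
  then have "((\<lambda>u. \<Phi> (inversion u)) has_derivative flat_deriv P u) (at u)"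
    using False unfolding flat_deriv_def[abs_def] eval_sq by simp
  then show ?thesis
  proof (rule has_derivative_transform_within_open)
    show "open (- {0} :: (real \<times> real) set)" by (intro open_Compl closed_singleton)
    show "\<Phi> (inversion v) = flat P v" if "v \<in> - {0}" for v
      using that by (simp add: \<Phi>_def flat_def eval_sq)
  qed (use False in simp)
qed

lemma flat_deriv_flat:
  assumes "b \<in> Basis"
  shows "\<exists>Q. (\<lambda>u. flat_deriv P u b) = flat Q"
proof -
  define A where "A = deriv_x P - P * deriv_x sq"
  define A' where "A' = deriv_y P - P * deriv_y sq"
  have i: "inversion_deriv u h = (((snd (inversion u))\<^sup>2 - (fst (inversion u))\<^sup>2) * fst h
      - 2 * fst (inversion u) * snd (inversion u) * snd h,
      ((fst (inversion u))\<^sup>2 - (snd (inversion u))\<^sup>2) * snd h - 2 * fst (inversion u) * snd (inversion u) * fst h)"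
    if "u \<noteq> 0" for u h
    using inversion_deriv_inversion[of "inversion u" h] that by simp
  have two: "eval_xy 2 x y = 2" for x y
    by (metis eval_xy_simps(2,3) one_add_one)
  consider "b = (1, 0)" | "b = (0, 1)" using Basis_real_prod[OF assms] by blast
  then show ?thesis
  proof cases
    case 1
    have "flat_deriv P u b = flat (A * (var_y\<^sup>2 - var_x\<^sup>2) - A' * (2 * var_x * var_y)) u" for u
      by (simp add: flat_deriv_def flat_def i gradient_def A_def A'_def 1 two algebra_simps)
    then show ?thesis by blast
  next
    case 2
    have "flat_deriv P u b = flat (A' * (var_x\<^sup>2 - var_y\<^sup>2) - A * (2 * var_x * var_y)) u" for u
      by (simp add: flat_deriv_def flat_def i gradient_def A_def A'_def 2 two algebra_simps)
    then show ?thesis by blast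
  qed
qed

lemma Ck_on_flat: "Ck_on k UNIV (flat P)"
  unfolding Ck_on_def
proof (intro allI impI)
  fix n
  show "Cn_on n UNIV (flat P)"
  proof (rule Cn_on_closed_class[where \<C> = "range flat"])
    fix \<phi> assume "\<phi> \<in> range flat"
    then obtain P where \<phi>: "\<phi> = flat P" by blast
    show "\<phi> differentiable (at z)" for z unfolding \<phi> differentiable_def using flat_has_derivative by blast
    show "(\<lambda>z. frechet_derivative \<phi> (at z) b) \<in> range flat" if "b \<in> Basis" for b
      unfolding \<phi> frechet_derivative_at[OF flat_has_derivative, symmetric] using flat_deriv_flat[OF that] by fastforce
  qed simp
qed

lemma first_integral_flat: "first_integral_on B UNIV (flat 1)"
  unfolding first_integral_on_def
proof (intro conjI allI impI)
  fix V :: "(real \<times> real) set" assume V: "open V \<and> V \<noteq> {} \<and> V \<subseteq> UNIV"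
  show "\<not> flat 1 constant_on V"
  proof
    assume "flat 1 constant_on V"
    then obtain c where c: "\<And>v. v \<in> V \<Longrightarrow> flat 1 v = c" unfolding constant_on_def by blast
    have "V \<noteq> {0}" using V not_open_singleton[of "0::real \<times> real"] by auto
    then obtain u where u: "u \<in> V" "u \<noteq> 0" using V by blast
    define w where "w = F (inversion u)"
    have w0: "w \<noteq> 0" using u by (simp add: w_def)
    \<comment> \<open>A curve through \<open>u\<close> across the levels: it lifts the ray through
      \<open>w\<close>, so \<open>flat 1\<close> has the value
      \<open>exp (- (t * norm w)\<^sup>2)\<close> on it.\<close>
    define s where "s = (\<lambda>t. inversion (G (t *\<^sub>R w)))"
    have "continuous_on {0<..} s"
      unfolding s_def
      by (rule continuous_on_inversion, rule continuous_on_compose2[OF continuous_on_G_UNIV[of UNIV]])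
        (use w0 in \<open>auto intro!: continuous_on_scaleR continuous_on_id continuous_on_const\<close>)
    then have "open ({0<..} \<inter> s -` V)" using V by (intro continuous_open_preimage) auto
    moreover have "s 1 = u" by (simp add: s_def w_def)
    then have "1 \<in> {0<..} \<inter> s -` V" using u by simp
    ultimately obtain e where e: "0 < e" "ball 1 e \<subseteq> {0<..} \<inter> s -` V" using open_contains_ball by blast
    define t where "t = 1 + e / 2"
    have t: "t \<in> ball 1 e" using e by (simp add: t_def dist_real_def)
    have val: "flat 1 (s t) = exp (- (t * norm w)\<^sup>2)" if "0 < t" for t
    proof -
      have "s t \<noteq> 0" using that w0 by (simp add: s_def)
      then show ?thesis using that by (simp add: flat_def s_def abs_mult)
    qed
    have "t \<in> {0<..} \<inter> s -` V" using t e(2) by blast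
    then have "flat 1 (s t) = flat 1 (s 1)" using c u \<open>s 1 = u\<close> by simp
    then have "(t * norm w)\<^sup>2 = (1 * norm w)\<^sup>2" using val[of t] val[of 1] e by (simp add: t_def)
    then have "t * norm w = 1 * norm w" using e by (simp add: t_def power2_eq_iff_nonneg)
    then show False using w0 e by (simp add: t_def)
  qed
next
  fix \<gamma> I assume "solves B \<gamma> I \<and> \<gamma> ` I \<subseteq> UNIV"
  then have I: "is_interval I" and \<gamma>: "\<And>t. t \<in> I \<Longrightarrow> (\<gamma> has_vector_derivative B (\<gamma> t)) (at t within I)"
    by (auto simp: solves_def)
  have z: "flat_deriv 1 u (B u) = 0" for u
  proof (cases "u = 0")
    case False
    have "inversion_deriv u (B u) = norm u ^ (2 * dd) *\<^sub>R X (inversion u)"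
      unfolding B_eq[OF False] inversion_deriv_scaleR inversion_deriv_inverse[OF False] ..
    moreover have "gradient sq z (c *\<^sub>R h) = c * gradient sq z h" for z c h by (simp add: gradient_def algebra_simps)
    ultimately have "gradient sq (inversion u) (inversion_deriv u (B u)) = 0" by (simp add: gradient_sq_X)
    moreover have "gradient 1 z h = 0" for z h
    proof -
      have "((\<lambda>z. eval_xy 1 (fst z) (snd z)) has_derivative (\<lambda>h. 0)) (at z)" by simp
      from has_derivative_unique[OF has_derivative_gradient this] show ?thesis by simp
    qed
    ultimately show ?thesis by (simp add: flat_deriv_def)
  qed (simp add: flat_deriv_def)
  have "((\<lambda>t. flat 1 (\<gamma> t)) has_real_derivative 0) (at t within I)" if t: "t \<in> I" for t
  proof -
    have "(flat 1 \<circ> \<gamma> has_derivative flat_deriv 1 (\<gamma> t) \<circ> (\<lambda>h. h *\<^sub>R B (\<gamma> t))) (at t within I)"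
      using \<gamma>[OF t] unfolding has_vector_derivative_def
      by (rule diff_chain_within[OF _ has_derivative_at_withinI[OF flat_has_derivative]])
    moreover have "flat_deriv 1 (\<gamma> t) (h *\<^sub>R B (\<gamma> t)) = 0" for h
      using linear_scale[OF has_derivative_linear[OF flat_has_derivative]] z by simp
    moreover have "(*) 0 = (\<lambda>h::real. 0::real)" by (simp add: fun_eq_iff)
    ultimately show ?thesis by (simp add: has_field_derivative_def o_def)
  qed
  then show "(\<lambda>t. flat 1 (\<gamma> t)) constant_on I"
    using has_field_derivative_zero_constant[of I "\<lambda>t. flat 1 (\<gamma> t)"] I
    unfolding constant_on_def is_interval_convex_1 by blast
qed auto

lemma isolated_minimum_flat: "isolated_minimum_at (flat 1) 0"
  unfolding isolated_minimum_at_def eventually_at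
  by (intro exI[of _ 1]) (simp add: flat_def)

end

section \<open>Smoothness of the inverse map\<close>

context bijective_map
begin

text \<open>The derivative of \<open>G\<close> is \<open>DFinv\<close> at \<open>G w\<close>, with
  entries that are polynomials divided by \<open>J\<close>. So these quotients form a class closed
  under partial derivatives.\<close>

definition pulled_back :: "poly_xy \<Rightarrow> nat \<Rightarrow> real \<times> real \<Rightarrow> real" where
  "pulled_back P m w = eval_xy P (fst (G w)) (snd (G w)) / J (G w) ^ m"

lemma pulled_back_has_derivative:
  "(pulled_back P m has_derivative (\<lambda>h. (J (G w) * gradient P (G w) (DFinv (G w) h) -
     real m * eval_xy P (fst (G w)) (snd (G w)) * gradient (jacobian_det (f, g)) (G w) (DFinv (G w) h)) /
     J (G w) ^ (m + 1))) (at w)"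
proof -
  define z where "z = G w"
  have Jz: "J z \<noteq> 0" using J_pos[of z] by simp
  have dJ: "(J has_derivative gradient (jacobian_det (f, g)) z) (at z)"
    using has_derivative_gradient[of "jacobian_det (f, g)" z] by (simp add: J_def[abs_def])
  have "((\<lambda>z. eval_xy P (fst z) (snd z) / J z ^ m) has_derivative (\<lambda>h. (gradient P z h * J z ^ m -
      eval_xy P (fst z) (snd z) * (of_nat m * gradient (jacobian_det (f, g)) z h * J z ^ (m - 1))) / (J z ^ m * J z ^ m))) (at z)"
    by (rule has_derivative_divide'[OF has_derivative_gradient has_derivative_power[OF dJ]]) (use Jz in simp)
  moreover have "(gradient P z h * J z ^ m - eval_xy P (fst z) (snd z) * (of_nat m * c * J z ^ (m - 1))) / (J z ^ m * J z ^ m) =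
      (J z * gradient P z h - real m * eval_xy P (fst z) (snd z) * c) / J z ^ (m + 1)" for h c
    using Jz by (cases m) (simp_all add: field_simps)
  ultimately have "((\<lambda>z. eval_xy P (fst z) (snd z) / J z ^ m) has_derivative (\<lambda>h. (J z * gradient P z h -
      real m * eval_xy P (fst z) (snd z) * gradient (jacobian_det (f, g)) z h) / J z ^ (m + 1))) (at z)"
    by simp
  from has_derivative_compose[OF G_has_derivative[of w] this[unfolded z_def]] show ?thesis
    by (simp add: D_UNIV pulled_back_def[abs_def] z_def)
qed

lemma gradient_DFinv:
  assumes "b \<in> Basis"
  obtains P' where "\<forall>z. gradient P z (DFinv z b) = eval_xy P' (fst z) (snd z) / J z"
proof -
  consider "b = (1, 0)" | "b = (0, 1)" using Basis_real_prod[OF assms] by blast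
  then show ?thesis
  proof cases
    case 1
    show ?thesis
      by (rule that[of "deriv_x P * deriv_y g - deriv_y P * deriv_x g"])
        (simp add: 1 gradient_def DFinv_def gx_def gy_def diff_divide_distrib)
  next
    case 2
    show ?thesis
      by (rule that[of "deriv_y P * deriv_x f - deriv_x P * deriv_y f"])
        (simp add: 2 gradient_def DFinv_def fx_def fy_def diff_divide_distrib)
  qed
qed

lemma pulled_back_deriv:
  assumes "b \<in> Basis"
  obtains Q n where "\<forall>w. (J (G w) * gradient P (G w) (DFinv (G w) b) -
     real m * eval_xy P (fst (G w)) (snd (G w)) * gradient (jacobian_det (f, g)) (G w) (DFinv (G w) b)) /
     J (G w) ^ (m + 1) = pulled_back Q n w"
proof -
  obtain P' where P': "\<forall>z. gradient P z (DFinv z b) = eval_xy P' (fst z) (snd z) / J z"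
    using gradient_DFinv[OF assms] .
  obtain J' where J': "\<forall>z. gradient (jacobian_det (f, g)) z (DFinv z b) = eval_xy J' (fst z) (snd z) / J z"
    using gradient_DFinv[OF assms] .
  define Q where "Q = jacobian_det (f, g) * P' - [:[:real m:]:] * P * J'"
  have "(J z * (p' / J z) - real m * p * (j' / J z)) / J z ^ (m + 1) = (J z * p' - real m * p * j') / J z ^ (m + 2)" for z p p' j'
    using J_pos[of z] by (simp add: field_simps)
  then show ?thesis
    by (intro that[of Q "m + 2"]) (simp add: P' J' pulled_back_def Q_def J_def[symmetric])
qed

text \<open>\<open>\<sigma>\<close> will be the identity or the exchange of coordinates; the
  exchange occurs when the Jacobian determinant is negative and \<open>f\<close> and
  \<open>g\<close> trade places.\<close>

lemma Cn_on_pulled_back: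
  fixes \<sigma> :: "real \<times> real \<Rightarrow> real \<times> real"
  assumes \<sigma>: "bounded_linear \<sigma>" "\<And>b. b \<in> Basis \<Longrightarrow> \<sigma> b \<in> Basis"
  shows "Cn_on n UNIV (\<lambda>w. (pulled_back P m (\<sigma> w), pulled_back Q l (\<sigma> w)))"
proof (rule Cn_on_closed_class[where \<C> = "{\<lambda>w. (pulled_back P m (\<sigma> w), pulled_back Q l (\<sigma> w)) |P m Q l. True}"])
  define D' where "D' = (\<lambda>P m w h. (J (G w) * gradient P (G w) (DFinv (G w) h) -
     real m * eval_xy P (fst (G w)) (snd (G w)) * gradient (jacobian_det (f, g)) (G w) (DFinv (G w) h)) /
     J (G w) ^ (m + 1))"
  have d: "((\<lambda>w. (pulled_back P m (\<sigma> w), pulled_back Q l (\<sigma> w))) has_derivative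
      (\<lambda>h. (D' P m (\<sigma> w) (\<sigma> h), D' Q l (\<sigma> w) (\<sigma> h)))) (at w)" for P m Q l w
    unfolding D'_def
    by (intro has_derivative_Pair has_derivative_compose[OF bounded_linear_imp_has_derivative[OF \<sigma>(1)] pulled_back_has_derivative])
  fix \<phi> assume "\<phi> \<in> {\<lambda>w. (pulled_back P m (\<sigma> w), pulled_back Q l (\<sigma> w)) |P m Q l. True}"
  then obtain P m Q l where \<phi>: "\<phi> = (\<lambda>w. (pulled_back P m (\<sigma> w), pulled_back Q l (\<sigma> w)))" by blast
  show "\<phi> differentiable (at w)" for w unfolding \<phi> differentiable_def using d by blast
  fix b :: "real \<times> real" assume b: "b \<in> Basis"
  obtain P' m' where 1: "\<forall>w. D' P m w (\<sigma> b) = pulled_back P' m' w"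
    using pulled_back_deriv[OF \<sigma>(2)[OF b], of P m] unfolding D'_def .
  obtain Q' l' where 2: "\<forall>w. D' Q l w (\<sigma> b) = pulled_back Q' l' w"
    using pulled_back_deriv[OF \<sigma>(2)[OF b], of Q l] unfolding D'_def .
  show "(\<lambda>w. frechet_derivative \<phi> (at w) b) \<in> {\<lambda>w. (pulled_back P m (\<sigma> w), pulled_back Q l (\<sigma> w)) |P m Q l. True}"
  proof -
    have "(\<lambda>w. (D' P m (\<sigma> w) (\<sigma> b), D' Q l (\<sigma> w) (\<sigma> b))) = (\<lambda>w. (pulled_back P' m' (\<sigma> w), pulled_back Q' l' (\<sigma> w)))"
      by (rule ext) (simp only: 1[rule_format] 2[rule_format])
    then show ?thesis unfolding \<phi> frechet_derivative_at[OF d, symmetric] by blast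
  qed
qed blast

lemma inv_F: "inv F = G"
  by (rule inv_equality) simp_all

text \<open>With exponent \<open>0\<close> and the polynomials \<open>var_x\<close> and
  \<open>var_y\<close> the pulled back pair is \<open>G\<close> itself.\<close>

lemma Ck_on_G:
  fixes \<sigma> :: "real \<times> real \<Rightarrow> real \<times> real"
  assumes "bounded_linear \<sigma>" "\<And>b. b \<in> Basis \<Longrightarrow> \<sigma> b \<in> Basis"
  shows "Ck_on k UNIV (\<lambda>w. G (\<sigma> w))"
  using Cn_on_pulled_back[OF assms, of _ var_x 0 var_y 0] by (simp add: Ck_on_def pulled_back_def)

end

section \<open>The equivalences for a positive Jacobian determinant\<close>

context positive_jacobian
begin

text \<open>Each condition is proved for bijective maps and refuted for all others, which gives both
  directions at once.\<close>

lemma bij_iff_center_monodromic_sectors: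
  shows "bij F \<longleftrightarrow> is_center B 0" "bij F \<longleftrightarrow> is_monodromic B 0" "bij F \<longleftrightarrow> \<not> (\<exists>S. hyperbolic_sector B 0 S)"
proof -
  have pos: "is_center B 0 \<and> is_monodromic B 0 \<and> \<not> (\<exists>S. hyperbolic_sector B 0 S)" if "bij F"
  proof -
    interpret bijective_map f g by unfold_locales (rule that)
    show ?thesis using is_center_B is_monodromic_B no_hyperbolic_sector by blast
  qed
  have neg: "\<not> is_center B 0 \<and> \<not> is_monodromic B 0 \<and> (\<exists>S. hyperbolic_sector B 0 S)" if nb: "\<not> bij F"
  proof -
    obtain R where "0 < R" "ball 0 R \<subseteq> D" "\<exists>w. norm w = R \<and> w \<notin> D" "\<exists>w. norm w = R \<and> w \<in> D"
      using not_bij_radius[OF nb] .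
    then interpret nonproper_map f g R by unfold_locales
    show ?thesis using not_center not_monodromic hyperbolic_sector_exists by blast
  qed
  show "bij F \<longleftrightarrow> is_center B 0" "bij F \<longleftrightarrow> is_monodromic B 0" "bij F \<longleftrightarrow> \<not> (\<exists>S. hyperbolic_sector B 0 S)"
    using pos neg by blast+
qed

text \<open>The function \<open>flat 1\<close> serves all \<open>k\<close>. Conversely, a continuous
  first integral with an isolated minimum excludes hyperbolic sectors, and their absence is
  bijectivity.\<close>

lemma bij_iff_first_integral:
  assumes "1 \<le> k"
  shows "bij F \<longleftrightarrow> (\<exists>U H. 0 \<in> U \<and> first_integral_on B U H \<and> Ck_on k U H \<and> isolated_minimum_at H 0)"
proof
  assume "bij F"
  then interpret bijective_map f g by unfold_locales
  show "\<exists>U H. 0 \<in> U \<and> first_integral_on B U H \<and> Ck_on k U H \<and> isolated_minimum_at H 0"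
    using first_integral_flat Ck_on_flat isolated_minimum_flat by blast
next
  assume "\<exists>U H. 0 \<in> U \<and> first_integral_on B U H \<and> Ck_on k U H \<and> isolated_minimum_at H 0"
  then obtain U H where H: "0 \<in> U" "first_integral_on B U H" "Ck_on k U H" "isolated_minimum_at H 0" by blast
  have "enat 0 \<le> k" by (simp add: zero_enat_def[symmetric])
  then have "Cn_on 0 U H" using H(3) unfolding Ck_on_def by blast
  then have "\<not> (\<exists>S. hyperbolic_sector B 0 S)"
    using sector_excludes_first_integral H by blast
  then show "bij F" using bij_iff_center_monodromic_sectors(3) by blast
qed

end

section \<open>The sign of the Jacobian determinant and the exchange of the components\<close>

lemma poly_map_swap: "poly_map (q, p) = prod.swap \<circ> poly_map (p, q)"
  by (simp add: poly_map_def fun_eq_iff)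

lemma bij_swap_comp: "bij (prod.swap \<circ> h) \<longleftrightarrow> bij h"
  using bij_comp[of "prod.swap \<circ> h" prod.swap] bij_comp[of h prod.swap] by (auto simp: comp_assoc[symmetric])

text \<open>The Hamiltonian is symmetric in the two components, so the exchange that makes the
  determinant positive leaves \<open>B\<close> unchanged.\<close>

lemma hamiltonian_field_swap: "hamiltonian_field (q, p) = hamiltonian_field (p, q)"
  by (simp add: hamiltonian_field_def)

lemma jacobian_det_constant_sign:
  assumes "\<And>x y. eval_xy p x y \<noteq> 0"
  shows "(\<forall>x y. 0 < eval_xy p x y) \<or> (\<forall>x y. eval_xy p x y < 0)"
proof (rule ccontr)
  assume "\<not> ?thesis"
  then obtain x y x' y' where xy: "eval_xy p x y < 0" "0 < eval_xy p x' y'"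
    using assms by (metis linorder_neqE_linordered_idom)
  define m where "m = (\<lambda>z. eval_xy p (fst z) (snd z))"
  have "continuous_on UNIV m"
    unfolding m_def by (intro continuous_on_eval_xy continuous_on_fst continuous_on_snd continuous_on_id)
  then have "connected (range m)" using connected_continuous_image connected_UNIV by blast
  then have "is_interval (range m)" by (simp add: is_interval_connected_1)
  moreover have "m (x, y) \<in> range m" "m (x', y') \<in> range m" by auto
  ultimately have "0 \<in> range m"
    by (rule mem_is_interval_1_I) (use xy in \<open>simp_all add: m_def\<close>)
  then show False using assms by (auto simp: m_def)
qed

lemma global_diffeomorphism_iff_bij:
  assumes J: "\<And>x y. eval_xy (jacobian_det (f, g)) x y \<noteq> 0" and 0: "poly_map (f, g) (0, 0) = (0, 0)"
  shows "global_diffeomorphism (poly_map (f, g)) \<longleftrightarrow> bij (poly_map (f, g))"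
proof
  assume bij: "bij (poly_map (f, g))"
  have "Ck_on \<infinity> UNIV (inv (poly_map (f, g)))"
    using jacobian_det_constant_sign[OF J]
  proof
    assume "\<forall>x y. 0 < eval_xy (jacobian_det (f, g)) x y"
    then interpret positive_jacobian f g by unfold_locales (use 0 in auto)
    interpret bijective_map f g by unfold_locales (use bij F_def in simp)
    have "Ck_on \<infinity> UNIV (\<lambda>w. G (id w))" by (rule Ck_on_G) (auto simp: id_def bounded_linear_ident)
    then show ?thesis using inv_F by (simp add: F_def)
  next
    \<comment> \<open>The exchanged map has a positive determinant, and its inverse composed with
      the exchange inverts the given map.\<close>
    assume neg: "\<forall>x y. eval_xy (jacobian_det (f, g)) x y < 0"
    have "eval_xy (jacobian_det (g, f)) x y = - eval_xy (jacobian_det (f, g)) x y" for x y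
      by (simp add: jacobian_det_def mult.commute)
    then interpret positive_jacobian g f
      using neg 0 by unfold_locales (simp_all add: poly_map_swap[of g f])
    have F: "F = prod.swap \<circ> poly_map (f, g)" unfolding F_def by (rule poly_map_swap)
    interpret bijective_map g f by unfold_locales (simp add: bij F bij_swap_comp)
    have "inv (poly_map (f, g)) = (\<lambda>w. G (prod.swap w))"
    proof (rule inv_equality)
      show "G (prod.swap (poly_map (f, g) z)) = z" for z using GF[of z] F by simp
      show "poly_map (f, g) (G (prod.swap w)) = w" for w
        using FG[of "prod.swap w"] unfolding F by (metis comp_apply swap_swap)
    qed
    moreover have "bounded_linear (prod.swap :: real \<times> real \<Rightarrow> real \<times> real)"
      unfolding linear_conv_bounded_linear[symmetric] by (rule linearI) auto
    then have "Ck_on \<infinity> UNIV (\<lambda>w. G (prod.swap w))"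
      by (rule Ck_on_G) (auto dest!: Basis_real_prod simp: Basis_prod_def)
    ultimately show ?thesis by simp
  qed
  moreover have "Ck_on \<infinity> UNIV (poly_map (f, g))" by (simp add: Ck_on_def Cn_on_poly_map)
  ultimately show "global_diffeomorphism (poly_map (f, g))" using bij by (simp add: global_diffeomorphism_def)
qed (simp add: global_diffeomorphism_def)

theorem theorem3:
  fixes f g :: "real poly poly" and k :: enat
  defines "F \<equiv> poly_map (f, g)"
    and "B \<equiv> poly_map (bendixson (hamiltonian_field (f, g)))"
  assumes "\<And>x y. eval_xy (jacobian_det (f, g)) x y \<noteq> 0"
    and "F (0, 0) = (0, 0)"
    and "1 \<le> k"
  shows "(global_diffeomorphism F \<longleftrightarrow> is_center B (0, 0)) \<and>
         (is_center B (0, 0) \<longleftrightarrow> is_monodromic B (0, 0)) \<and>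
         (is_monodromic B (0, 0) \<longleftrightarrow> \<not> (\<exists>S. hyperbolic_sector B (0, 0) S)) \<and>
         (\<not> (\<exists>S. hyperbolic_sector B (0, 0) S) \<longleftrightarrow>
            (\<exists>U H. (0, 0) \<in> U \<and> first_integral_on B U H \<and> Ck_on k U H \<and>
                   isolated_minimum_at H (0, 0)))"
proof -
  have diffeo: "global_diffeomorphism F \<longleftrightarrow> bij F"
    unfolding F_def by (rule global_diffeomorphism_iff_bij) (use assms in auto)
  have "(bij F \<longleftrightarrow> is_center B 0) \<and> (bij F \<longleftrightarrow> is_monodromic B 0) \<and>
      (bij F \<longleftrightarrow> \<not> (\<exists>S. hyperbolic_sector B 0 S)) \<and>
      (bij F \<longleftrightarrow> (\<exists>U H. 0 \<in> U \<and> first_integral_on B U H \<and> Ck_on k U H \<and> isolated_minimum_at H 0))"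
    using jacobian_det_constant_sign[OF assms(3)]
  proof
    assume pos: "\<forall>x y. 0 < eval_xy (jacobian_det (f, g)) x y"
    interpret positive_jacobian f g by unfold_locales (use pos assms(4) F_def in auto)
    show ?thesis
      using bij_iff_center_monodromic_sectors bij_iff_first_integral[OF assms(5)]
      unfolding F_def B_def assms(1,2) by blast
  next
    assume neg: "\<forall>x y. eval_xy (jacobian_det (f, g)) x y < 0"
    have "eval_xy (jacobian_det (g, f)) x y = - eval_xy (jacobian_det (f, g)) x y" for x y
      by (simp add: jacobian_det_def mult.commute)
    then interpret positive_jacobian g f
      using neg assms(4) F_def by unfold_locales (simp_all add: poly_map_swap[of g f])
    show ?thesis
      using bij_iff_center_monodromic_sectors bij_iff_first_integral[OF assms(5)]
      unfolding F_def B_def assms(1,2) hamiltonian_field_swap[of g f] poly_map_swap[of g f] bij_swap_comp by blast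
  qed
  then show ?thesis unfolding diffeo zero_prod_def[symmetric] by blast
qed

end
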